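(* Let $C\subset\mathcal H$ be a nonempty, closed and convex set and assume that $f$ satisfies $(\mathcal H^f)$ and $g$ satisfies $(\mathcal H^g)$ (these conditions are spelled out in the context). Then for any $x_0\in C$ there exists a unique absolutely continuous solution $x\colon I\to\mathcal H$ of the integro-differential projected dynamical system $$ \dot x(t)=\operatorname{proj}_{T_C(x(t))}\Big(f(t,x(t))+\int_{T_0}^tg(t,s,x(s))\,ds\Big)\quad\text{for a.e. } t\in I,\qquad x(T_0)=x_0 . $$ Moreover, $x$ is a slow solution of $$ \dot x(t)\in-N_C(x(t))+f(t,x(t))+\int_{T_0}^tg(t,s,x(s))\,ds\quad\text{for a.e. } t\in I,\qquad x(T_0)=x_0, $$ and, with $\gamma(t):=2\beta(t)+2\int_{T_0}^t\sigma(t,s)\,ds$, the following bounds hold: $$ \|x(t)\|\le r(t):=\|x_0\|\exp\Big(\int_{T_0}^t\gamma(s)\,ds\Big)+\int_{T_0}^t\gamma(s)\exp\Big(\int_s^t\gamma(\tau)\,d\tau\Big)ds\quad\text{for all } t\in I, $$ $$ \|\dot x(t)\|\le\theta(t):=\gamma(t)(1+r(t))\quad\text{for a.e. } t\in I. $$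
   Context: $\mathcal H$ is a real Hilbert space with norm $\|\cdot\|$; $\mathbb B$ is its closed unit ball; $I=[T_0,T]$ with $-\infty<T_0<T<+\infty$; $D:=\{(t,s)\in I\times I: s\le t\}$. For a closed convex set $C$ and $x\in C$, $T_C(x)$ is the tangent cone (closure of $\bigcup_{\lambda>0}\lambda(C-x)$) and $N_C(x)=\{v:\langle v,y-x\rangle\le0\ \forall y\in C\}$ the normal cone; both are empty if $x\notin C$, so solutions take values in $C$. $\operatorname{proj}_K$ is the metric projection onto a closed convex set $K$. Slow solution: an absolutely continuous $x\colon I\to\mathcal H$ with $x(T_0)=x_0$ is a slow solution of the differential inclusion $\dot x(t)\in-N_C(x(t))+f(t,x(t))+\int_{T_0}^tg(t,s,x(s))\,ds$ for a.e. $t\in I$, $x(T_0)=x_0$, if $\dot x(t)=-\bar\nu(t)+f(t,x(t))+\int_{T_0}^tg(t,s,x(s))\,ds$ for a.e. $t\in I$, where $\bar\nu(t)$ is the minimizer over $\nu\in N_C(x(t))$ of $\|f(t,x(t))+\int_{T_0}^tg(t,s,x(s))\,ds-\nu\|$. $(\mathcal H^f)$: $f\colon I\times\mathcal H\to\mathcal H$ satisfies: (a) for each $x\in\mathcal H$, $t\mapsto f(t,x)$ is measurable; (b) for all $r>0$ there is an integrable $\kappa_r\colon I\to\mathbb R_+$ with $\|f(t,x)-f(t,y)\|\le\kappa_r(t)\|x-y\|$ for all $t\in I$, $x,y\in r\mathbb B$; (c) there is a nonnegative integrable $\beta\colon I\to\mathbb R$ with $\|f(t,x)\|\le\beta(t)(1+\|x\|)$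 for all $t\in I$, $x\in\mathcal H$. $(\mathcal H^g)$: $g\colon I\times I\times\mathcal H\to\mathcal H$ satisfies: (a) for each $x\in\mathcal H$, $(t,s)\mapsto g(t,s,x)$ is measurable; (b) for all $r>0$ there is an integrable $\mu_r\colon I\to\mathbb R_+$ with $\|g(t,s,x)-g(t,s,y)\|\le\mu_r(t)\|x-y\|$ for all $(t,s)\in D$, $x,y\in r\mathbb B$; (c) there is a nonnegative integrable $\sigma\colon D\to\mathbb R$ with $\|g(t,s,x)\|\le\sigma(t,s)(1+\|x\|)$ for all $(t,s)\in D$, $x\in\mathcal H$. *)

theory Defs
  imports "HOL-Analysis.Analysis"
begin

text \<open>
  A real Hilbert space is a type of sort \<open>{real_inner, banach}\<close>; it is not assumed to be separable.
  Since the Bochner integral of the library is restricted to second countable codomains, integrals are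
  Henstock--Kurzweil integrals (\<^term>\<open>integral\<close>), which agree with Bochner integrals on every
  Bochner integrable function. Measurability of Hilbert space valued functions is \<open>measurable_on\<close>:
  being an almost everywhere limit of continuous functions, that is, strong Lebesgue measurability.
\<close>

definition absolutely_continuous_fun_on :: "(real \<Rightarrow> 'h::real_normed_vector) \<Rightarrow> real set \<Rightarrow> bool" where
  "absolutely_continuous_fun_on x S \<longleftrightarrow>
    (\<forall>\<epsilon>>0. \<exists>\<delta>>0. \<forall>(n::nat) (a::nat \<Rightarrow> real) (b::nat \<Rightarrow> real).
      (\<forall>i<n. a i \<le> b i \<and> {a i..b i} \<subseteq> S) \<longrightarrow>
      disjoint_family_on (\<lambda>i. {a i<..<b i}) {..<n} \<longrightarrow>
      (\<Sum>i<n. b i - a i) < \<delta> \<longrightarrow>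
      (\<Sum>i<n. norm (x (b i) - x (a i))) < \<epsilon>)"

definition tangent_cone :: "'h::real_normed_vector set \<Rightarrow> 'h \<Rightarrow> 'h set" where
  "tangent_cone C x =
    (if x \<in> C then closure (\<Union>l\<in>{0<..}. (\<lambda>y. l *\<^sub>R (y - x)) ` C) else {})"

definition normal_cone :: "'h::real_inner set \<Rightarrow> 'h \<Rightarrow> 'h set" where
  "normal_cone C x = (if x \<in> C then {v. \<forall>y\<in>C. inner v (y - x) \<le> 0} else {})"

text \<open>
  The library's \<open>closest_point\<close> is not available here, as it requires a Heine--Borel space.
  The value is unspecified when \<open>K\<close> is empty.
\<close>

definition metric_proj :: "'h::metric_space set \<Rightarrow> 'h \<Rightarrow> 'h" where
  "metric_proj K u = arg_min_on (\<lambda>p. dist u p) K"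

definition triangle :: "real \<Rightarrow> real \<Rightarrow> (real \<times> real) set" where
  "triangle T0 T = {(t, s). t \<in> {T0..T} \<and> s \<in> {T0..T} \<and> s \<le> t}"

definition cond_f ::
  "real \<Rightarrow> real \<Rightarrow> (real \<Rightarrow> 'h::{real_inner, banach} \<Rightarrow> 'h) \<Rightarrow> (real \<Rightarrow> real) \<Rightarrow> bool" where
  "cond_f T0 T f \<beta> \<longleftrightarrow>
    (\<forall>x. (\<lambda>t. f t x) measurable_on {T0..T}) \<and>
    (\<forall>r>0. \<exists>\<kappa>::real \<Rightarrow> real. \<kappa> absolutely_integrable_on {T0..T} \<and> (\<forall>t\<in>{T0..T}. 0 \<le> \<kappa> t) \<and>
      (\<forall>t\<in>{T0..T}. \<forall>x\<in>cball 0 r. \<forall>y\<in>cball 0 r. norm (f t x - f t y) \<le> \<kappa> t * norm (x - y))) \<and>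
    \<beta> absolutely_integrable_on {T0..T} \<and> (\<forall>t\<in>{T0..T}. 0 \<le> \<beta> t) \<and>
    (\<forall>t\<in>{T0..T}. \<forall>x. norm (f t x) \<le> \<beta> t * (1 + norm x))"

definition cond_g ::
  "real \<Rightarrow> real \<Rightarrow> (real \<Rightarrow> real \<Rightarrow> 'h::{real_inner, banach} \<Rightarrow> 'h) \<Rightarrow> (real \<Rightarrow> real \<Rightarrow> real) \<Rightarrow> bool" where
  "cond_g T0 T g \<sigma> \<longleftrightarrow>
    (\<forall>x. (\<lambda>(t, s). g t s x) measurable_on ({T0..T} \<times> {T0..T})) \<and>
    (\<forall>r>0. \<exists>\<mu>::real \<Rightarrow> real. \<mu> absolutely_integrable_on {T0..T} \<and> (\<forall>t\<in>{T0..T}. 0 \<le> \<mu> t) \<and>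
      (\<forall>(t, s)\<in>triangle T0 T. \<forall>x\<in>cball 0 r. \<forall>y\<in>cball 0 r.
        norm (g t s x - g t s y) \<le> \<mu> t * norm (x - y))) \<and>
    (\<lambda>(t, s). \<sigma> t s) absolutely_integrable_on triangle T0 T \<and>
    (\<forall>(t, s)\<in>triangle T0 T. 0 \<le> \<sigma> t s) \<and>
    (\<forall>(t, s)\<in>triangle T0 T. \<forall>x. norm (g t s x) \<le> \<sigma> t s * (1 + norm x))"

definition drift ::
  "real \<Rightarrow> (real \<Rightarrow> 'h::{real_inner, banach} \<Rightarrow> 'h) \<Rightarrow> (real \<Rightarrow> real \<Rightarrow> 'h \<Rightarrow> 'h) \<Rightarrow>
   (real \<Rightarrow> 'h) \<Rightarrow> real \<Rightarrow> 'h" where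
  "drift T0 f g x t = f t (x t) + integral {T0..t} (\<lambda>s. g t s (x s))"

text \<open>
  The conjunct \<open>x t \<in> C\<close> expresses that the projection onto the tangent cone is taken
  over a nonempty set.
\<close>

definition projected_solution ::
  "real \<Rightarrow> real \<Rightarrow> 'h::{real_inner, banach} set \<Rightarrow> (real \<Rightarrow> 'h \<Rightarrow> 'h) \<Rightarrow>
   (real \<Rightarrow> real \<Rightarrow> 'h \<Rightarrow> 'h) \<Rightarrow> 'h \<Rightarrow> (real \<Rightarrow> 'h) \<Rightarrow> bool" where
  "projected_solution T0 T C f g x0 x \<longleftrightarrow>
    absolutely_continuous_fun_on x {T0..T} \<and> x T0 = x0 \<and>
    (AE t in lebesgue_on {T0..T}. x t \<in> C \<and>
      (x has_vector_derivative metric_proj (tangent_cone C (x t)) (drift T0 f g x t))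
        (at t within {T0..T}))"

definition slow_solution ::
  "real \<Rightarrow> real \<Rightarrow> 'h::{real_inner, banach} set \<Rightarrow> (real \<Rightarrow> 'h \<Rightarrow> 'h) \<Rightarrow>
   (real \<Rightarrow> real \<Rightarrow> 'h \<Rightarrow> 'h) \<Rightarrow> 'h \<Rightarrow> (real \<Rightarrow> 'h) \<Rightarrow> bool" where
  "slow_solution T0 T C f g x0 x \<longleftrightarrow>
    absolutely_continuous_fun_on x {T0..T} \<and> x T0 = x0 \<and>
    (AE t in lebesgue_on {T0..T}. \<exists>\<nu>.
      is_arg_min (\<lambda>\<nu>. norm (drift T0 f g x t - \<nu>)) (\<lambda>\<nu>. \<nu> \<in> normal_cone C (x t)) \<nu> \<and>
      (x has_vector_derivative (- \<nu> + drift T0 f g x t)) (at t within {T0..T}))"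

end

theory Submission
  imports Defs
begin

text \<open>
  For a fixed integrable \<open>h\<close>, Moreau's catching-up algorithm, which adds the increment of \<open>\<integral> h\<close> over a
  dyadic interval and projects onto \<open>C\<close>, converges uniformly by monotonicity of the normal cone. The
  limit is absolutely continuous and satisfies the variational inequality
  \<open>\<parallel>x t - y\<parallel>\<^sup>2 - \<parallel>x s - y\<parallel>\<^sup>2 \<le> 2 (x s - y) \<bullet> (H t - H s) + 2 (M t - M s)\<^sup>2\<close> for \<open>y \<in> C\<close>, where \<open>H\<close> and
  \<open>M\<close> are the indefinite integrals of \<open>h\<close> and \<open>\<parallel>h\<parallel>\<close>. A Hilbert space has the Radon--Nikodym property,
  so \<open>x\<close> is differentiable almost everywhere, and differentiating the inequality puts \<open>h t - x' t\<close> into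
  the normal cone at \<open>x t\<close>. Both \<open>x' t\<close> and \<open>- x' t\<close> are tangent to \<open>C\<close>, hence orthogonal to
  \<open>h t - x' t\<close>; by Moreau's decomposition \<open>x' t\<close> is the projection of \<open>h t\<close> onto the tangent cone, and
  \<open>h t - x' t\<close> is the normal vector nearest to \<open>h t\<close>. Monotonicity also bounds the distance of two such
  curves by the integral of \<open>\<parallel>h1 - h2\<parallel>\<close>. Hence mapping \<open>x\<close> to the trajectory driven by
  \<open>drift T0 f g x\<close> is a contraction for an exponentially weighted supremum norm, and its fixed point is
  the solution; \<open>\<parallel>x'\<parallel> \<le> \<parallel>h\<parallel>\<close> and a Gronwall argument along the Picard iterates give the bounds.
\<close>


subsection \<open>Absolutely continuous functions of a real variable\<close>

lemma negligible_uminus_image: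
  fixes N :: "real set"
  assumes "negligible N"
  shows "negligible (uminus ` N)"
  using assms by (intro negligible_differentiable_image_negligible) (auto intro!: derivative_intros simp: differentiable_on_def)

lemma indefinite_integral_differentiable_ae:
  fixes f :: "real \<Rightarrow> real"
  assumes f: "f integrable_on {a..b}"
  obtains N where "negligible N"
    "\<And>t. t \<in> {a<..<b} - N \<Longrightarrow> ((\<lambda>u. integral {a..u} f) has_real_derivative f t) (at t)"
proof -
  define F where "F = (\<lambda>x. if x \<in> {a..b} then f x else 0)"
  have FU: "F integrable_on UNIV"
    using f unfolding F_def by (simp only: integrable_restrict_UNIV)
  have F: "F integrable_on {c..d}" for c d
    using integrable_on_subinterval[OF FU, of c d] by auto
  have R: "(\<lambda>x. F (- x)) integrable_on {c..d}" for c d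
    using F[of "-d" "-c"] Henstock_Kurzweil_Integration.integrable_reflect_real[of F "-c" "-d"] by simp
  obtain N1 where N1: "negligible N1" "\<And>x e. \<lbrakk>x \<notin> N1; 0 < e\<rbrakk> \<Longrightarrow>
      \<exists>d>0. \<forall>h. 0 < h \<and> h < d \<longrightarrow> \<bar>integral {x..x + h} F / h - F x\<bar> < e"
    using integrable_ccontinuous_explicit[of F] F by (auto simp: field_simps)
  obtain N2 where N2: "negligible N2" "\<And>x e. \<lbrakk>x \<notin> N2; 0 < e\<rbrakk> \<Longrightarrow>
      \<exists>d>0. \<forall>h. 0 < h \<and> h < d \<longrightarrow> \<bar>integral {x..x + h} (\<lambda>x. F (- x)) / h - F (- x)\<bar> < e"
    using integrable_ccontinuous_explicit[of "\<lambda>x. F (- x)"] R by (auto simp: field_simps)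
  show ?thesis
  proof
    show "negligible (N1 \<union> uminus ` N2)"
      using N1(1) N2(1) negligible_uminus_image by auto
    fix t assume t: "t \<in> {a<..<b} - (N1 \<union> uminus ` N2)"
    have t2: "- t \<notin> N2" using t by (metis DiffD2 UnCI imageI minus_minus)
    have "(\<lambda>h. (integral {a..t + h} f - integral {a..t} f) / h) \<midarrow>0\<rightarrow> f t"
    proof (rule LIM_I)
      fix e :: real assume e: "0 < e"
      obtain d1 where d1: "d1 > 0" "\<And>h. 0 < h \<Longrightarrow> h < d1 \<Longrightarrow> \<bar>integral {t..t + h} F / h - F t\<bar> < e"
        using N1(2)[of t e] t e by auto
      obtain d2 where d2: "d2 > 0" "\<And>h. 0 < h \<Longrightarrow> h < d2 \<Longrightarrow> \<bar>integral {-t..-t + h} (\<lambda>x. F (- x)) / h - F t\<bar> < e"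
        using N2(2)[of "-t" e] t2 e by auto
      define d where "d = Min {d1, d2, t - a, b - t}"
      have d: "0 < d" "d \<le> d1" "d \<le> d2" "d \<le> t - a" "d \<le> b - t"
        using d1(1) d2(1) t by (auto simp: d_def)
      have "\<bar>(integral {a..t + h} f - integral {a..t} f) / h - f t\<bar> < e" if h: "h \<noteq> 0" "\<bar>h\<bar> < d" for h
      proof (cases "h > 0")
        case True
        have "integral {a..t} f + integral {t..t+h} f = integral {a..t+h} f"
          using True h d t by (intro Henstock_Kurzweil_Integration.integral_combine integrable_on_subinterval[OF f]) auto
        moreover have "integral {t..t+h} f = integral {t..t+h} F"
          using h d t by (intro integral_cong) (auto simp: F_def)
        ultimately have eq: "integral {a..t + h} f - integral {a..t} f = integral {t..t+h} F"
          by linarith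
        have "F t = f t" using t by (simp add: F_def)
        then show ?thesis using d1(2)[of h] True h d unfolding eq by simp
      next
        case False
        then have hn: "h < 0" using h by simp
        have "integral {a..t+h} f + integral {t+h..t} f = integral {a..t} f"
          using hn h d t by (intro Henstock_Kurzweil_Integration.integral_combine integrable_on_subinterval[OF f]) auto
        moreover have "integral {t+h..t} f = integral {t+h..t} F"
          using h d t by (intro integral_cong) (auto simp: F_def)
        moreover have "integral {t+h..t} F = integral {-t..-t-h} (\<lambda>x. F (-x))"
          using Henstock_Kurzweil_Integration.integral_reflect_real[of t "t+h" F] by simp
        ultimately have eq: "(integral {a..t + h} f - integral {a..t} f) = - integral {-t..-t-h} (\<lambda>x. F (-x))"
          by linarith
        have "\<bar>integral {-t..-t + (-h)} (\<lambda>x. F (- x)) / (-h) - F t\<bar> < e"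
          using d2(2)[of "-h"] hn h d by auto
        then show ?thesis unfolding eq using t by (simp add: F_def)
      qed
      then show "\<exists>s>0. \<forall>x. x \<noteq> 0 \<and> norm (x - 0) < s \<longrightarrow>
          norm ((integral {a..t + x} f - integral {a..t} f) / x - f t) < e"
        using d(1) by (intro exI[of _ d]) auto
    qed
    then show "((\<lambda>u. integral {a..u} f) has_real_derivative f t) (at t)"
      by (simp add: DERIV_def)
  qed
qed

lemma absolutely_continuous_fun_on_imp_continuous_on:
  fixes x :: "real \<Rightarrow> 'h::real_normed_vector"
  assumes x: "absolutely_continuous_fun_on x {a..b}"
  shows "continuous_on {a..b} x"
  unfolding continuous_on_iff
proof (intro ballI allI impI)
  fix t e :: real assume t: "t \<in> {a..b}" and e: "0 < e"
  obtain d where d: "d > 0" "\<And>(n::nat) A B. (\<forall>i<n. A i \<le> B i \<and> {A i..B i} \<subseteq> {a..b}) \<Longrightarrow>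
      disjoint_family_on (\<lambda>i. {A i<..<B i}) {..<n} \<Longrightarrow>
      (\<Sum>i<n. B i - A i) < d \<Longrightarrow>
      (\<Sum>i<n. norm (x (B i) - x (A i))) < e"
    using x e unfolding absolutely_continuous_fun_on_def by meson
  have "dist (x s) (x t) < e" if s: "s \<in> {a..b}" "dist s t < d" for s
  proof -
    have "(\<Sum>i<Suc 0. norm (x (max s t) - x (min s t))) < e"
      using s t by (intro d(2)) (auto simp: dist_real_def disjoint_family_on_def)
    then show ?thesis by (auto simp: dist_norm max_def min_def norm_minus_commute split: if_splits)
  qed
  then show "\<exists>d>0. \<forall>x'\<in>{a..b}. dist x' t < d \<longrightarrow> dist (x x') (x t) < e"
    using d(1) by blast
qed

lemma absolutely_continuous_fun_on_finite_family:
  fixes x :: "real \<Rightarrow> 'h::real_normed_vector"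
  assumes x: "absolutely_continuous_fun_on x S" and e: "0 < e"
  shows "\<exists>d>0. \<forall>(I :: 'i set) A B. finite I \<longrightarrow> (\<forall>i\<in>I. A i \<le> B i \<and> {A i..B i} \<subseteq> S) \<longrightarrow>
      disjoint_family_on (\<lambda>i. {A i<..<B i}) I \<longrightarrow> (\<Sum>i\<in>I. B i - A i) < d
     \<longrightarrow> (\<Sum>i\<in>I. norm (x (B i) - x (A i))) < e"
proof -
  obtain d where d: "d > 0" "\<And>(n::nat) A B. (\<forall>i<n. A i \<le> B i \<and> {A i..B i} \<subseteq> S) \<Longrightarrow>
      disjoint_family_on (\<lambda>i. {A i<..<B i}) {..<n} \<Longrightarrow>
      (\<Sum>i<n. B i - A i) < d \<Longrightarrow>
      (\<Sum>i<n. norm (x (B i) - x (A i))) < e"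
    using x e unfolding absolutely_continuous_fun_on_def by meson
  show ?thesis
  proof (intro exI[of _ d] conjI allI impI)
    show "d > 0" by (fact d(1))
    fix I :: "'i set" and A B :: "'i \<Rightarrow> real"
    assume I: "finite I" and AB: "\<forall>i\<in>I. A i \<le> B i \<and> {A i..B i} \<subseteq> S"
      and dis: "disjoint_family_on (\<lambda>i. {A i<..<B i}) I" and sm: "(\<Sum>i\<in>I. B i - A i) < d"
    obtain h where h: "bij_betw h {..<card I} I"
      using ex_bij_betw_nat_finite[OF I] by (auto simp: atLeast0LessThan)
    have hI: "h i \<in> I" if "i < card I" for i using h that by (auto simp: bij_betw_def)
    have inj: "h i \<noteq> h j" if "i < card I" "j < card I" "i \<noteq> j" for i j
      using h that by (auto simp: bij_betw_def inj_on_def)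
    have "(\<Sum>i<card I. norm (x (B (h i)) - x (A (h i)))) < e"
    proof (rule d(2))
      show "\<forall>i<card I. A (h i) \<le> B (h i) \<and> {A (h i)..B (h i)} \<subseteq> S" using AB hI by blast
      show "disjoint_family_on (\<lambda>i. {A (h i)<..<B (h i)}) {..<card I}"
        unfolding disjoint_family_on_def
      proof (intro ballI impI)
        fix m n assume "m \<in> {..<card I}" "n \<in> {..<card I}" "m \<noteq> n"
        then show "{A (h m)<..<B (h m)} \<inter> {A (h n)<..<B (h n)} = {}"
          using dis hI inj unfolding disjoint_family_on_def by (meson lessThan_iff)
      qed
      show "(\<Sum>i<card I. B (h i) - A (h i)) < d"
        using sm sum.reindex_bij_betw[OF h, of "\<lambda>i. B i - A i"] by simp
    qed
    then show "(\<Sum>i\<in>I. norm (x (B i) - x (A i))) < e"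
      using sum.reindex_bij_betw[OF h, of "\<lambda>i. norm (x (B i) - x (A i))"] by simp
  qed
qed

text \<open>In a fine division the intervals tagged in the exceptional null set have small total length;
  absolute continuity makes their contribution small.\<close>

lemma has_integral_absolutely_continuous:
  fixes x :: "real \<Rightarrow> 'h::banach"
  assumes ab: "a \<le> b" and x: "absolutely_continuous_fun_on x {a..b}" and N: "negligible N"
    and der: "\<And>t. t \<in> {a..b} - N \<Longrightarrow> (x has_vector_derivative d t) (at t within {a..b})"
  shows "(d has_integral (x b - x a)) {a..b}"
proof -
  define d' where "d' = (\<lambda>t. if t \<in> N then 0 else d t)"
  have "(d' has_integral (x b - x a)) {a..b}"
    unfolding has_integral_real
  proof (intro allI impI)
    fix e :: real assume e: "0 < e"
    define e1 where "e1 = e / (2 * (b - a + 1))"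
    have e1: "e1 > 0" using e ab by (simp add: e1_def)
    have "\<exists>r>0. \<forall>u v. u \<le> t \<longrightarrow> t \<le> v \<longrightarrow> {u..v} \<subseteq> {a..b} \<longrightarrow> {u..v} \<subseteq> ball t r \<longrightarrow>
        norm ((v - u) *\<^sub>R d t - (x v - x u)) \<le> e1 * (v - u)" if t: "t \<in> {a..b} - N" for t
    proof -
      have "\<exists>r>0. \<forall>y\<in>{a..b}. norm (y - t) < r \<longrightarrow> norm (x y - x t - (y - t) *\<^sub>R d t) \<le> e1 * norm (y - t)"
        using der[OF t] e1 unfolding has_vector_derivative_def has_derivative_within_alt by auto
      then obtain r where r: "r > 0" "\<And>y. y \<in> {a..b} \<Longrightarrow> \<bar>y - t\<bar> < r \<Longrightarrow>
          norm (x y - x t - (y - t) *\<^sub>R d t) \<le> e1 * \<bar>y - t\<bar>" by auto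
      have "norm ((v - u) *\<^sub>R d t - (x v - x u)) \<le> e1 * (v - u)"
        if uv: "u \<le> t" "t \<le> v" "{u..v} \<subseteq> {a..b}" "{u..v} \<subseteq> ball t r" for u v
      proof -
        have "u \<in> {u..v}" "v \<in> {u..v}" using uv by auto
        then have m: "u \<in> {a..b}" "v \<in> {a..b}" "\<bar>u - t\<bar> < r" "\<bar>v - t\<bar> < r"
          using uv(3,4) by (auto simp: dist_real_def abs_minus_commute subset_eq)
        have "(v - u) *\<^sub>R d t - (x v - x u) = (x u - x t - (u - t) *\<^sub>R d t) - (x v - x t - (v - t) *\<^sub>R d t)"
          by (simp add: algebra_simps)
        also have "norm \<dots> \<le> e1 * \<bar>u - t\<bar> + e1 * \<bar>v - t\<bar>"
          using r(2)[OF m(1,3)] r(2)[OF m(2,4)] norm_triangle_ineq4 by (smt (verit))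
        also have "\<dots> = e1 * (v - u)" using uv by (simp add: algebra_simps)
        finally show ?thesis .
      qed
      with r(1) show ?thesis by blast
    qed
    then have "\<forall>t\<in>{a..b} - N. \<exists>r. r > 0 \<and> (\<forall>u v. u \<le> t \<longrightarrow> t \<le> v \<longrightarrow> {u..v} \<subseteq> {a..b} \<longrightarrow>
        {u..v} \<subseteq> ball t r \<longrightarrow> norm ((v - u) *\<^sub>R d t - (x v - x u)) \<le> e1 * (v - u))"
      by (intro ballI)
    from bchoice[OF this] obtain r where r0: "\<forall>t\<in>{a..b} - N. r t > 0 \<and>
        (\<forall>u v. u \<le> t \<longrightarrow> t \<le> v \<longrightarrow> {u..v} \<subseteq> {a..b} \<longrightarrow>
        {u..v} \<subseteq> ball t (r t) \<longrightarrow> norm ((v - u) *\<^sub>R d t - (x v - x u)) \<le> e1 * (v - u))" ..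
    have r: "\<And>t. t \<in> {a..b} - N \<Longrightarrow> r t > 0"
        "\<And>t u v. t \<in> {a..b} - N \<Longrightarrow> u \<le> t \<Longrightarrow> t \<le> v \<Longrightarrow> {u..v} \<subseteq> {a..b} \<Longrightarrow> {u..v} \<subseteq> ball t (r t) \<Longrightarrow>
        norm ((v - u) *\<^sub>R d t - (x v - x u)) \<le> e1 * (v - u)"
      using r0 by blast+
    define g1 where "g1 = (\<lambda>t. if t \<in> {a..b} - N then ball t (r t) else ball t 1)"
    have g1: "gauge g1" using r(1) by (auto simp: g1_def gauge_def)
    obtain \<delta> where \<delta>: "\<delta> > 0" "\<forall>(I :: (real \<times> real set) set) A B. finite I \<longrightarrow> (\<forall>i\<in>I. A i \<le> B i \<and> {A i..B i} \<subseteq> {a..b}) \<longrightarrow>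
      disjoint_family_on (\<lambda>i. {A i<..<B i}) I \<longrightarrow> (\<Sum>i\<in>I. B i - A i) < \<delta>
     \<longrightarrow> (\<Sum>i\<in>I. norm (x (B i) - x (A i))) < e / 2"
      using absolutely_continuous_fun_on_finite_family[OF x half_gt_zero[OF e]] by blast
    have "((indicator N :: real \<Rightarrow> real) has_integral 0) {a..b}"
      using N by (simp add: negligible_def flip: box_real)
    from this[unfolded has_integral_real, rule_format, OF \<delta>(1)]
    obtain g2 where g20: "gauge g2 \<and> (\<forall>D. D tagged_division_of {a..b} \<and> g2 fine D \<longrightarrow>
        norm ((\<Sum>(t,k)\<in>D. measure lborel k *\<^sub>R (indicator N t :: real)) - 0) < \<delta>)" ..
    have g2: "gauge g2" "\<And>D. D tagged_division_of {a..b} \<Longrightarrow> g2 fine D \<Longrightarrow>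
        norm ((\<Sum>(t,k)\<in>D. measure lborel k *\<^sub>R (indicator N t :: real)) - 0) < \<delta>"
      using g20 by (blast, iprover)
    have "norm ((\<Sum>(t,k)\<in>D. measure lborel k *\<^sub>R d' t) - (x b - x a)) < e"
      if D: "D tagged_division_of {a..b}" "(\<lambda>t. g1 t \<inter> g2 t) fine D" for D
    proof -
      have fin: "finite D" using D(1) by blast
      have fine: "g1 fine D" "g2 fine D" using D(2) by (auto simp: fine_Int)
      have cell: "\<exists>u v. k = {u..v} \<and> u \<le> t \<and> t \<le> v \<and> {u..v} \<subseteq> {a..b}" if "(t,k) \<in> D" for t k
        using tagged_division_ofD(2,3,4)[OF D(1) that] by (metis atLeastAtMost_iff box_real(2))
      have sum: "(\<Sum>(t,k)\<in>D. x (Sup k) - x (Inf k)) = x b - x a"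
        by (rule additive_tagged_division_1[OF ab D(1)])
      define D1 where "D1 = {p \<in> D. fst p \<notin> N}"
      define D2 where "D2 = {p \<in> D. fst p \<in> N}"
      have DD: "D = D1 \<union> D2" "D1 \<inter> D2 = {}" "finite D1" "finite D2" "D1 \<subseteq> D" "D2 \<subseteq> D"
        using fin by (auto simp: D1_def D2_def)
      let ?E = "\<lambda>(t,k). norm (measure lborel k *\<^sub>R d' t - (x (Sup k) - x (Inf k)))"
      have "norm ((\<Sum>(t,k)\<in>D. measure lborel k *\<^sub>R d' t) - (x b - x a))
          = norm (\<Sum>(t,k)\<in>D. measure lborel k *\<^sub>R d' t - (x (Sup k) - x (Inf k)))"
        by (simp add: sum[symmetric] sum_subtractf split_def)
      also have "\<dots> \<le> (\<Sum>p\<in>D. ?E p)" by (rule order_trans[OF norm_sum]) (auto simp: split_def)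
      also have "\<dots> = (\<Sum>p\<in>D1. ?E p) + (\<Sum>p\<in>D2. ?E p)"
        using DD by (simp only: sum.union_disjoint[of D1 D2, symmetric])
      also have "(\<Sum>p\<in>D1. ?E p) \<le> (\<Sum>p\<in>D1. e1 * measure lborel (snd p))"
      proof (rule sum_mono)
        fix p assume "p \<in> D1"
        then obtain t k where p: "p = (t,k)" "(t,k) \<in> D" "t \<notin> N" by (cases p) (auto simp: D1_def)
        obtain u v where uv: "k = {u..v}" "u \<le> t" "t \<le> v" "{u..v} \<subseteq> {a..b}" using cell[OF p(2)] by blast
        have t: "t \<in> {a..b} - N" using uv p(3) by auto
        have "{u..v} \<subseteq> ball t (r t)"
          using fine(1) p(2) t uv(1) unfolding fine_def g1_def by fastforce
        then show "?E p \<le> e1 * measure lborel (snd p)"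
          using r(2)[OF t uv(2,3,4)] uv p t by (simp add: d'_def)
      qed
      also have "\<dots> \<le> (\<Sum>p\<in>D. e1 * measure lborel (snd p))"
        using DD fin e1 by (intro sum_mono2) auto
      also have "\<dots> = e1 * (b - a)"
        using additive_content_tagged_division[of D a b] D(1) ab
        by (simp add: sum_distrib_left[symmetric] split_def)
      also have "\<dots> \<le> e / 2"
        using e ab by (simp add: e1_def field_simps)
      also have "(\<Sum>p\<in>D2. ?E p) = (\<Sum>p\<in>D2. norm (x (Sup (snd p)) - x (Inf (snd p))))"
        by (intro sum.cong) (auto simp: D2_def d'_def norm_minus_commute)
      also have "\<dots> < e / 2"
      proof (rule \<delta>(2)[rule_format, OF DD(4)])
        show "Inf (snd p) \<le> Sup (snd p) \<and> {Inf (snd p)..Sup (snd p)} \<subseteq> {a..b}" if "p \<in> D2" for p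
        proof -
          have "p \<in> D" using that DD(6) by blast
          then obtain u v where "snd p = {u..v}" "u \<le> fst p" "fst p \<le> v" "{u..v} \<subseteq> {a..b}"
            using cell[of "fst p" "snd p"] by auto
          then show ?thesis by auto
        qed
        show "disjoint_family_on (\<lambda>p. {Inf (snd p)<..<Sup (snd p)}) D2"
          unfolding disjoint_family_on_def
        proof (intro ballI impI)
          fix p q assume pq: "p \<in> D2" "q \<in> D2" "p \<noteq> q"
          have "interior (snd p) \<inter> interior (snd q) = {}"
            using tagged_division_ofD(5)[OF D(1), of "fst p" "snd p" "fst q" "snd q"] pq DD(6) by auto
          moreover have "interior (snd p) = {Inf (snd p)<..<Sup (snd p)}" if "p \<in> D2" for p
          proof -
            have "p \<in> D" using that DD(6) by blast
            then obtain u v where "snd p = {u..v}" "u \<le> fst p" "fst p \<le> v" "{u..v} \<subseteq> {a..b}"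
              using cell[of "fst p" "snd p"] by auto
            then show ?thesis by (auto simp: interior_atLeastAtMost_real)
          qed
          ultimately show "{Inf (snd p)<..<Sup (snd p)} \<inter> {Inf (snd q)<..<Sup (snd q)} = {}"
            using pq by auto
        qed
        have "(\<Sum>p\<in>D2. Sup (snd p) - Inf (snd p)) = (\<Sum>p\<in>D2. measure lborel (snd p) * indicator N (fst p))"
          using cell DD(6) by (intro sum.cong) (fastforce simp: D2_def)+
        also have "\<dots> \<le> (\<Sum>p\<in>D. measure lborel (snd p) * indicator N (fst p))"
          using DD fin by (intro sum_mono2) auto
        also have "\<dots> < \<delta>"
          using g2(2)[OF D(1) fine(2)] by (auto simp: split_def)
        finally show "(\<Sum>p\<in>D2. Sup (snd p) - Inf (snd p)) < \<delta>" .
      qed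
      finally show ?thesis by simp
    qed
    moreover have "gauge (\<lambda>t. g1 t \<inter> g2 t)" using g1 g2(1) by (rule gauge_Int)
    ultimately show "\<exists>\<gamma>. gauge \<gamma> \<and> (\<forall>\<D>. \<D> tagged_division_of {a..b} \<and> \<gamma> fine \<D> \<longrightarrow>
        norm ((\<Sum>(x, k)\<in>\<D>. measure lborel k *\<^sub>R d' x) - (x b - x a)) < e)"
      by blast
  qed
  then show ?thesis
    by (rule has_integral_spike[OF N, rotated]) (auto simp: d'_def)
qed

lemma sum_integral_le_integral_disjoint:
  fixes w :: "real \<Rightarrow> real"
  assumes w: "w integrable_on {a..b}" and pos: "\<And>t. t \<in> {a..b} \<Longrightarrow> 0 \<le> w t"
    and AB: "\<And>i. i < (n::nat) \<Longrightarrow> A i \<le> B i \<and> {A i..B i} \<subseteq> {a..b}"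
    and dis: "disjoint_family_on (\<lambda>i. {A i<..<B i}) {..<n}"
  shows "(\<Sum>i<n. integral {A i..B i} w) \<le> integral {a..b} w"
proof -
  have 1: "((\<lambda>t. if t \<in> {A i<..<B i} then w t else 0) has_integral integral {A i..B i} w) {a..b}" if "i < n" for i
  proof -
    have "(w has_integral integral {A i..B i} w) {A i..B i}"
      using AB[OF that] by (intro integrable_integral integrable_on_subinterval[OF w]) auto
    moreover have "cbox (A i) (B i) \<subseteq> cbox a b" using AB[OF that] by simp
    ultimately show ?thesis
      using has_integral_restrict_open_subinterval[of w _ "A i" "B i" a b] by (metis box_real(1) box_real(2))
  qed
  have 2: "((\<lambda>t. \<Sum>i<n. if t \<in> {A i<..<B i} then w t else 0) has_integral (\<Sum>i<n. integral {A i..B i} w)) {a..b}"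
    by (rule has_integral_sum) (use 1 in simp_all)
  show ?thesis
  proof (rule has_integral_le[OF 2 integrable_integral[OF w]])
    fix t assume t: "t \<in> {a..b}"
    show "(\<Sum>i<n. if t \<in> {A i<..<B i} then w t else 0) \<le> w t"
    proof (cases "\<exists>j<n. t \<in> {A j<..<B j}")
      case True
      then obtain j where j: "j < n" "t \<in> {A j<..<B j}" by blast
      have "(\<Sum>i<n. if t \<in> {A i<..<B i} then w t else 0) = (\<Sum>i<n. if i = j then w t else 0)"
      proof (intro sum.cong refl)
        fix i assume "i \<in> {..<n}"
        then have "i \<noteq> j \<Longrightarrow> {A i<..<B i} \<inter> {A j<..<B j} = {}"
          using dis j unfolding disjoint_family_on_def by (meson lessThan_iff)
        then show "(if t \<in> {A i<..<B i} then w t else 0) = (if i = j then w t else 0)"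
          using j by auto
      qed
      also have "\<dots> = w t" using j by simp
      finally show ?thesis by simp
    next
      case False
      then have "(\<Sum>i<n. if t \<in> {A i<..<B i} then w t else 0) = 0" by (intro sum.neutral) auto
      then show ?thesis using pos[OF t] by simp
    qed
  qed
qed

lemma integral_excess_tendsto_0:
  fixes m :: "'a::euclidean_space \<Rightarrow> real"
  assumes m: "m absolutely_integrable_on cbox a b" and pos: "\<And>t. t \<in> cbox a b \<Longrightarrow> 0 \<le> m t"
  shows "(\<lambda>t. max 0 (m t - real n)) integrable_on cbox a b"
    and "(\<lambda>n. integral (cbox a b) (\<lambda>t. max 0 (m t - real n))) \<longlonglongrightarrow> 0"
proof -
  have i: "(\<lambda>t. max 0 (m t - real n)) integrable_on cbox a b" for n
  proof -
    have "(\<lambda>t. max 0 (m t - real n)) absolutely_integrable_on cbox a b"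
      by (intro absolutely_integrable_max_1 set_integral_diff(1) m absolutely_integrable_continuous continuous_intros)
    then show ?thesis by (rule set_lebesgue_integral_eq_integral(1))
  qed
  then show "(\<lambda>t. max 0 (m t - real n)) integrable_on cbox a b" .
  have mi: "m integrable_on cbox a b" using m by (rule set_lebesgue_integral_eq_integral(1))
  have "(\<lambda>n. integral (cbox a b) (\<lambda>t. max 0 (m t - real n))) \<longlonglongrightarrow> integral (cbox a b) (\<lambda>t. 0)"
  proof (rule dominated_convergence(2)[OF i mi])
    show "norm (max 0 (m t - real n)) \<le> m t" if "t \<in> cbox a b" for n t
      using pos[OF that] by auto
    show "(\<lambda>n. max 0 (m t - real n)) \<longlonglongrightarrow> 0" if "t \<in> cbox a b" for t
    proof (rule tendsto_eventually)
      have "eventually (\<lambda>n. real n \<ge> m t) sequentially"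
        using filterlim_real_sequentially by (simp add: filterlim_at_top)
      then show "eventually (\<lambda>n. max 0 (m t - real n) = 0) sequentially"
        by eventually_elim auto
    qed
  qed
  then show "(\<lambda>n. integral (cbox a b) (\<lambda>t. max 0 (m t - real n))) \<longlonglongrightarrow> 0" by simp
qed

lemma absolutely_continuous_fun_on_integral_bound:
  fixes x :: "real \<Rightarrow> 'h::real_normed_vector"
  assumes m: "m absolutely_integrable_on {a..b}" and pos: "\<And>t. t \<in> {a..b} \<Longrightarrow> 0 \<le> m t"
    and x: "\<And>s t. a \<le> s \<Longrightarrow> s \<le> t \<Longrightarrow> t \<le> b \<Longrightarrow> norm (x t - x s) \<le> integral {s..t} m"
  shows "absolutely_continuous_fun_on x {a..b}"
  unfolding absolutely_continuous_fun_on_def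
proof (intro allI impI)
  fix e :: real assume e: "0 < e"
  have mc: "m absolutely_integrable_on cbox a b" using m by simp
  have "\<forall>\<^sub>F n in sequentially. integral {a..b} (\<lambda>t. max 0 (m t - real n)) < e / 2"
    using order_tendstoD(2)[OF integral_excess_tendsto_0(2)[OF mc], of "e/2"] pos e by simp
  then obtain n where n: "integral {a..b} (\<lambda>t. max 0 (m t - real n)) < e / 2"
    unfolding eventually_sequentially by blast
  define w where "w = (\<lambda>t. max 0 (m t - real n))"
  have w: "w integrable_on {a..b}" using integral_excess_tendsto_0(1)[OF mc] pos by (simp add: w_def)
  have mi: "m integrable_on {a..b}" using m by (rule set_lebesgue_integral_eq_integral(1))
  show "\<exists>\<delta>>0. \<forall>(k::nat) A B. (\<forall>i<k. A i \<le> B i \<and> {A i..B i} \<subseteq> {a..b}) \<longrightarrow>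
      disjoint_family_on (\<lambda>i. {A i<..<B i}) {..<k} \<longrightarrow> (\<Sum>i<k. B i - A i) < \<delta> \<longrightarrow>
      (\<Sum>i<k. norm (x (B i) - x (A i))) < e"
  proof (intro exI[of _ "e / (2 * (real n + 1))"] conjI allI impI)
    show "0 < e / (2 * (real n + 1))" using e by simp
    fix k :: nat and A B :: "nat \<Rightarrow> real"
    assume AB: "\<forall>i<k. A i \<le> B i \<and> {A i..B i} \<subseteq> {a..b}"
      and dis: "disjoint_family_on (\<lambda>i. {A i<..<B i}) {..<k}"
      and sm: "(\<Sum>i<k. B i - A i) < e / (2 * (real n + 1))"
    have "norm (x (B i) - x (A i)) \<le> real n * (B i - A i) + integral {A i..B i} w" if i: "i < k" for i
    proof -
      have ab: "A i \<le> B i" "a \<le> A i" "B i \<le> b" using AB i by auto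
      have wi: "w integrable_on {A i..B i}" "m integrable_on {A i..B i}"
        using AB i integrable_on_subinterval[OF w] integrable_on_subinterval[OF mi] by blast+
      have "norm (x (B i) - x (A i)) \<le> integral {A i..B i} m" using x ab by auto
      also have "\<dots> \<le> integral {A i..B i} (\<lambda>t. real n + w t)"
        using wi by (intro integral_le integrable_add integrable_const_ivl) (auto simp: w_def)
      also have "\<dots> = real n * (B i - A i) + integral {A i..B i} w"
        using wi ab by (subst integral_add) auto
      finally show ?thesis .
    qed
    then have "(\<Sum>i<k. norm (x (B i) - x (A i))) \<le> (\<Sum>i<k. real n * (B i - A i) + integral {A i..B i} w)"
      by (intro sum_mono) auto
    also have "\<dots> = real n * (\<Sum>i<k. B i - A i) + (\<Sum>i<k. integral {A i..B i} w)"
      by (simp add: sum.distrib sum_distrib_left)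
    also have "(\<Sum>i<k. integral {A i..B i} w) \<le> integral {a..b} w"
      using AB dis by (intro sum_integral_le_integral_disjoint w) (auto simp: w_def)
    also have "\<dots> < e / 2" using n by (simp add: w_def)
    also have "real n * (\<Sum>i<k. B i - A i) \<le> real n * (e / (2 * (real n + 1)))"
      using sm by (intro mult_left_mono) auto
    also have "\<dots> \<le> e / 2" using e by (simp add: field_simps)
    finally show "(\<Sum>i<k. norm (x (B i) - x (A i))) < e" by simp
  qed
qed

lemma absolutely_continuous_fun_on_compose_lipschitz:
  fixes x :: "real \<Rightarrow> 'h::real_normed_vector" and G :: "real \<Rightarrow> 'k::real_normed_vector"
  assumes x: "absolutely_continuous_fun_on x S" and L: "L > 0"
    and G: "\<And>s t. s \<in> S \<Longrightarrow> t \<in> S \<Longrightarrow> norm (G s - G t) \<le> L * norm (x s - x t)"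
  shows "absolutely_continuous_fun_on G S"
  unfolding absolutely_continuous_fun_on_def
proof (intro allI impI)
  fix e :: real assume e: "0 < e"
  obtain d where d: "d > 0" "\<And>(n::nat) A B. (\<forall>i<n. A i \<le> B i \<and> {A i..B i} \<subseteq> S) \<Longrightarrow>
      disjoint_family_on (\<lambda>i. {A i<..<B i}) {..<n} \<Longrightarrow>
      (\<Sum>i<n. B i - A i) < d \<Longrightarrow>
      (\<Sum>i<n. norm (x (B i) - x (A i))) < e / L"
    using x divide_pos_pos[OF e L] unfolding absolutely_continuous_fun_on_def by meson
  have "(\<Sum>i<n. norm (G (B i) - G (A i))) < e"
    if AB: "\<forall>i<n. A i \<le> B i \<and> {A i..B i} \<subseteq> S" and
      *: "disjoint_family_on (\<lambda>i. {A i<..<B i}) {..<n}" "(\<Sum>i<n. B i - A i) < d" for n :: nat and A B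
  proof -
    have "(\<Sum>i<n. norm (G (B i) - G (A i))) \<le> (\<Sum>i<n. L * norm (x (B i) - x (A i)))"
      using AB by (intro sum_mono G) (meson atLeastAtMost_iff lessThan_iff order_refl subsetD)+
    also have "\<dots> = L * (\<Sum>i<n. norm (x (B i) - x (A i)))" by (simp add: sum_distrib_left)
    also have "\<dots> < L * (e / L)" using d(2)[OF AB *] L by (intro mult_strict_left_mono)
    finally show ?thesis using L by simp
  qed
  with d(1) show "\<exists>\<delta>>0. \<forall>(n::nat) A B. (\<forall>i<n. A i \<le> B i \<and> {A i..B i} \<subseteq> S) \<longrightarrow>
      disjoint_family_on (\<lambda>i. {A i<..<B i}) {..<n} \<longrightarrow> (\<Sum>i<n. B i - A i) < \<delta> \<longrightarrow>
      (\<Sum>i<n. norm (G (B i) - G (A i))) < e" by blast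
qed


subsection \<open>Bochner integrability without separability\<close>

lemma AE_lborel_negligible:
  fixes P :: "'a::euclidean_space \<Rightarrow> bool"
  assumes "AE z in lborel. P z"
  obtains N where "negligible N" "\<And>z. z \<notin> N \<Longrightarrow> P z"
proof -
  have "AE z in lebesgue. P z" using assms by (rule AE_completion)
  then obtain N where "N \<in> null_sets lebesgue" "{z \<in> space lebesgue. \<not> P z} \<subseteq> N"
    unfolding eventually_ae_filter by auto
  then show ?thesis using that[of N] by (auto simp: negligible_iff_null_sets)
qed

lemma summable_integrals_imp_summable_ae:
  fixes \<rho> :: "nat \<Rightarrow> 'a::euclidean_space \<Rightarrow> real"
  assumes i: "\<And>k. \<rho> k integrable_on S" and pos: "\<And>k z. z \<in> S \<Longrightarrow> 0 \<le> \<rho> k z"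
    and s: "summable (\<lambda>k. integral S (\<rho> k))"
  shows "\<exists>N. negligible N \<and> (\<forall>z\<in>S - N. summable (\<lambda>k. \<rho> k z)) \<and>
    (\<lambda>z. if z \<in> N then 0 else \<Sum>k. \<rho> k z) integrable_on S \<and>
    integral S (\<lambda>z. if z \<in> N then 0 else \<Sum>k. \<rho> k z) = (\<Sum>k. integral S (\<rho> k))"
proof -
  define f where "f k z = indicator S z *\<^sub>R \<rho> k z" for k z
  have f: "integrable lebesgue (f k)" for k
    using nonnegative_absolutely_integrable_1[OF i pos] unfolding set_integrable_def f_def by auto
  have f0: "0 \<le> f k z" for k z using pos by (auto simp: f_def indicator_def)
  have fi: "integral\<^sup>L lebesgue (f k) = integral S (\<rho> k)" for k
    using set_lebesgue_integral_eq_integral(2)[OF nonnegative_absolutely_integrable_1[OF i pos]]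
    by (simp add: set_lebesgue_integral_def f_def[abs_def])
  have p0: "0 \<le> integral S (\<rho> k)" for k using integral_nonneg[OF i] pos by auto
  have "(\<integral>\<^sup>+ z. (\<Sum>k. ennreal (f k z)) \<partial>lebesgue) = (\<Sum>k. \<integral>\<^sup>+ z. ennreal (f k z) \<partial>lebesgue)"
    using f by (intro nn_integral_suminf) auto
  also have "\<dots> = (\<Sum>k. ennreal (integral S (\<rho> k)))"
    using f f0 by (simp add: nn_integral_eq_integral fi)
  also have "\<dots> = ennreal (\<Sum>k. integral S (\<rho> k))"
    using p0 s by (intro suminf_ennreal2) auto
  also have "\<dots> \<noteq> \<infinity>" by simp
  finally have "AE z in lebesgue. (\<Sum>k. ennreal (f k z)) \<noteq> \<infinity>"
    using f by (intro nn_integral_PInf_AE borel_measurable_suminf) auto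
  then obtain N where N: "N \<in> null_sets lebesgue" "{z \<in> space lebesgue. \<not> (\<Sum>k. ennreal (f k z)) \<noteq> \<infinity>} \<subseteq> N"
    unfolding eventually_ae_filter by auto
  then have neg: "negligible N" by (simp add: negligible_iff_null_sets)
  have sum: "summable (\<lambda>k. \<rho> k z)" if z: "z \<in> S - N" for z
  proof -
    have "(\<Sum>k. ennreal (f k z)) \<noteq> top" using N(2) z by auto
    then have "summable (\<lambda>k. f k z)" using f0 by (intro summable_suminf_not_top)
    then show ?thesis using z by (simp add: f_def)
  qed
  define F where "F n z = (if z \<in> N then 0 else \<Sum>k<n. \<rho> k z)" for n z
  have Fs: "(\<lambda>z. \<Sum>k<n. \<rho> k z) integrable_on S" for n using i by (intro integrable_sum) auto
  have Fi: "F n integrable_on S" for n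
    by (rule integrable_spike[OF Fs neg]) (auto simp: F_def)
  have FI: "integral S (F n) = (\<Sum>k<n. integral S (\<rho> k))" for n
  proof -
    have "integral S (F n) = integral S (\<lambda>z. \<Sum>k<n. \<rho> k z)"
      by (rule integral_spike[OF neg]) (auto simp: F_def)
    also have "\<dots> = (\<Sum>k<n. integral S (\<rho> k))" using i by (intro integral_sum) auto
    finally show ?thesis .
  qed
  have lim: "(\<lambda>n. \<Sum>k<n. integral S (\<rho> k)) \<longlonglongrightarrow> (\<Sum>k. integral S (\<rho> k))"
    using s by (rule summable_LIMSEQ)
  have MC: "(\<lambda>z. if z \<in> N then 0 else \<Sum>k. \<rho> k z) integrable_on S \<and>
      (\<lambda>n. integral S (F n)) \<longlonglongrightarrow> integral S (\<lambda>z. if z \<in> N then 0 else \<Sum>k. \<rho> k z)"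
  proof (rule monotone_convergence_increasing[OF Fi])
    show "F n z \<le> F (Suc n) z" if "z \<in> S" for n z using pos[OF that] by (simp add: F_def)
    show "(\<lambda>n. F n z) \<longlonglongrightarrow> (if z \<in> N then 0 else \<Sum>k. \<rho> k z)" if "z \<in> S" for z
      using summable_LIMSEQ[OF sum[of z]] that by (auto simp: F_def)
    show "bounded (range (\<lambda>n. integral S (F n)))"
      unfolding FI using lim convergent_imp_bounded convergentI by blast
  qed
  have "integral S (\<lambda>z. if z \<in> N then 0 else \<Sum>k. \<rho> k z) = (\<Sum>k. integral S (\<rho> k))"
    using MC lim LIMSEQ_unique unfolding FI by blast
  with neg sum MC show ?thesis by (intro exI[of _ N]) auto
qed

text \<open>Bochner integrability, stated as approximability in \<open>L\<^sup>1\<close> by continuous functions: this makes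
  sense in Banach spaces that are not second countable.\<close>

definition bochner_integrable_on :: "('a::euclidean_space \<Rightarrow> 'b::banach) \<Rightarrow> 'a set \<Rightarrow> bool"
    (infixr \<open>bochner'_integrable'_on\<close> 46) where
  "G bochner_integrable_on S \<longleftrightarrow> (\<forall>\<epsilon>>0. \<exists>\<phi> \<rho>. continuous_on UNIV \<phi> \<and> \<rho> integrable_on S \<and>
     (\<forall>z\<in>S. norm (G z - \<phi> z) \<le> \<rho> z) \<and> integral S \<rho> < \<epsilon>)"

lemma bochner_integrable_onI:
  assumes "\<And>\<epsilon>. \<epsilon> > 0 \<Longrightarrow> \<exists>G' \<rho> N. G' bochner_integrable_on S \<and> \<rho> integrable_on S \<and> negligible N \<and>
     (\<forall>z\<in>S - N. norm (G z - G' z) \<le> \<rho> z) \<and> integral S \<rho> < \<epsilon>"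
  shows "G bochner_integrable_on S"
  unfolding bochner_integrable_on_def
proof (intro allI impI)
  fix \<epsilon> :: real assume e: "\<epsilon> > 0"
  obtain G' \<rho> N where G': "G' bochner_integrable_on S" "\<rho> integrable_on S" "negligible N"
     "\<And>z. z \<in> S - N \<Longrightarrow> norm (G z - G' z) \<le> \<rho> z" "integral S \<rho> < \<epsilon> / 2"
    using assms[OF half_gt_zero[OF e]] by blast
  obtain \<phi> \<rho>' where r: "continuous_on UNIV \<phi>" "\<rho>' integrable_on S"
     "\<And>z. z \<in> S \<Longrightarrow> norm (G' z - \<phi> z) \<le> \<rho>' z" "integral S \<rho>' < \<epsilon> / 2"
    using G'(1) half_gt_zero[OF e] unfolding bochner_integrable_on_def by blast
  define \<rho>2 where "\<rho>2 z = (if z \<in> N then norm (G z - \<phi> z) else \<rho> z + \<rho>' z)" for z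
  have i: "(\<lambda>z. \<rho> z + \<rho>' z) integrable_on S" using G'(2) r(2) by (rule integrable_add)
  have "norm (G z - \<phi> z) \<le> \<rho>2 z" if "z \<in> S" for z
  proof (cases "z \<in> N")
    case False
    have "norm (G z - \<phi> z) \<le> norm (G z - G' z) + norm (G' z - \<phi> z)" by norm
    then show ?thesis using G'(4)[of z] r(3)[of z] that False by (simp add: \<rho>2_def)
  qed (simp add: \<rho>2_def)
  moreover have "\<rho>2 integrable_on S"
    by (rule integrable_spike[OF i G'(3)]) (auto simp: \<rho>2_def)
  moreover have "integral S \<rho>2 = integral S (\<lambda>z. \<rho> z + \<rho>' z)"
    by (rule integral_spike[OF G'(3)]) (auto simp: \<rho>2_def)
  then have "integral S \<rho>2 < \<epsilon>"
    using G'(5) r(4) by (simp add: integral_add[OF G'(2) r(2)])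
  ultimately show "\<exists>\<phi> \<rho>. continuous_on UNIV \<phi> \<and> \<rho> integrable_on S \<and>
     (\<forall>z\<in>S. norm (G z - \<phi> z) \<le> \<rho> z) \<and> integral S \<rho> < \<epsilon>"
    using r(1) by blast
qed

lemma bochner_integrable_on_continuous:
  assumes "continuous_on UNIV \<phi>"
  shows "\<phi> bochner_integrable_on S"
  unfolding bochner_integrable_on_def
proof (intro allI impI exI conjI)
  show "continuous_on UNIV \<phi>" by fact
  show "(\<lambda>_. 0::real) integrable_on S" by (rule Henstock_Kurzweil_Integration.integrable_0)
qed auto

lemma bochner_integrable_onI_continuous:
  assumes "\<And>\<epsilon>. \<epsilon> > 0 \<Longrightarrow> \<exists>\<phi> \<rho> N. continuous_on UNIV \<phi> \<and> \<rho> integrable_on S \<and> negligible N \<and>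
     (\<forall>z\<in>S - N. norm (G z - \<phi> z) \<le> \<rho> z) \<and> integral S \<rho> < \<epsilon>"
  shows "G bochner_integrable_on S"
  using assms by (intro bochner_integrable_onI) (meson bochner_integrable_on_continuous)

lemma bochner_integrable_on_spike:
  assumes "G bochner_integrable_on S" "negligible N" "\<And>z. z \<in> S - N \<Longrightarrow> G' z = G z"
  shows "G' bochner_integrable_on S"
proof (rule bochner_integrable_onI)
  fix \<epsilon> :: real assume "\<epsilon> > 0"
  then show "\<exists>H \<rho> N. H bochner_integrable_on S \<and> \<rho> integrable_on S \<and> negligible N \<and>
     (\<forall>z\<in>S - N. norm (G' z - H z) \<le> \<rho> z) \<and> integral S \<rho> < \<epsilon>"
    using assms Henstock_Kurzweil_Integration.integrable_0
    by (intro exI[of _ G] exI[of _ "\<lambda>_. 0"] exI[of _ N]) auto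
qed

lemma bochner_integrable_on_approx_seq:
  assumes "G bochner_integrable_on S"
  shows "\<exists>\<phi> \<rho>. \<forall>k::nat. continuous_on UNIV (\<phi> k) \<and> \<rho> k integrable_on S \<and>
    (\<forall>z\<in>S. norm (G z - \<phi> k z) \<le> \<rho> k z) \<and> integral S (\<rho> k) < (1/2) ^ k"
proof -
  have "\<forall>k::nat. \<exists>p. continuous_on UNIV (fst p) \<and> snd p integrable_on S \<and>
     (\<forall>z\<in>S. norm (G z - fst p z) \<le> snd p z) \<and> integral S (snd p) < (1/2) ^ k"
  proof
    fix k :: nat
    have "(0::real) < (1/2) ^ k" by simp
    then show "\<exists>p. continuous_on UNIV (fst p) \<and> snd p integrable_on S \<and>
     (\<forall>z\<in>S. norm (G z - fst p z) \<le> snd p z) \<and> integral S (snd p) < (1/2) ^ k"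
      using assms unfolding bochner_integrable_on_def by (metis fst_conv snd_conv)
  qed
  from choice[OF this] obtain p where "\<forall>k::nat. continuous_on UNIV (fst (p k)) \<and> snd (p k) integrable_on S \<and>
     (\<forall>z\<in>S. norm (G z - fst (p k) z) \<le> snd (p k) z) \<and> integral S (snd (p k)) < (1/2) ^ k" ..
  then show ?thesis by (intro exI[of _ "\<lambda>k. fst (p k)"] exI[of _ "\<lambda>k. snd (p k)"])
qed

lemma integrals_less_half_powers_tendsto_0_ae:
  fixes \<rho> :: "nat \<Rightarrow> 'a::euclidean_space \<Rightarrow> real"
  assumes i: "\<And>k. \<rho> k integrable_on S" and pos: "\<And>k z. z \<in> S \<Longrightarrow> 0 \<le> \<rho> k z"
    and lt: "\<And>k. integral S (\<rho> k) < (1/2) ^ k"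
  shows "\<exists>N. negligible N \<and> (\<forall>z\<in>S - N. (\<lambda>k. \<rho> k z) \<longlonglongrightarrow> 0)"
proof -
  have "0 \<le> integral S (\<rho> k)" for k using integral_nonneg[OF i] pos by auto
  then have "summable (\<lambda>k. integral S (\<rho> k))"
    using lt by (intro summable_comparison_test'[OF summable_geometric[of "1/2::real"]])
      (auto simp: less_imp_le)
  from summable_integrals_imp_summable_ae[OF i pos this]
  obtain N where "negligible N \<and> (\<forall>z\<in>S - N. summable (\<lambda>k. \<rho> k z)) \<and>
    (\<lambda>z. if z \<in> N then 0 else \<Sum>k. \<rho> k z) integrable_on S \<and>
    integral S (\<lambda>z. if z \<in> N then 0 else \<Sum>k. \<rho> k z) = (\<Sum>k. integral S (\<rho> k))" ..
  then show ?thesis by (intro exI[of _ N]) (simp add: summable_LIMSEQ_zero)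
qed

lemma bochner_integrable_on_imp_integrable:
  assumes G: "G bochner_integrable_on cbox a b"
  shows "G integrable_on cbox a b"
  unfolding integrable_Cauchy
proof (intro allI impI)
  fix e :: real assume e: "0 < e"
  then have "e / 8 > 0" by simp
  then obtain \<phi> \<rho> where r: "continuous_on UNIV \<phi>" "\<rho> integrable_on cbox a b"
     "\<forall>z\<in>cbox a b. norm (G z - \<phi> z) \<le> \<rho> z" "integral (cbox a b) \<rho> < e / 8"
    using G unfolding bochner_integrable_on_def by blast
  have "\<phi> integrable_on cbox a b"
    using r(1) by (intro integrable_continuous) (auto intro: continuous_on_subset)
  then have ph: "(\<phi> has_integral integral (cbox a b) \<phi>) (cbox a b)" by (rule integrable_integral)
  have rh: "(\<rho> has_integral integral (cbox a b) \<rho>) (cbox a b)" using r(2) by (rule integrable_integral)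
  from ph[unfolded has_integral, rule_format, of "e/8"] e
  obtain g1 where g1: "gauge g1" "\<forall>D. D tagged_division_of cbox a b \<and> g1 fine D \<longrightarrow>
     norm ((\<Sum>(x,k)\<in>D. measure lborel k *\<^sub>R \<phi> x) - integral (cbox a b) \<phi>) < e / 8" by auto
  from rh[unfolded has_integral, rule_format, of "e/8"] e
  obtain g2 where g2: "gauge g2" "\<forall>D. D tagged_division_of cbox a b \<and> g2 fine D \<longrightarrow>
     norm ((\<Sum>(x,k)\<in>D. measure lborel k *\<^sub>R \<rho> x) - integral (cbox a b) \<rho>) < e / 8" by auto
  let ?R = "\<lambda>D h. \<Sum>(x,k)\<in>D. measure lborel k *\<^sub>R h x"
  have key: "norm (?R D G - integral (cbox a b) \<phi>) < e / 2"
    if D: "D tagged_division_of cbox a b" "(\<lambda>t. g1 t \<inter> g2 t) fine D" for D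
  proof -
    have "g1 fine D" "g2 fine D" using D(2) by (auto simp: fine_Int)
    then have 1: "norm (?R D \<phi> - integral (cbox a b) \<phi>) < e / 8"
      and 2: "norm (?R D \<rho> - integral (cbox a b) \<rho>) < e / 8" using g1(2) g2(2) D(1) by blast+
    have "?R D G - ?R D \<phi> = (\<Sum>(x,k)\<in>D. measure lborel k *\<^sub>R (G x - \<phi> x))"
      by (simp add: sum_subtractf[symmetric] split_def scaleR_diff_right)
    also have "norm \<dots> \<le> (\<Sum>(x,k)\<in>D. measure lborel k *\<^sub>R \<rho> x)"
    proof (rule order_trans[OF norm_sum], rule sum_mono)
      fix p assume "p \<in> D"
      then have "fst p \<in> cbox a b"
        using tagged_division_ofD(2,3)[OF D(1), of "fst p" "snd p"] by auto
      then show "norm (case p of (x, k) \<Rightarrow> measure lborel k *\<^sub>R (G x - \<phi> x)) \<le> (case p of (x, k) \<Rightarrow> measure lborel k *\<^sub>R \<rho> x)"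
        using r(3) by (auto simp: split_def intro!: mult_left_mono)
    qed
    also have "\<dots> < e / 8 + e / 8" using 2 r(4) unfolding real_norm_def by linarith
    finally have 3: "norm (?R D G - ?R D \<phi>) < e / 8 + e / 8" .
    have "norm (u - w) \<le> norm (u - v) + norm (v - w)" for u v w :: 'b by norm
    then have "norm (?R D G - integral (cbox a b) \<phi>) \<le> norm (?R D G - ?R D \<phi>) + norm (?R D \<phi> - integral (cbox a b) \<phi>)" .
    with 1 3 e show ?thesis by linarith
  qed
  show "\<exists>\<gamma>. gauge \<gamma> \<and> (\<forall>D1 D2. D1 tagged_division_of cbox a b \<and> \<gamma> fine D1 \<and>
     D2 tagged_division_of cbox a b \<and> \<gamma> fine D2 \<longrightarrow> norm (?R D1 G - ?R D2 G) < e)"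
  proof (intro exI[of _ "\<lambda>t. g1 t \<inter> g2 t"] conjI allI impI)
    show "gauge (\<lambda>t. g1 t \<inter> g2 t)" using g1(1) g2(1) by (rule gauge_Int)
    fix D1 D2 assume "D1 tagged_division_of cbox a b \<and> (\<lambda>t. g1 t \<inter> g2 t) fine D1 \<and>
     D2 tagged_division_of cbox a b \<and> (\<lambda>t. g1 t \<inter> g2 t) fine D2"
    then have "norm (?R D1 G - integral (cbox a b) \<phi>) < e / 2" "norm (?R D2 G - integral (cbox a b) \<phi>) < e / 2"
      using key by blast+
    then show "norm (?R D1 G - ?R D2 G) < e" by norm
  qed
qed

lemma bochner_integrable_on_norm:
  assumes G: "G bochner_integrable_on S"
  shows "(\<lambda>z. norm (G z)) bochner_integrable_on S"
proof (rule bochner_integrable_onI_continuous)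
  fix \<epsilon> :: real assume e: "\<epsilon> > 0"
  obtain \<phi> \<rho> where r: "continuous_on UNIV \<phi>" "\<rho> integrable_on S"
     "\<And>z. z \<in> S \<Longrightarrow> norm (G z - \<phi> z) \<le> \<rho> z" "integral S \<rho> < \<epsilon>"
    using G e unfolding bochner_integrable_on_def by blast
  have "norm (norm (G z) - norm (\<phi> z)) \<le> \<rho> z" if "z \<in> S" for z
    using r(3)[OF that] norm_triangle_ineq3[of "G z" "\<phi> z"] by simp
  then show "\<exists>\<phi> \<rho> N. continuous_on UNIV \<phi> \<and> \<rho> integrable_on S \<and> negligible N \<and>
     (\<forall>z\<in>S - N. norm (norm (G z) - \<phi> z) \<le> \<rho> z) \<and> integral S \<rho> < \<epsilon>"
    using r by (intro exI[of _ "\<lambda>z. norm (\<phi> z)"] exI[of _ \<rho>] exI[of _ "{}"]) (auto intro: continuous_intros)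
qed

lemma bochner_integrable_on_norm_integrable:
  assumes G: "G bochner_integrable_on cbox a b"
  shows "(\<lambda>z. norm (G z)) integrable_on cbox a b"
  using bochner_integrable_on_imp_integrable bochner_integrable_on_norm G by blast

lemma bochner_integrable_on_add:
  assumes F: "F bochner_integrable_on S" and G: "G bochner_integrable_on S"
  shows "(\<lambda>z. F z + G z) bochner_integrable_on S"
proof (rule bochner_integrable_onI_continuous)
  fix \<epsilon> :: real assume e: "\<epsilon> > 0"
  obtain \<phi> \<rho> where r: "continuous_on UNIV \<phi>" "\<rho> integrable_on S"
     "\<And>z. z \<in> S \<Longrightarrow> norm (F z - \<phi> z) \<le> \<rho> z" "integral S \<rho> < \<epsilon> / 2"
    using F half_gt_zero[OF e] unfolding bochner_integrable_on_def by blast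
  obtain \<phi>' \<rho>' where r': "continuous_on UNIV \<phi>'" "\<rho>' integrable_on S"
     "\<And>z. z \<in> S \<Longrightarrow> norm (G z - \<phi>' z) \<le> \<rho>' z" "integral S \<rho>' < \<epsilon> / 2"
    using G half_gt_zero[OF e] unfolding bochner_integrable_on_def by blast
  have "norm (F z + G z - (\<phi> z + \<phi>' z)) \<le> \<rho> z + \<rho>' z" if "z \<in> S" for z
    using r(3)[OF that] r'(3)[OF that] by norm
  moreover have "integral S (\<lambda>z. \<rho> z + \<rho>' z) < \<epsilon>"
    using r(4) r'(4) by (simp add: integral_add[OF r(2) r'(2)])
  ultimately show "\<exists>\<phi> \<rho> N. continuous_on UNIV \<phi> \<and> \<rho> integrable_on S \<and> negligible N \<and>
     (\<forall>z\<in>S - N. norm (F z + G z - \<phi> z) \<le> \<rho> z) \<and> integral S \<rho> < \<epsilon>"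
    using r(1) r'(1) integrable_add[OF r(2) r'(2)]
    by (intro exI[of _ "\<lambda>z. \<phi> z + \<phi>' z"] exI[of _ "\<lambda>z. \<rho> z + \<rho>' z"] exI[of _ "{}"])
      (auto intro: continuous_intros)
qed

lemma bochner_integrable_on_sum:
  assumes "finite I" "\<And>i. i \<in> I \<Longrightarrow> F i bochner_integrable_on S"
  shows "(\<lambda>z. \<Sum>i\<in>I. F i z) bochner_integrable_on S"
  using assms
  by (induction I) (auto intro: bochner_integrable_on_add bochner_integrable_on_continuous)

lemma bochner_integrable_on_scaleR_continuous:
  assumes G: "G bochner_integrable_on S" and l: "continuous_on UNIV l" "\<And>z. \<bar>l z\<bar> \<le> 1"
  shows "(\<lambda>z. l z *\<^sub>R G z) bochner_integrable_on S"
proof (rule bochner_integrable_onI_continuous)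
  fix \<epsilon> :: real assume e: "\<epsilon> > 0"
  obtain \<phi> \<rho> where r: "continuous_on UNIV \<phi>" "\<rho> integrable_on S"
     "\<And>z. z \<in> S \<Longrightarrow> norm (G z - \<phi> z) \<le> \<rho> z" "integral S \<rho> < \<epsilon>"
    using G e unfolding bochner_integrable_on_def by blast
  have "norm (l z *\<^sub>R G z - l z *\<^sub>R \<phi> z) \<le> \<rho> z" if "z \<in> S" for z
  proof -
    have "norm (l z *\<^sub>R G z - l z *\<^sub>R \<phi> z) = \<bar>l z\<bar> * norm (G z - \<phi> z)"
      by (simp add: scaleR_diff_right[symmetric])
    also have "\<dots> \<le> 1 * norm (G z - \<phi> z)" using l(2) by (intro mult_right_mono) auto
    finally show ?thesis using r(3)[OF that] by simp
  qed
  then show "\<exists>\<phi> \<rho> N. continuous_on UNIV \<phi> \<and> \<rho> integrable_on S \<and> negligible N \<and>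
     (\<forall>z\<in>S - N. norm (l z *\<^sub>R G z - \<phi> z) \<le> \<rho> z) \<and> integral S \<rho> < \<epsilon>"
    using r l by (intro exI[of _ "\<lambda>z. l z *\<^sub>R \<phi> z"] exI[of _ \<rho>] exI[of _ "{}"]) (auto intro: continuous_intros)
qed


lemma integrable_imp_measurable_on:
  fixes f :: "'a::euclidean_space \<Rightarrow> real"
  assumes "f integrable_on cbox a b"
  shows "f measurable_on cbox a b"
  using assms by (simp add: measurable_on_iff_borel_measurable integrable_imp_measurable)

lemma negligible_Times_UNIV:
  fixes N :: "real set"
  assumes "negligible N"
  shows "negligible (N \<times> (UNIV :: real set))"
proof -
  have "N \<in> null_sets (completion lborel)" using assms by (simp add: negligible_iff_null_sets)
  then obtain M where M: "M \<in> null_sets lborel" "N \<subseteq> M"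
    using null_sets_completion_iff2[of N lborel] by auto
  have "M \<times> UNIV \<in> null_sets (lborel \<Otimes>\<^sub>M (lborel :: real measure))"
    using M(1) lborel.emeasure_pair_measure_Times[of M lborel UNIV] by (auto simp: null_sets_def)
  then have "M \<times> (UNIV :: real set) \<in> null_sets lebesgue"
    unfolding lborel_prod by (rule null_sets_completionI)
  then have "negligible (M \<times> (UNIV :: real set))" by (simp add: negligible_iff_null_sets)
  then show ?thesis by (rule negligible_subset) (use M(2) in auto)
qed

lemma measurable_on_fst:
  fixes \<mu> :: "real \<Rightarrow> 'b::real_normed_vector"
  assumes "\<mu> measurable_on {a..b}"
  shows "(\<lambda>z::real \<times> real. \<mu> (fst z)) measurable_on (cbox (a, c) (b, d))"
proof -
  obtain N g where g: "negligible N" "\<And>n. continuous_on UNIV (g n)"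
     "\<And>x. x \<notin> N \<Longrightarrow> (\<lambda>n. g n x) \<longlonglongrightarrow> (if x \<in> {a..b} then \<mu> x else 0)"
    using assms unfolding measurable_on_def by blast
  have "(\<lambda>z::real \<times> real. if z \<in> {a..b} \<times> UNIV then \<mu> (fst z) else 0) measurable_on UNIV"
    unfolding measurable_on_def
  proof (intro exI conjI allI impI)
    show "negligible (N \<times> (UNIV :: real set))" using g(1) by (rule negligible_Times_UNIV)
    show "continuous_on UNIV (\<lambda>z::real \<times> real. g n (fst z))" for n
      by (rule continuous_on_compose2[OF g(2) continuous_on_fst[OF continuous_on_id]]) auto
    fix z :: "real \<times> real" assume "z \<notin> N \<times> UNIV"
    then have "fst z \<notin> N" by (cases z) auto
    from g(3)[OF this] show "(\<lambda>n. g n (fst z)) \<longlonglongrightarrow>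
      (if z \<in> UNIV then if z \<in> {a..b} \<times> UNIV then \<mu> (fst z) else 0 else 0)"
      by (cases z) auto
  qed
  then have "(\<lambda>z. if z \<in> cbox (a, c) (b, d) then if z \<in> {a..b} \<times> UNIV then \<mu> (fst z) else 0 else 0) measurable_on UNIV"
    by (rule measurable_on_restrict) auto
  then have "(\<lambda>z::real \<times> real. if z \<in> {a..b} \<times> UNIV then \<mu> (fst z) else 0) measurable_on (cbox (a, c) (b, d))"
    by (simp only: measurable_on_UNIV)
  then show ?thesis
    by (rule measurable_on_spike[OF _ negligible_empty]) (auto simp: cbox_Pair_eq)
qed

definition radial_truncation :: "nat \<Rightarrow> 'b::real_normed_vector \<Rightarrow> 'b" where
  "radial_truncation n v = (real n / max (real n) (norm v)) *\<^sub>R v"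

lemma radial_truncation_continuous: "n > 0 \<Longrightarrow> continuous_on UNIV (radial_truncation n)"
  unfolding radial_truncation_def[abs_def] by (intro continuous_intros) auto

lemma norm_radial_truncation_le: "norm (radial_truncation n v) \<le> real n"
proof (cases "n = 0")
  case False
  then have "norm (radial_truncation n v) = real n * (norm v / max (real n) (norm v))"
    by (simp add: radial_truncation_def)
  also have "\<dots> \<le> real n * 1"
    using False by (intro mult_left_mono) (auto simp: divide_le_eq_1)
  finally show ?thesis by simp
qed (simp add: radial_truncation_def)

lemma norm_minus_radial_truncation:
  assumes "n > 0"
  shows "norm (v - radial_truncation n v) = max 0 (norm v - real n)"
proof (cases "norm v \<le> real n")
  case True
  then show ?thesis using assms by (simp add: radial_truncation_def max_def)
next
  case False
  then have "v - radial_truncation n v = 1 *\<^sub>R v - (real n / norm v) *\<^sub>R v"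
    by (simp add: radial_truncation_def max_def)
  also have "\<dots> = ((norm v - real n) / norm v) *\<^sub>R v"
    unfolding scaleR_left_diff_distrib[symmetric] using False assms
    by (intro arg_cong2[of _ _ _ _ scaleR]) (auto simp: diff_divide_distrib)
  finally have "v - radial_truncation n v = ((norm v - real n) / norm v) *\<^sub>R v" .
  moreover have "v \<noteq> 0" using False by auto
  ultimately show ?thesis using False assms by simp
qed

text \<open>The approximating functions are truncations of the continuous functions given by measurability;
  only real functions need to be integrated.\<close>

lemma measurable_on_imp_bochner_integrable_on:
  fixes G :: "'a::euclidean_space \<Rightarrow> 'b::banach"
  assumes G: "G measurable_on cbox a b" and m: "m integrable_on cbox a b"
    and le: "\<And>z. z \<in> cbox a b \<Longrightarrow> norm (G z) \<le> m z"
  shows "G bochner_integrable_on cbox a b"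
proof (rule bochner_integrable_onI_continuous)
  fix \<epsilon> :: real assume e: "\<epsilon> > 0"
  let ?S = "cbox a b"
  obtain N g where g: "negligible N" "\<And>n. continuous_on UNIV (g n)"
     "\<And>x. x \<notin> N \<Longrightarrow> (\<lambda>n. g n x) \<longlonglongrightarrow> (if x \<in> ?S then G x else 0)"
    using G unfolding measurable_on_def by blast
  have m0: "0 \<le> m z" if "z \<in> ?S" for z using le[OF that] norm_ge_zero order_trans by blast
  have ma: "m absolutely_integrable_on ?S"
    using m m0 by (intro nonnegative_absolutely_integrable_1)
  have "eventually (\<lambda>n. integral ?S (\<lambda>t. max 0 (m t - real n)) < \<epsilon> / 2) sequentially"
    using order_tendstoD(2)[OF integral_excess_tendsto_0(2)[OF ma m0], of "\<epsilon>/2"] e by auto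
  then have "eventually (\<lambda>n. n > 0 \<and> integral ?S (\<lambda>t. max 0 (m t - real n)) < \<epsilon> / 2) sequentially"
    using eventually_gt_at_top[of 0] by eventually_elim auto
  then obtain n where n: "n > 0" "integral ?S (\<lambda>t. max 0 (m t - real n)) < \<epsilon> / 2"
    unfolding eventually_sequentially by blast
  let ?T = "radial_truncation n :: 'b \<Rightarrow> 'b"
  have cT: "continuous_on UNIV (\<lambda>z. ?T (g k z))" for k
    by (rule continuous_on_compose2[OF radial_truncation_continuous[OF n(1)] g(2)]) auto
  have tT: "(\<lambda>k. ?T (g k z)) \<longlonglongrightarrow> ?T (G z)" if "z \<in> ?S - N" for z
  proof -
    have "isCont ?T (G z)"
      using radial_truncation_continuous[OF n(1)] by (auto simp: continuous_on_eq_continuous_at)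
    moreover have "(\<lambda>k. g k z) \<longlonglongrightarrow> G z" using g(3)[of z] that by auto
    ultimately show ?thesis by (rule isCont_tendsto_compose)
  qed
  have bT: "norm (?T u - ?T v) \<le> 2 * real n" for u v
    using norm_radial_truncation_le[of n u] norm_radial_truncation_le[of n v] norm_triangle_ineq4[of "?T u" "?T v"]
    by linarith
  define h where "h k z = (if z \<in> N then 0 else norm (?T (G z) - ?T (g k z)))" for k z
  have ci: "(\<lambda>z. 2 * real n) integrable_on ?S" by (rule integrable_const)
  have hi: "h k integrable_on ?S" for k
  proof (rule dominated_convergence(1)[where f = "\<lambda>j z. if z \<in> N then 0 else norm (?T (g j z) - ?T (g k z))", OF _ ci])
    fix j
    have "continuous_on UNIV (\<lambda>z. norm (?T (g j z) - ?T (g k z)))"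
      by (intro continuous_on_norm continuous_on_diff cT)
    then have "(\<lambda>z. norm (?T (g j z) - ?T (g k z))) integrable_on ?S"
      using integrable_continuous continuous_on_subset subset_UNIV by blast
    then show "(\<lambda>z. if z \<in> N then 0 else norm (?T (g j z) - ?T (g k z))) integrable_on ?S"
      by (rule integrable_spike[OF _ g(1)]) auto
    show "norm (if z \<in> N then 0 else norm (?T (g j z) - ?T (g k z))) \<le> 2 * real n" for z
      using bT by simp
  next
    fix z assume z: "z \<in> ?S"
    show "(\<lambda>j. if z \<in> N then 0 else norm (?T (g j z) - ?T (g k z))) \<longlonglongrightarrow> h k z"
    proof (cases "z \<in> N")
      case False
      have "(\<lambda>j. norm (?T (g j z) - ?T (g k z))) \<longlonglongrightarrow> norm (?T (G z) - ?T (g k z))"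
        using z False by (intro tendsto_norm tendsto_diff tendsto_const tT) auto
      then show ?thesis using False by (simp add: h_def)
    qed (simp add: h_def)
  qed
  have "(\<lambda>k. integral ?S (h k)) \<longlonglongrightarrow> integral ?S (\<lambda>z. 0)"
  proof (rule dominated_convergence(2)[OF hi ci])
    show "norm (h k z) \<le> 2 * real n" for k z using bT by (simp add: h_def)
    fix z assume z: "z \<in> ?S"
    show "(\<lambda>k. h k z) \<longlonglongrightarrow> 0"
    proof (cases "z \<in> N")
      case False
      have "(\<lambda>k. norm (?T (G z) - ?T (g k z))) \<longlonglongrightarrow> norm (?T (G z) - ?T (G z))"
        using z False by (intro tendsto_norm tendsto_diff tendsto_const tT) auto
      then show ?thesis using False by (simp add: h_def)
    qed (simp add: h_def)
  qed
  then have "eventually (\<lambda>k. integral ?S (h k) < \<epsilon> / 2) sequentially"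
    using e by (intro order_tendstoD(2)) auto
  then obtain k where k: "integral ?S (h k) < \<epsilon> / 2"
    unfolding eventually_sequentially by blast
  have xi: "(\<lambda>t. max 0 (m t - real n)) integrable_on ?S"
    using integral_excess_tendsto_0(1)[OF ma m0] by auto
  have "norm (G z - ?T (g k z)) \<le> max 0 (m z - real n) + h k z" if z: "z \<in> ?S - N" for z
  proof -
    have "norm (G z - ?T (g k z)) \<le> norm (G z - ?T (G z)) + norm (?T (G z) - ?T (g k z))" by norm
    also have "norm (G z - ?T (G z)) \<le> max 0 (m z - real n)"
      using le[of z] z by (auto simp: norm_minus_radial_truncation[OF n(1)])
    finally show ?thesis using z by (simp add: h_def)
  qed
  moreover have "integral ?S (\<lambda>z. max 0 (m z - real n) + h k z) < \<epsilon>"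
    using n(2) k by (simp add: integral_add[OF xi hi])
  ultimately show "\<exists>\<phi> \<rho> N. continuous_on UNIV \<phi> \<and> \<rho> integrable_on ?S \<and> negligible N \<and>
     (\<forall>z\<in>?S - N. norm (G z - \<phi> z) \<le> \<rho> z) \<and> integral ?S \<rho> < \<epsilon>"
    using cT[of k] g(1) integrable_add[OF xi hi]
    by (intro exI[of _ "\<lambda>z. ?T (g k z)"] exI[of _ "\<lambda>z. max 0 (m z - real n) + h k z"] exI[of _ N]) auto
qed

lemma integrable_on_cbox_Fubini:
  fixes \<rho> :: "real \<times> real \<Rightarrow> real"
  assumes i: "\<rho> integrable_on cbox (a, c) (b, d)" and pos: "\<And>z. z \<in> cbox (a, c) (b, d) \<Longrightarrow> 0 \<le> \<rho> z"
  shows "\<exists>N. negligible N \<and> (\<forall>t\<in>{a..b} - N. (\<lambda>s. \<rho> (t, s)) integrable_on {c..d})"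
    and "(\<lambda>t. integral {c..d} (\<lambda>s. \<rho> (t, s))) integrable_on {a..b}"
    and "integral {a..b} (\<lambda>t. integral {c..d} (\<lambda>s. \<rho> (t, s))) = integral (cbox (a, c) (b, d)) \<rho>"
proof -
  define f where "f z = (if z \<in> cbox (a, c) (b, d) then \<rho> z else 0)" for z
  have "\<rho> absolutely_integrable_on cbox (a, c) (b, d)"
    using i pos by (rule nonnegative_absolutely_integrable_1)
  then have f: "integrable lebesgue f"
    unfolding set_integrable_def f_def indicator_scaleR_eq_if .
  have fI: "(f has_integral integral (cbox (a, c) (b, d)) \<rho>) UNIV"
    unfolding f_def has_integral_restrict_UNIV using i by (rule integrable_integral)
  obtain f' where f': "f' \<in> borel_measurable lborel" "AE z in lborel. f z = f' z"
    using completion_ex_borel_measurable_real[OF borel_measurable_integrable[OF f]] by auto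
  have "integrable lebesgue f'"
  proof (rule integrable_cong_AE_imp[OF f])
    show "f' \<in> borel_measurable lebesgue" using f'(1) by (rule measurable_completion)
    show "AE z in lebesgue. f z = f' z" using f'(2) by (rule AE_completion)
  qed
  then have f'i: "integrable lborel f'" using f'(1) by (simp add: integrable_completion)
  have f'I: "integral\<^sup>L lborel f' = integral (cbox (a, c) (b, d)) \<rho>"
  proof -
    have "(f has_integral integral\<^sup>L lborel f') UNIV"
      using has_integral_integral_real[OF f'i] f'(2) by (subst has_integral_AE[of _ _ f']) auto
    then show ?thesis using fI has_integral_unique by blast
  qed
  have f'i2: "integrable (lborel \<Otimes>\<^sub>M lborel) f'" using f'i by (simp add: lborel_prod)
  have ae: "AE z in (lborel \<Otimes>\<^sub>M lborel). f z = f' z" unfolding lborel_prod by (rule f'(2))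
  have "AE t in lborel. (AE s in lborel. f (t, s) = f' (t, s)) \<and> integrable lborel (\<lambda>s. f' (t, s))"
    using lborel_pair.AE_pair[OF ae] lborel_pair.AE_integrable_fst'[OF f'i2] by eventually_elim auto
  then obtain N where N: "negligible N" "\<And>t. t \<notin> N \<Longrightarrow> (AE s in lborel. f (t, s) = f' (t, s)) \<and> integrable lborel (\<lambda>s. f' (t, s))"
    using AE_lborel_negligible by blast
  have sec: "((\<lambda>s. \<rho> (t, s)) has_integral (\<integral>s. f' (t, s) \<partial>lborel)) {c..d}" if t: "t \<in> {a..b} - N" for t
  proof -
    have "((\<lambda>s. f (t, s)) has_integral (\<integral>s. f' (t, s) \<partial>lborel)) UNIV"
      using N(2)[of t] t has_integral_integral_real[of "\<lambda>s. f' (t, s)"]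
      by (subst has_integral_AE[of _ _ "\<lambda>s. f' (t, s)"]) auto
    moreover have "(\<lambda>s. f (t, s)) = (\<lambda>s. if s \<in> {c..d} then \<rho> (t, s) else 0)"
      using t by (auto simp: f_def cbox_Pair_eq)
    ultimately show ?thesis by (simp only: has_integral_restrict_UNIV)
  qed
  have sec0: "(\<integral>s. f' (t, s) \<partial>lborel) = 0" if t: "t \<notin> {a..b}" "t \<notin> N" for t
  proof -
    have "((\<lambda>s. f (t, s)) has_integral (\<integral>s. f' (t, s) \<partial>lborel)) UNIV"
      using N(2)[of t] t has_integral_integral_real[of "\<lambda>s. f' (t, s)"]
      by (subst has_integral_AE[of _ _ "\<lambda>s. f' (t, s)"]) auto
    moreover have "(\<lambda>s. f (t, s)) = (\<lambda>s. 0)"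
      using t by (auto simp: f_def cbox_Pair_eq)
    ultimately show ?thesis by simp
  qed
  have "((\<lambda>t. \<integral>s. f' (t, s) \<partial>lborel) has_integral integral\<^sup>L lborel f') UNIV"
    using has_integral_integral_real[OF lborel_pair.integrable_fst'[OF f'i2]]
      lborel_pair.integral_fst'[OF f'i2] by (simp add: lborel_prod)
  then have "((\<lambda>t. if t \<in> {a..b} then \<integral>s. f' (t, s) \<partial>lborel else 0) has_integral integral\<^sup>L lborel f') UNIV"
    by (rule has_integral_spike[OF N(1), rotated]) (use sec0 in auto)
  then have "((\<lambda>t. \<integral>s. f' (t, s) \<partial>lborel) has_integral integral\<^sup>L lborel f') {a..b}"
    by (simp only: has_integral_restrict_UNIV)
  then have "((\<lambda>t. integral {c..d} (\<lambda>s. \<rho> (t, s))) has_integral integral\<^sup>L lborel f') {a..b}"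
    by (rule has_integral_spike[OF N(1), rotated]) (use integral_unique[OF sec] in auto)
  then show "(\<lambda>t. integral {c..d} (\<lambda>s. \<rho> (t, s))) integrable_on {a..b}"
    and "integral {a..b} (\<lambda>t. integral {c..d} (\<lambda>s. \<rho> (t, s))) = integral (cbox (a, c) (b, d)) \<rho>"
    using f'I by (auto simp: integrable_on_def integral_unique)
  show "\<exists>N. negligible N \<and> (\<forall>t\<in>{a..b} - N. (\<lambda>s. \<rho> (t, s)) integrable_on {c..d})"
    using N(1) has_integral_integrable[OF sec] by blast
qed

lemma bochner_integrable_on_Fubini:
  fixes G :: "real \<times> real \<Rightarrow> 'b::banach"
  assumes G: "G bochner_integrable_on cbox (a, c) (b, d)"
  shows "\<exists>N. negligible N \<and> (\<forall>t\<in>{a..b} - N. (\<lambda>s. G (t, s)) bochner_integrable_on {c..d})"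
    and "(\<lambda>t. integral {c..d} (\<lambda>s. G (t, s))) bochner_integrable_on {a..b}"
proof -
  let ?S = "cbox (a, c) (b, d)"
  from bochner_integrable_on_approx_seq[OF G]
  obtain \<phi> \<rho> where r': "\<forall>k::nat. continuous_on UNIV (\<phi> k) \<and> \<rho> k integrable_on ?S \<and>
    (\<forall>z\<in>?S. norm (G z - \<phi> k z) \<le> \<rho> k z) \<and> integral ?S (\<rho> k) < (1/2) ^ k"
    by blast
  have r: "\<And>k::nat. continuous_on UNIV (\<phi> k)" "\<And>k. \<rho> k integrable_on ?S"
    "\<And>k z. z \<in> ?S \<Longrightarrow> norm (G z - \<phi> k z) \<le> \<rho> k z" "\<And>k. integral ?S (\<rho> k) < (1/2) ^ k"
    using r' by auto
  have r0: "0 \<le> \<rho> k z" if "z \<in> ?S" for k z using r(3)[OF that, of k] norm_ge_zero order_trans by blast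
  have "\<forall>k. \<exists>N. negligible N \<and> (\<forall>t\<in>{a..b} - N. (\<lambda>s. \<rho> k (t, s)) integrable_on {c..d})"
    by (intro allI integrable_on_cbox_Fubini(1) r(2) r0)
  from choice[OF this] obtain N where N':
    "\<forall>k. negligible (N k) \<and> (\<forall>t\<in>{a..b} - N k. (\<lambda>s. \<rho> k (t, s)) integrable_on {c..d})" ..
  have N: "\<And>k. negligible (N k)"
    "\<And>k t. t \<in> {a..b} - N k \<Longrightarrow> (\<lambda>s. \<rho> k (t, s)) integrable_on {c..d}"
    "\<And>k. (\<lambda>t. integral {c..d} (\<lambda>s. \<rho> k (t, s))) integrable_on {a..b}"
    "\<And>k. integral {a..b} (\<lambda>t. integral {c..d} (\<lambda>s. \<rho> k (t, s))) = integral ?S (\<rho> k)"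
    using N' integrable_on_cbox_Fubini(2,3)[OF r(2) r0] by auto
  define R where "R k t = (if t \<in> N k then 0 else integral {c..d} (\<lambda>s. \<rho> k (t, s)))" for k t
  have Ri: "R k integrable_on {a..b}" for k
    by (rule integrable_spike[OF N(3)[of k] N(1)[of k]]) (auto simp: R_def)
  have RI: "integral {a..b} (R k) = integral ?S (\<rho> k)" for k
    unfolding N(4)[symmetric] by (rule integral_spike[OF N(1)[of k]]) (auto simp: R_def)
  have R0: "0 \<le> R k t" if "t \<in> {a..b}" for k t
    using that N(2)[of t k] r0 by (auto simp: R_def cbox_Pair_eq intro!: integral_nonneg)
  have "\<exists>N. negligible N \<and> (\<forall>t\<in>{a..b} - N. (\<lambda>k. R k t) \<longlonglongrightarrow> 0)"
    using r(4) by (intro integrals_less_half_powers_tendsto_0_ae Ri R0) (auto simp: RI)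
  then obtain N0 where N0: "negligible N0" "\<And>t. t \<in> {a..b} - N0 \<Longrightarrow> (\<lambda>k. R k t) \<longlonglongrightarrow> 0"
    by blast
  define M where "M = N0 \<union> (\<Union>k. N k)"
  have M: "negligible M" using N0(1) N(1) by (auto simp: M_def intro!: negligible_Union_nat)
  have cs: "continuous_on UNIV (\<lambda>s. \<phi> k (t, s))" for k t
    by (rule continuous_on_compose2[OF r(1)]) (auto intro!: continuous_intros)
  have sec: "(\<lambda>s. G (t, s)) bochner_integrable_on {c..d}" if t: "t \<in> {a..b} - M" for t
  proof (rule bochner_integrable_onI_continuous)
    fix \<epsilon> :: real assume e: "\<epsilon> > 0"
    have t': "t \<notin> N0" "\<And>k. t \<notin> N k" "t \<in> {a..b}" using t by (auto simp: M_def)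
    obtain k where k: "R k t < \<epsilon>"
      using order_tendstoD(2)[OF N0(2)[of t] e] t' unfolding eventually_sequentially by blast
    show "\<exists>\<phi> \<rho> N. continuous_on UNIV \<phi> \<and> \<rho> integrable_on {c..d} \<and> negligible N \<and>
     (\<forall>s\<in>{c..d} - N. norm (G (t, s) - \<phi> s) \<le> \<rho> s) \<and> integral {c..d} \<rho> < \<epsilon>"
      using cs[of k t] N(2)[of t k] t' r(3)[of "(t, _)" k] k
      by (intro exI[of _ "\<lambda>s. \<phi> k (t, s)"] exI[of _ "\<lambda>s. \<rho> k (t, s)"] exI[of _ "{}"])
        (auto simp: R_def cbox_Pair_eq)
  qed
  show "(\<lambda>t. integral {c..d} (\<lambda>s. G (t, s))) bochner_integrable_on {a..b}"
  proof (rule bochner_integrable_onI_continuous)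
    fix \<epsilon> :: real assume e: "\<epsilon> > 0"
    obtain k where k: "(1/2) ^ k < \<epsilon>" using real_arch_pow_inv[OF e, of "1/2"] by auto
    have "norm (integral {c..d} (\<lambda>s. G (t, s)) - integral {c..d} (\<lambda>s. \<phi> k (t, s))) \<le> R k t"
      if t: "t \<in> {a..b} - M" for t
    proof -
      have t': "t \<notin> N0" "\<And>k. t \<notin> N k" "t \<in> {a..b}" using t by (auto simp: M_def)
      have gi: "(\<lambda>s. G (t, s)) integrable_on {c..d}"
        using bochner_integrable_on_imp_integrable[of "\<lambda>s. G (t, s)" c d] sec[OF t] by simp
      have pi: "(\<lambda>s. \<phi> k (t, s)) integrable_on {c..d}"
        by (intro integrable_continuous_real continuous_on_subset[OF cs]) auto
      have "norm (integral {c..d} (\<lambda>s. G (t, s) - \<phi> k (t, s))) \<le> integral {c..d} (\<lambda>s. \<rho> k (t, s))"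
        using t' N(2)[of t k] r(3)[of "(t, _)" k]
        by (intro integral_norm_bound_integral integrable_diff gi pi) (auto simp: cbox_Pair_eq)
      then show ?thesis using t' by (simp add: integral_diff[OF gi pi] R_def)
    qed
    moreover have "continuous_on UNIV (\<lambda>t. integral {c..d} (\<lambda>s. \<phi> k (t, s)))"
      using integral_continuous_on_param[of UNIV c d "\<lambda>t s. \<phi> k (t, s)"] r(1)[of k]
      by (auto simp: split_def intro: continuous_on_subset)
    moreover have "integral {a..b} (R k) < \<epsilon>" using r(4)[of k] RI k by simp
    ultimately show "\<exists>\<phi> \<rho> N. continuous_on UNIV \<phi> \<and> \<rho> integrable_on {a..b} \<and> negligible N \<and>
     (\<forall>t\<in>{a..b} - N. norm (integral {c..d} (\<lambda>s. G (t, s)) - \<phi> t) \<le> \<rho> t) \<and> integral {a..b} \<rho> < \<epsilon>"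
      using Ri[of k] M
      by (intro exI[of _ "\<lambda>t. integral {c..d} (\<lambda>s. \<phi> k (t, s))"] exI[of _ "R k"] exI[of _ M]) auto
  qed
  show "\<exists>N. negligible N \<and> (\<forall>t\<in>{a..b} - N. (\<lambda>s. G (t, s)) bochner_integrable_on {c..d})"
    using M sec by blast
qed


text \<open>Near-constancy of \<open>x\<close> on the members of a partition of unity reduces this to the functions
  \<open>\<lambda>z. G z c\<close>. The error is dominated and tends to 0 pointwise.\<close>

lemma bochner_integrable_on_Caratheodory:
  fixes G :: "'a::euclidean_space \<Rightarrow> 'b::banach \<Rightarrow> 'b" and x :: "'a \<Rightarrow> 'b"
  assumes meas: "\<And>v. (\<lambda>z. G z v) measurable_on cbox a b"
    and \<kappa>: "\<kappa> measurable_on cbox a b" "\<And>z. z \<in> cbox a b \<Longrightarrow> 0 \<le> \<kappa> z"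
    and lip: "\<And>z u v. \<lbrakk>z \<in> cbox a b; norm u \<le> R; norm v \<le> R\<rbrakk> \<Longrightarrow> norm (G z u - G z v) \<le> \<kappa> z * norm (u - v)"
    and \<beta>: "\<beta> integrable_on cbox a b"
    and growth: "\<And>z v. z \<in> cbox a b \<Longrightarrow> norm (G z v) \<le> \<beta> z * (1 + norm v)"
    and x: "continuous_on UNIV x" and K: "compact K" "range x \<subseteq> K" "\<And>v. v \<in> K \<Longrightarrow> norm v \<le> R"
  shows "(\<lambda>z. G z (x z)) bochner_integrable_on cbox a b"
proof (rule bochner_integrable_onI)
  fix \<epsilon> :: real assume e: "\<epsilon> > 0"
  let ?S = "cbox a b"
  have b0: "0 \<le> \<beta> z" if "z \<in> ?S" for z using order_trans[OF norm_ge_zero growth[OF that, of 0]] by simp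
  have R0: "0 \<le> R"
  proof -
    have "norm (x undefined) \<le> R" using K(2,3) by blast
    then show ?thesis using norm_ge_zero order_trans by blast
  qed
  define E where "E = (\<lambda>(n::nat) z. min (\<kappa> z * (1 / real (Suc n))) (2 * (1 + R) * \<beta> z))"
  have E0: "0 \<le> E n z" if "z \<in> ?S" for n z using b0 \<kappa>(2) that R0 by (auto simp: E_def)
  have bi: "(\<lambda>z. 2 * (1 + R) * \<beta> z) integrable_on ?S"
    using integrable_on_cmult_left[OF \<beta>, of "2 * (1 + R)"] by simp
  have Ei: "E n integrable_on ?S" for n
  proof (rule measurable_bounded_by_integrable_imp_integrable_real[OF _ bi])
    have "\<kappa> \<in> borel_measurable (lebesgue_on ?S)"
      using \<kappa>(1) by (simp add: measurable_on_iff_borel_measurable)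
    moreover have "\<beta> \<in> borel_measurable (lebesgue_on ?S)" using \<beta> by (rule integrable_imp_measurable)
    ultimately show "E n \<in> borel_measurable (lebesgue_on ?S)" unfolding E_def by measurable
    show "\<bar>E n z\<bar> \<le> 2 * (1 + R) * \<beta> z" if "z \<in> ?S" for z using E0[OF that, of n] by (simp add: E_def)
  qed auto
  have "(\<lambda>n. integral ?S (E n)) \<longlonglongrightarrow> integral ?S (\<lambda>z. 0)"
  proof (rule dominated_convergence(2)[OF Ei bi])
    show "norm (E n z) \<le> 2 * (1 + R) * \<beta> z" if "z \<in> ?S" for n z using E0[OF that, of n] by (simp add: E_def)
    fix z assume z: "z \<in> ?S"
    have "(\<lambda>n. \<kappa> z * (1 / real (Suc n))) \<longlonglongrightarrow> \<kappa> z * 0"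
      by (intro tendsto_mult tendsto_const) (rule LIMSEQ_Suc[OF lim_1_over_n])
    then have "(\<lambda>n. \<kappa> z * (1 / real (Suc n))) \<longlonglongrightarrow> 0" by simp
    show "(\<lambda>n. E n z) \<longlonglongrightarrow> 0"
    proof (rule tendsto_sandwich)
      show "\<forall>\<^sub>F n in sequentially. 0 \<le> E n z" using E0[OF z] by simp
      show "\<forall>\<^sub>F n in sequentially. E n z \<le> \<kappa> z * (1 / real (Suc n))" by (simp add: E_def)
      show "(\<lambda>n. \<kappa> z * (1 / real (Suc n))) \<longlonglongrightarrow> 0" by fact
    qed (rule tendsto_const)
  qed
  then have "eventually (\<lambda>n. integral ?S (E n) < \<epsilon>) sequentially"
    using e by (intro order_tendstoD(2)) auto
  then obtain n where n: "integral ?S (E n) < \<epsilon>" unfolding eventually_sequentially by blast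
  define \<delta> where "\<delta> = 1 / real (Suc n)"
  have d: "\<delta> > 0" by (simp add: \<delta>_def)
  obtain P where P: "finite P" "P \<subseteq> K" "K \<subseteq> (\<Union>c\<in>P. ball c \<delta>)"
    using seq_compact_imp_totally_bounded[OF compact_imp_seq_compact[OF K(1)], rule_format, OF d] by auto
  define l where "l = (\<lambda>c z. max 0 (\<delta> - dist c (x z)))"
  define L where "L z = (\<Sum>c\<in>P. l c z)" for z
  have l0: "0 \<le> l c z" for c z by (simp add: l_def)
  have Lpos: "L z > 0" for z
  proof -
    have "x z \<in> K" using K(2) by auto
    then obtain c where c: "c \<in> P" "dist c (x z) < \<delta>" using P(3) by auto
    then have "0 < l c z" by (simp add: l_def)
    also have "\<dots> \<le> L z" unfolding L_def using P(1) c(1) l0 by (intro member_le_sum) auto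
    finally show ?thesis .
  qed
  have lc: "continuous_on UNIV (l c)" for c
    unfolding l_def by (intro continuous_intros x)
  have Lc: "continuous_on UNIV L" unfolding L_def using lc by (intro continuous_on_sum)
  define w where "w = (\<lambda>c z. l c z / L z)"
  have wc: "continuous_on UNIV (w c)" for c
    unfolding w_def using Lpos by (intro continuous_on_divide lc Lc) (metis less_irrefl)
  have w0: "0 \<le> w c z" for c z using l0 Lpos[of z] by (simp add: w_def)
  have wsum: "(\<Sum>c\<in>P. w c z) = 1" for z
    using Lpos[of z] by (simp add: w_def L_def sum_divide_distrib[symmetric])
  have w1: "\<bar>w c z\<bar> \<le> 1" if "c \<in> P" for c z
  proof -
    have "w c z \<le> (\<Sum>c\<in>P. w c z)" using P(1) that w0 by (intro member_le_sum) auto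
    then show ?thesis using w0[of c z] wsum[of z] by simp
  qed
  define G' where "G' z = (\<Sum>c\<in>P. w c z *\<^sub>R G z c)" for z
  have "G' bochner_integrable_on ?S"
    unfolding G'_def
  proof (intro bochner_integrable_on_sum P(1) bochner_integrable_on_scaleR_continuous wc w1)
    fix c assume "c \<in> P"
    have "(\<lambda>z. \<beta> z * (1 + norm c)) integrable_on ?S" using \<beta> by (rule integrable_on_mult_left)
    then show "(\<lambda>z. G z c) bochner_integrable_on ?S"
      by (rule measurable_on_imp_bochner_integrable_on[OF meas _ growth])
  qed
  moreover have "norm (G z (x z) - G' z) \<le> E n z" if z: "z \<in> ?S" for z
  proof -
    have xz: "norm (x z) \<le> R" using K(2,3) by blast
    have "G z (x z) - G' z = (\<Sum>c\<in>P. w c z *\<^sub>R (G z (x z) - G z c))"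
      using wsum[of z] by (simp add: G'_def scaleR_diff_right sum_subtractf scaleR_left.sum[symmetric])
    also have "norm \<dots> \<le> (\<Sum>c\<in>P. w c z * E n z)"
    proof (rule order_trans[OF norm_sum], rule sum_mono)
      fix c assume c: "c \<in> P"
      have cR: "norm c \<le> R" using c P(2) K(3) by blast
      show "norm (w c z *\<^sub>R (G z (x z) - G z c)) \<le> w c z * E n z"
      proof (cases "dist c (x z) < \<delta>")
        case True
        have "norm (G z (x z) - G z c) \<le> \<kappa> z * norm (x z - c)" by (rule lip[OF z xz cR])
        also have "\<dots> \<le> \<kappa> z * \<delta>"
          using True \<kappa>(2)[OF z] by (intro mult_left_mono) (auto simp: dist_norm norm_minus_commute)
        finally have 1: "norm (G z (x z) - G z c) \<le> \<kappa> z * \<delta>" .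
        have "norm (G z (x z)) \<le> \<beta> z * (1 + R)"
          using growth[OF z, of "x z"] mult_left_mono[of "1 + norm (x z)" "1 + R" "\<beta> z"] xz b0[OF z] by linarith
        moreover have "norm (G z c) \<le> \<beta> z * (1 + R)"
          using growth[OF z, of c] mult_left_mono[of "1 + norm c" "1 + R" "\<beta> z"] cR b0[OF z] by linarith
        ultimately have "norm (G z (x z) - G z c) \<le> \<beta> z * (1 + R) + \<beta> z * (1 + R)"
          using norm_triangle_ineq4[of "G z (x z)" "G z c"] by linarith
        then have "norm (G z (x z) - G z c) \<le> 2 * (1 + R) * \<beta> z" by (simp add: algebra_simps)
        with 1 have "norm (G z (x z) - G z c) \<le> E n z" by (simp add: E_def \<delta>_def)
        then show ?thesis using w0[of c z] by (simp add: mult_left_mono)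
      next
        case False
        then have "w c z = 0" by (simp add: w_def l_def)
        then show ?thesis by simp
      qed
    qed
    also have "\<dots> = E n z" using wsum[of z] by (simp add: sum_distrib_right[symmetric])
    finally show ?thesis .
  qed
  ultimately show "\<exists>G' \<rho> N. G' bochner_integrable_on ?S \<and> \<rho> integrable_on ?S \<and> negligible N \<and>
     (\<forall>z\<in>?S - N. norm (G z (x z) - G' z) \<le> \<rho> z) \<and> integral ?S \<rho> < \<epsilon>"
    using Ei[of n] n by (intro exI[of _ G'] exI[of _ "E n"] exI[of _ "{}"]) auto
qed

lemma has_vector_derivative_at_alt:
  fixes x :: "real \<Rightarrow> 'h::real_normed_vector"
  shows "(x has_vector_derivative d) (at t) \<longleftrightarrow>
    (\<forall>e>0. \<exists>r>0. \<forall>u. \<bar>u - t\<bar> < r \<longrightarrow> norm (x u - x t - (u - t) *\<^sub>R d) \<le> e * \<bar>u - t\<bar>)"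
  unfolding has_vector_derivative_def has_derivative_at_alt
  by (auto intro!: bounded_linear_intros)

lemma has_vector_derivative_at_approx:
  fixes x :: "real \<Rightarrow> 'h::banach"
  assumes inc: "\<And>(k::nat) s t. \<lbrakk>a \<le> s; s \<le> t; t \<le> b\<rbrakk> \<Longrightarrow>
      norm ((x t - X k t) - (x s - X k s)) \<le> P k t - P k s"
    and P: "\<And>k. (P k has_real_derivative \<rho> k) (at t)"
    and X: "\<And>k. (X k has_vector_derivative D k) (at t)"
    and pos: "\<And>k. 0 \<le> \<rho> k" and lim: "\<rho> \<longlonglongrightarrow> 0" and t: "t \<in> {a<..<b}"
  shows "\<exists>d. (x has_vector_derivative d) (at t) \<and> (\<forall>k. norm (d - D k) \<le> \<rho> k)"
proof -
  define q where "q = min (t - a) (b - t)"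
  have q: "q > 0" using t by (simp add: q_def)
  have inc': "norm ((x u - X k u) - (x t - X k t)) \<le> \<bar>P k u - P k t\<bar>" if "\<bar>u - t\<bar> < q" for u k
    using inc[of t u k] inc[of u t k] that t by (cases "t \<le> u") (auto simp: q_def norm_minus_commute)
  have step: "\<exists>r>0. \<forall>u. \<bar>u - t\<bar> < r \<longrightarrow> norm ((x u - X k u) - (x t - X k t)) \<le> (\<rho> k + e) * \<bar>u - t\<bar> \<and>
      norm (X k u - X k t - (u - t) *\<^sub>R D k) \<le> e * \<bar>u - t\<bar>" if e: "e > 0" for k e
  proof -
    obtain r1 where r1: "r1 > 0" "\<And>u. \<bar>u - t\<bar> < r1 \<Longrightarrow> \<bar>P k u - P k t - (u - t) * \<rho> k\<bar> \<le> e * \<bar>u - t\<bar>"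
      using P[of k, unfolded has_real_derivative_iff_has_vector_derivative has_vector_derivative_at_alt] e
      by (auto simp: scaleR_conv_of_real)
    obtain r2 where r2: "r2 > 0" "\<And>u. \<bar>u - t\<bar> < r2 \<Longrightarrow> norm (X k u - X k t - (u - t) *\<^sub>R D k) \<le> e * \<bar>u - t\<bar>"
      using X[of k, unfolded has_vector_derivative_at_alt] e by blast
    have "norm ((x u - X k u) - (x t - X k t)) \<le> (\<rho> k + e) * \<bar>u - t\<bar>" if u: "\<bar>u - t\<bar> < min q r1" for u
    proof -
      have "\<bar>P k u - P k t\<bar> \<le> \<bar>P k u - P k t - (u - t) * \<rho> k\<bar> + \<bar>(u - t) * \<rho> k\<bar>" by linarith
      also have "\<dots> \<le> e * \<bar>u - t\<bar> + \<bar>u - t\<bar> * \<rho> k"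
        using r1(2)[of u] u pos[of k] by (simp add: abs_mult)
      finally show ?thesis using inc'[of u k] u by (simp add: algebra_simps)
    qed
    then show ?thesis using q r1(1) r2 by (intro exI[of _ "min (min q r1) r2"]) auto
  qed
  have DD: "norm (D j - D k) \<le> \<rho> j + \<rho> k" for j k
  proof (rule field_le_epsilon)
    fix e :: real assume e: "e > 0"
    then have e4: "e / 4 > 0" by simp
    obtain r1 where r1: "r1 > 0" "\<And>u. \<bar>u - t\<bar> < r1 \<Longrightarrow> norm ((x u - X k u) - (x t - X k t)) \<le> (\<rho> k + e/4) * \<bar>u - t\<bar> \<and>
      norm (X k u - X k t - (u - t) *\<^sub>R D k) \<le> e/4 * \<bar>u - t\<bar>" using step[OF e4, of k] by blast
    obtain r2 where r2: "r2 > 0" "\<And>u. \<bar>u - t\<bar> < r2 \<Longrightarrow> norm ((x u - X j u) - (x t - X j t)) \<le> (\<rho> j + e/4) * \<bar>u - t\<bar> \<and>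
      norm (X j u - X j t - (u - t) *\<^sub>R D j) \<le> e/4 * \<bar>u - t\<bar>" using step[OF e4, of j] by blast
    define h where "h = min r1 r2 / 2"
    have h: "h > 0" "h < r1" "h < r2" using r1(1) r2(1) by (auto simp: h_def)
    define A1 A2 B1 B2 where "A1 = (x (t + h) - X k (t + h)) - (x t - X k t)"
      and "A2 = (x (t + h) - X j (t + h)) - (x t - X j t)"
      and "B1 = X k (t + h) - X k t - h *\<^sub>R D k" and "B2 = X j (t + h) - X j t - h *\<^sub>R D j"
    have "norm A1 \<le> (\<rho> k + e/4) * h" "norm B1 \<le> e/4 * h" "norm A2 \<le> (\<rho> j + e/4) * h" "norm B2 \<le> e/4 * h"
      using r1(2)[of "t + h"] r2(2)[of "t + h"] h by (auto simp: A1_def A2_def B1_def B2_def)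
    moreover have eq: "h *\<^sub>R (D j - D k) = A1 - A2 + B1 - B2"
      by (simp add: A1_def A2_def B1_def B2_def algebra_simps)
    have "norm (h *\<^sub>R (D j - D k)) \<le> norm A1 + norm A2 + norm B1 + norm B2" unfolding eq by norm
    ultimately have "norm (h *\<^sub>R (D j - D k)) \<le> (\<rho> k + e/4) * h + (\<rho> j + e/4) * h + e/4 * h + e/4 * h"
      by linarith
    also have "\<dots> = (\<rho> j + \<rho> k + e) * h" by (simp add: algebra_simps)
    finally have "norm (h *\<^sub>R (D j - D k)) \<le> (\<rho> j + \<rho> k + e) * h" .
    then have "h * norm (D j - D k) \<le> h * (\<rho> j + \<rho> k + e)" using h(1) by (simp add: mult.commute)
    then show "norm (D j - D k) \<le> \<rho> j + \<rho> k + e" using h(1) by simp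
  qed
  have "Cauchy D"
  proof (rule metric_CauchyI)
    fix e :: real assume e: "0 < e"
    obtain M where M: "\<And>n. n \<ge> M \<Longrightarrow> \<rho> n < e / 2"
      using order_tendstoD(2)[OF lim, of "e/2"] e unfolding eventually_sequentially by auto
    have "dist (D m) (D n) < e" if "m \<ge> M" "n \<ge> M" for m n
      using DD[of m n] M[OF that(1)] M[OF that(2)] by (simp add: dist_norm)
    then show "\<exists>M. \<forall>m\<ge>M. \<forall>n\<ge>M. dist (D m) (D n) < e" by blast
  qed
  then obtain d where d: "D \<longlonglongrightarrow> d" using Cauchy_convergent_iff convergent_def by blast
  have dk: "norm (d - D k) \<le> \<rho> k" for k
  proof (rule LIMSEQ_le)
    show "(\<lambda>j. norm (D j - D k)) \<longlonglongrightarrow> norm (d - D k)" by (intro tendsto_intros d)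
    show "(\<lambda>j. \<rho> j + \<rho> k) \<longlonglongrightarrow> \<rho> k" using tendsto_add[OF lim tendsto_const, of "\<rho> k"] by simp
    show "\<exists>N. \<forall>j\<ge>N. norm (D j - D k) \<le> \<rho> j + \<rho> k" using DD by blast
  qed
  have "(x has_vector_derivative d) (at t)"
    unfolding has_vector_derivative_at_alt
  proof (intro allI impI)
    fix e :: real assume e: "e > 0"
    then have e4: "e / 4 > 0" by simp
    obtain k where k: "\<rho> k < e / 4"
      using order_tendstoD(2)[OF lim e4] unfolding eventually_sequentially by blast
    obtain r where r: "r > 0" "\<And>u. \<bar>u - t\<bar> < r \<Longrightarrow> norm ((x u - X k u) - (x t - X k t)) \<le> (\<rho> k + e/4) * \<bar>u - t\<bar> \<and>
      norm (X k u - X k t - (u - t) *\<^sub>R D k) \<le> e/4 * \<bar>u - t\<bar>" using step[OF e4, of k] by blast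
    have "norm (x u - x t - (u - t) *\<^sub>R d) \<le> e * \<bar>u - t\<bar>" if u: "\<bar>u - t\<bar> < r" for u
    proof -
      have "x u - x t - (u - t) *\<^sub>R d = ((x u - X k u) - (x t - X k t)) + (X k u - X k t - (u - t) *\<^sub>R D k)
        - (u - t) *\<^sub>R (d - D k)" by (simp add: algebra_simps)
      also have "norm \<dots> \<le> norm ((x u - X k u) - (x t - X k t)) + norm (X k u - X k t - (u - t) *\<^sub>R D k)
        + norm ((u - t) *\<^sub>R (d - D k))"
        by (intro order_trans[OF norm_triangle_ineq4] add_right_mono norm_triangle_ineq)
      also have "norm ((u - t) *\<^sub>R (d - D k)) \<le> \<bar>u - t\<bar> * (e/4)"
        unfolding norm_scaleR real_norm_def using dk[of k] k by (intro mult_left_mono) auto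
      also have "norm ((x u - X k u) - (x t - X k t)) \<le> (e/4 + e/4) * \<bar>u - t\<bar>"
        using r(2)[OF u] k mult_right_mono[of "\<rho> k + e/4" "e/4 + e/4" "\<bar>u - t\<bar>"] by linarith
      also have "norm (X k u - X k t - (u - t) *\<^sub>R D k) \<le> e/4 * \<bar>u - t\<bar>" using r(2)[OF u] by blast
      finally show ?thesis by (simp add: algebra_simps)
    qed
    with r(1) show "\<exists>r>0. \<forall>u. \<bar>u - t\<bar> < r \<longrightarrow> norm (x u - x t - (u - t) *\<^sub>R d) \<le> e * \<bar>u - t\<bar>" by blast
  qed
  with dk show ?thesis by blast
qed

lemma integral_diff_Icc:
  fixes f :: "real \<Rightarrow> 'b::banach"
  assumes "f integrable_on {a..b}" "a \<le> s" "s \<le> t" "t \<le> b"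
  shows "integral {a..t} f - integral {a..s} f = integral {s..t} f"
proof -
  have "integral {a..s} f + integral {s..t} f = integral {a..t} f"
    using assms by (intro Henstock_Kurzweil_Integration.integral_combine integrable_on_subinterval[OF assms(1)]) auto
  then show ?thesis by (metis add_diff_cancel_left')
qed

lemma differentiable_ae_approx:
  fixes x :: "real \<Rightarrow> 'h::banach"
  assumes inc: "\<And>(k::nat) s t. \<lbrakk>a \<le> s; s \<le> t; t \<le> b\<rbrakk> \<Longrightarrow>
      norm ((x t - X k t) - (x s - X k s)) \<le> integral {s..t} (\<rho> k)"
    and i: "\<And>k. \<rho> k integrable_on {a..b}" and pos: "\<And>k t. t \<in> {a..b} \<Longrightarrow> 0 \<le> \<rho> k t"
    and small: "\<And>k. integral {a..b} (\<rho> k) < (1/2) ^ k"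
    and N: "negligible N" and X: "\<And>k t. t \<in> {a<..<b} - N \<Longrightarrow> (X k has_vector_derivative D k t) (at t)"
  shows "\<exists>M d. negligible M \<and> (\<forall>t\<in>{a<..<b} - M. (x has_vector_derivative d t) (at t) \<and>
    (\<forall>k. norm (d t - D k t) \<le> \<rho> k t) \<and> (\<lambda>k. \<rho> k t) \<longlonglongrightarrow> 0)"
proof -
  have "\<forall>k. \<exists>M. negligible M \<and> (\<forall>t\<in>{a<..<b} - M. ((\<lambda>u. integral {a..u} (\<rho> k)) has_real_derivative \<rho> k t) (at t))"
    using indefinite_integral_differentiable_ae[OF i] by metis
  from choice[OF this] obtain M where M: "\<forall>k. negligible (M k) \<and>
    (\<forall>t\<in>{a<..<b} - M k. ((\<lambda>u. integral {a..u} (\<rho> k)) has_real_derivative \<rho> k t) (at t))" ..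
  obtain M0 where M0: "negligible M0" "\<And>t. t \<in> {a..b} - M0 \<Longrightarrow> (\<lambda>k. \<rho> k t) \<longlonglongrightarrow> 0"
    using integrals_less_half_powers_tendsto_0_ae[OF i pos small] by blast
  define Q where "Q = N \<union> M0 \<union> (\<Union>k. M k)"
  have Q: "negligible Q" using N M0(1) M by (auto simp: Q_def intro!: negligible_Union_nat)
  have inc2: "norm ((x t - X k t) - (x s - X k s)) \<le> integral {a..t} (\<rho> k) - integral {a..s} (\<rho> k)"
    if "a \<le> s" "s \<le> t" "t \<le> b" for k s t
    using inc[OF that] integral_diff_Icc[OF i that, of k] by simp
  have "\<exists>d. (x has_vector_derivative d) (at t) \<and> (\<forall>k. norm (d - D k t) \<le> \<rho> k t) \<and> (\<lambda>k. \<rho> k t) \<longlonglongrightarrow> 0"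
    if t: "t \<in> {a<..<b} - Q" for t
  proof -
    have t': "t \<in> {a<..<b}" "t \<notin> N" "t \<notin> M0" "\<And>k. t \<notin> M k" using t by (auto simp: Q_def)
    have "\<exists>d. (x has_vector_derivative d) (at t) \<and> (\<forall>k. norm (d - D k t) \<le> \<rho> k t)"
    proof (rule has_vector_derivative_at_approx[OF inc2])
      show "((\<lambda>u. integral {a..u} (\<rho> k)) has_real_derivative \<rho> k t) (at t)" for k using M t' by blast
      show "(X k has_vector_derivative D k t) (at t)" for k using X t' by blast
      show "0 \<le> \<rho> k t" for k using pos t' by auto
      show "(\<lambda>k. \<rho> k t) \<longlonglongrightarrow> 0" using M0(2)[of t] t' by auto
    qed (use t' in auto)
    then show ?thesis using M0(2)[of t] t' by auto
  qed
  then have "\<forall>t\<in>{a<..<b} - Q. \<exists>d. (x has_vector_derivative d) (at t) \<and> (\<forall>k. norm (d - D k t) \<le> \<rho> k t) \<and> (\<lambda>k. \<rho> k t) \<longlonglongrightarrow> 0"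
    by blast
  from bchoice[OF this] Q show ?thesis by blast
qed

lemma bochner_integrable_on_indefinite_integral_derivative:
  fixes h :: "real \<Rightarrow> 'h::banach"
  assumes h: "h bochner_integrable_on {a..b}"
  shows "\<exists>N. negligible N \<and> (\<forall>t\<in>{a<..<b} - N. ((\<lambda>u. integral {a..u} h) has_vector_derivative h t) (at t))"
proof -
  from bochner_integrable_on_approx_seq[OF h]
  obtain \<phi> \<rho> where r': "\<forall>k::nat. continuous_on UNIV (\<phi> k) \<and> \<rho> k integrable_on {a..b} \<and>
    (\<forall>z\<in>{a..b}. norm (h z - \<phi> k z) \<le> \<rho> k z) \<and> integral {a..b} (\<rho> k) < (1/2) ^ k"
    by blast
  have r: "\<And>k::nat. continuous_on UNIV (\<phi> k)" "\<And>k. \<rho> k integrable_on {a..b}"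
    "\<And>k z. z \<in> {a..b} \<Longrightarrow> norm (h z - \<phi> k z) \<le> \<rho> k z" "\<And>k. integral {a..b} (\<rho> k) < (1/2) ^ k"
    using r' by auto
  have hi: "h integrable_on {a..b}" using bochner_integrable_on_imp_integrable[of h a b] h by simp
  have phi: "\<phi> k integrable_on {a..b}" for k
    using integrable_continuous_real continuous_on_subset[OF r(1) subset_UNIV] by blast
  have "\<exists>M d. negligible M \<and> (\<forall>t\<in>{a<..<b} - M. ((\<lambda>u. integral {a..u} h) has_vector_derivative d t) (at t) \<and>
    (\<forall>k. norm (d t - \<phi> k t) \<le> \<rho> k t) \<and> (\<lambda>k. \<rho> k t) \<longlonglongrightarrow> 0)"
  proof (rule differentiable_ae_approx[where X = "\<lambda>k u. integral {a..u} (\<phi> k)" and N = "{}"])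
    fix k s t assume st: "a \<le> s" "s \<le> t" "t \<le> b"
    have sub: "h integrable_on {s..t}" "\<phi> k integrable_on {s..t}" "\<rho> k integrable_on {s..t}"
      using st by (auto intro: integrable_on_subinterval[OF hi] integrable_on_subinterval[OF phi] integrable_on_subinterval[OF r(2)])
    have "(integral {a..t} h - integral {a..t} (\<phi> k)) - (integral {a..s} h - integral {a..s} (\<phi> k))
       = integral {s..t} h - integral {s..t} (\<phi> k)"
      using integral_diff_Icc[OF hi st] integral_diff_Icc[OF phi st, of k] by (simp add: algebra_simps)
    also have "\<dots> = integral {s..t} (\<lambda>z. h z - \<phi> k z)" using sub by (simp add: integral_diff)
    also have "norm \<dots> \<le> integral {s..t} (\<rho> k)"
      using sub r(3) st by (intro integral_norm_bound_integral integrable_diff) auto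
    finally show "norm ((integral {a..t} h - integral {a..t} (\<phi> k)) - (integral {a..s} h - integral {a..s} (\<phi> k)))
      \<le> integral {s..t} (\<rho> k)" .
  next
    show "0 \<le> \<rho> k t" if "t \<in> {a..b}" for k t using order_trans[OF norm_ge_zero r(3)[OF that]] .
    fix k t assume t: "t \<in> {a<..<b} - {}"
    have "((\<lambda>u. integral {a..u} (\<phi> k)) has_vector_derivative \<phi> k t) (at t within {a..b})"
      using t by (intro integral_has_vector_derivative continuous_on_subset[OF r(1)]) auto
    then show "((\<lambda>u. integral {a..u} (\<phi> k)) has_vector_derivative \<phi> k t) (at t)"
      using t at_within_interior[of t "{a..b}"] by (simp add: interior_atLeastAtMost_real)
  qed (use r in auto)
  then obtain M d where M: "negligible M" "\<And>t. t \<in> {a<..<b} - M \<Longrightarrow> ((\<lambda>u. integral {a..u} h) has_vector_derivative d t) (at t) \<and>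
    (\<forall>k. norm (d t - \<phi> k t) \<le> \<rho> k t) \<and> (\<lambda>k. \<rho> k t) \<longlonglongrightarrow> 0" by blast
  have "d t = h t" if t: "t \<in> {a<..<b} - M" for t
  proof -
    have lim: "(\<lambda>k. \<rho> k t) \<longlonglongrightarrow> 0" and dk: "norm (d t - \<phi> k t) \<le> \<rho> k t" for k using M(2)[OF t] by auto
    have "norm (d t - h t) \<le> \<rho> k t + \<rho> k t" for k
    proof -
      have "norm (d t - h t) \<le> norm (d t - \<phi> k t) + norm (h t - \<phi> k t)" by norm
      then show ?thesis using dk[of k] r(3)[of t k] t by auto
    qed
    moreover have "(\<lambda>k. \<rho> k t + \<rho> k t) \<longlonglongrightarrow> 0 + 0" by (intro tendsto_add lim)
    ultimately have "norm (d t - h t) \<le> 0 + 0" by (intro LIMSEQ_le_const[of "\<lambda>k. \<rho> k t + \<rho> k t"]) auto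
    then show ?thesis by simp
  qed
  then show ?thesis using M by (intro exI[of _ M]) auto
qed


lemma bochner_integrable_on_diff:
  assumes "F bochner_integrable_on S" "G bochner_integrable_on S"
  shows "(\<lambda>z. F z - G z) bochner_integrable_on S"
  using bochner_integrable_on_add[OF assms(1) bochner_integrable_on_scaleR_continuous[OF assms(2), of "\<lambda>_. -1"]]
  by simp

lemma bochner_integrable_on_scaleR_const:
  fixes f :: "'a::euclidean_space \<Rightarrow> real" and v :: "'b::banach"
  assumes f: "f bochner_integrable_on S"
  shows "(\<lambda>z. f z *\<^sub>R v) bochner_integrable_on S"
proof (rule bochner_integrable_onI_continuous)
  fix \<epsilon> :: real assume e: "\<epsilon> > 0"
  then have "\<epsilon> / (1 + norm v) > 0" by (simp add: add_pos_nonneg)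
  then obtain \<phi> \<rho> where r: "continuous_on UNIV \<phi>" "\<rho> integrable_on S"
     "\<forall>z\<in>S. norm (f z - \<phi> z) \<le> \<rho> z" "integral S \<rho> < \<epsilon> / (1 + norm v)"
    using f unfolding bochner_integrable_on_def by blast
  have "norm (f z *\<^sub>R v - \<phi> z *\<^sub>R v) \<le> \<rho> z * (1 + norm v)" if "z \<in> S" for z
  proof -
    have "norm (f z *\<^sub>R v - \<phi> z *\<^sub>R v) = \<bar>f z - \<phi> z\<bar> * norm v"
      by (simp add: scaleR_left_diff_distrib[symmetric])
    also have "\<dots> \<le> \<rho> z * (1 + norm v)" using r(3) that by (intro mult_mono) fastforce+
    finally show ?thesis .
  qed
  moreover have "integral S (\<lambda>z. \<rho> z * (1 + norm v)) < \<epsilon>"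
  proof -
    have "integral S (\<lambda>z. \<rho> z * (1 + norm v)) = integral S \<rho> * (1 + norm v)" by simp
    also have "\<dots> < \<epsilon> / (1 + norm v) * (1 + norm v)"
      using r(4) by (intro mult_strict_right_mono) (auto simp: add_pos_nonneg)
    also have "\<dots> = \<epsilon>" by (simp add: add_pos_nonneg pos_add_strict[THEN less_imp_neq] add_nonneg_eq_0_iff)
    finally show ?thesis .
  qed
  ultimately show "\<exists>\<phi> \<rho> N. continuous_on UNIV \<phi> \<and> \<rho> integrable_on S \<and> negligible N \<and>
     (\<forall>z\<in>S - N. norm (f z *\<^sub>R v - \<phi> z) \<le> \<rho> z) \<and> integral S \<rho> < \<epsilon>"
    using r(1) integrable_on_mult_left[OF r(2), of "1 + norm v"]
    by (intro exI[of _ "\<lambda>z. \<phi> z *\<^sub>R v"] exI[of _ "\<lambda>z. \<rho> z * (1 + norm v)"] exI[of _ "{}"])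
      (auto intro: continuous_intros)
qed

lemma bochner_integrable_on_Icc_integrable:
  fixes h :: "real \<Rightarrow> 'b::banach"
  assumes "h bochner_integrable_on {a..b}"
  shows "h integrable_on {a..b}" "(\<lambda>t. norm (h t)) integrable_on {a..b}"
  using bochner_integrable_on_imp_integrable[of h a b] bochner_integrable_on_norm_integrable[of h a b] assms by simp_all

text \<open>The \<open>L\<^sup>1\<close>-limit of the \<open>G n\<close> is the derivative of \<open>x\<close>, along a rapidly converging subsequence.\<close>

lemma differentiable_ae_of_L1_Cauchy:
  fixes x :: "real \<Rightarrow> 'h::banach"
  assumes G: "\<And>n::nat. G n bochner_integrable_on {a..b}"
    and cau: "\<And>\<epsilon>. \<epsilon> > 0 \<Longrightarrow> \<exists>K. \<forall>l k. K \<le> k \<longrightarrow> k \<le> l \<longrightarrow> integral {a..b} (\<lambda>t. norm (G l t - G k t)) \<le> \<epsilon>"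
    and lim: "\<And>s t. \<lbrakk>a \<le> s; s \<le> t; t \<le> b\<rbrakk> \<Longrightarrow> (\<lambda>n. integral {s..t} (G n)) \<longlonglongrightarrow> x t - x s"
  shows "\<exists>N. negligible N \<and> (\<forall>t\<in>{a<..<b} - N. \<exists>d. (x has_vector_derivative d) (at t))"
proof -
  have "\<forall>j. \<exists>K. \<forall>l k. K \<le> k \<longrightarrow> k \<le> l \<longrightarrow> integral {a..b} (\<lambda>t. norm (G l t - G k t)) \<le> (1/2) ^ (j + 2)"
    by (intro allI cau) simp
  from choice[OF this] obtain K where K: "\<forall>j. \<forall>l k. K j \<le> k \<longrightarrow> k \<le> l \<longrightarrow>
      integral {a..b} (\<lambda>t. norm (G l t - G k t)) \<le> (1/2) ^ (j + 2)" ..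
  define \<kappa> where "\<kappa> j = j + (\<Sum>i\<le>j. K i)" for j
  have \<kappa>K: "K j \<le> \<kappa> j" for j
    using member_le_sum[of j "{..j}" K] by (simp add: \<kappa>_def)
  have \<kappa>S: "\<kappa> j \<le> \<kappa> (Suc j)" for j by (simp add: \<kappa>_def)
  have \<kappa>m: "strict_mono \<kappa>" by (rule strict_monoI_Suc) (simp add: \<kappa>_def)
  define H where "H j = G (\<kappa> j)" for j
  have H: "H j bochner_integrable_on {a..b}" for j using G by (simp add: H_def)
  define g where "g j t = norm (H (Suc j) t - H j t)" for j t
  have gi: "g j integrable_on {a..b}" for j
    unfolding g_def using bochner_integrable_on_Icc_integrable(2)[OF bochner_integrable_on_diff[OF H H]] .
  have g0: "0 \<le> g j t" for j t by (simp add: g_def)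
  have gI: "integral {a..b} (g j) \<le> (1/2) ^ (j + 2)" for j
    unfolding g_def H_def using K \<kappa>K \<kappa>S by blast
  have gI0: "0 \<le> integral {a..b} (g j)" for j using integral_nonneg[OF gi] g0 by auto
  have gs: "summable (\<lambda>j. integral {a..b} (g (k + j)))" for k
  proof (rule summable_comparison_test')
    show "summable (\<lambda>j. (1/2::real) ^ j * (1/2) ^ (k + 2))" by (intro summable_mult2 summable_geometric) simp
    show "norm (integral {a..b} (g (k + j))) \<le> (1/2) ^ j * (1/2) ^ (k + 2)" for j
      using gI[of "k + j"] gI0[of "k + j"] by (simp add: power_add mult_ac)
  qed
  have "\<forall>k. \<exists>N. negligible N \<and> (\<forall>z\<in>{a..b} - N. summable (\<lambda>j. g (k + j) z)) \<and>
    (\<lambda>z. if z \<in> N then 0 else \<Sum>j. g (k + j) z) integrable_on {a..b} \<and>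
    integral {a..b} (\<lambda>z. if z \<in> N then 0 else \<Sum>j. g (k + j) z) = (\<Sum>j. integral {a..b} (g (k + j)))"
    by (intro allI summable_integrals_imp_summable_ae gi g0 gs)
  from choice[OF this] obtain N where N: "\<forall>k. negligible (N k) \<and> (\<forall>z\<in>{a..b} - N k. summable (\<lambda>j. g (k + j) z)) \<and>
    (\<lambda>z. if z \<in> N k then 0 else \<Sum>j. g (k + j) z) integrable_on {a..b} \<and>
    integral {a..b} (\<lambda>z. if z \<in> N k then 0 else \<Sum>j. g (k + j) z) = (\<Sum>j. integral {a..b} (g (k + j)))" ..
  define \<rho> where "\<rho> k z = (if z \<in> N k then 0 else \<Sum>j. g (k + j) z)" for k z
  have \<rho>i: "\<rho> k integrable_on {a..b}" for k unfolding \<rho>_def using N by blast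
  have \<rho>0: "0 \<le> \<rho> k t" if "t \<in> {a..b}" for k t
    using N that g0 by (auto simp: \<rho>_def intro!: suminf_nonneg)
  have \<rho>I: "integral {a..b} (\<rho> k) < (1/2) ^ k" for k
  proof -
    have "integral {a..b} (\<rho> k) = (\<Sum>j. integral {a..b} (g (k + j)))" unfolding \<rho>_def using N by blast
    also have "\<dots> \<le> (\<Sum>j. (1/2::real) ^ j * (1/2) ^ (k + 2))"
      using gI[of "k + _"] by (intro suminf_le gs summable_mult2 summable_geometric) (auto simp: power_add mult_ac)
    also have "\<dots> = (1/2) ^ (k + 1)"
      by (subst suminf_mult2[symmetric]) (auto simp: suminf_geometric summable_geometric)
    also have "\<dots> < (1/2::real) ^ k" by simp
    finally show ?thesis .
  qed
  have "\<forall>k. \<exists>Q. negligible Q \<and> (\<forall>t\<in>{a<..<b} - Q. ((\<lambda>u. integral {a..u} (H k)) has_vector_derivative H k t) (at t))"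
    by (intro allI bochner_integrable_on_indefinite_integral_derivative H)
  from choice[OF this] obtain Q where Q: "\<forall>k. negligible (Q k) \<and>
    (\<forall>t\<in>{a<..<b} - Q k. ((\<lambda>u. integral {a..u} (H k)) has_vector_derivative H k t) (at t))" ..
  have "\<exists>M d. negligible M \<and> (\<forall>t\<in>{a<..<b} - M. (x has_vector_derivative d t) (at t) \<and>
    (\<forall>k. norm (d t - H k t) \<le> \<rho> k t) \<and> (\<lambda>k. \<rho> k t) \<longlonglongrightarrow> 0)"
  proof (rule differentiable_ae_approx[where X = "\<lambda>k u. integral {a..u} (H k)"])
    show "negligible (\<Union>k. Q k)" using Q by (intro negligible_Union_nat) auto
    show "((\<lambda>u. integral {a..u} (H k)) has_vector_derivative H k t) (at t)" if "t \<in> {a<..<b} - (\<Union>k. Q k)" for k t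
      using Q that by blast
    fix k s t assume st: "a \<le> s" "s \<le> t" "t \<le> b"
    have Hi: "H n integrable_on {a..b}" for n using bochner_integrable_on_Icc_integrable(1)[OF H] .
    have sub: "f integrable_on {s..t}" if "f integrable_on {a..b}" for f :: "real \<Rightarrow> 'c::banach"
      using st by (intro integrable_on_subinterval[OF that]) auto
    have le: "norm (integral {s..t} (H n) - integral {s..t} (H k)) \<le> integral {s..t} (\<rho> k)" if n: "k \<le> n" for n
    proof -
      define \<rho>' where "\<rho>' z = (if z \<in> N k then norm (H n z - H k z) else \<rho> k z)" for z
      have neg: "negligible (N k)" using N by blast
      have "norm (integral {s..t} (\<lambda>z. H n z - H k z)) \<le> integral {s..t} \<rho>'"
      proof (rule integral_norm_bound_integral)
        show "(\<lambda>z. H n z - H k z) integrable_on {s..t}" using sub[OF Hi] by (rule integrable_diff[OF _ sub[OF Hi]])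
        show "\<rho>' integrable_on {s..t}"
          by (rule integrable_spike[OF sub[OF \<rho>i[of k]] neg]) (auto simp: \<rho>'_def)
        fix z assume z: "z \<in> {s..t}"
        show "norm (H n z - H k z) \<le> \<rho>' z"
        proof (cases "z \<in> N k")
          case False
          have tel: "H n z - H k z = (\<Sum>j<n - k. H (k + Suc j) z - H (k + j) z)"
            using sum_lessThan_telescope[of "\<lambda>j. H (k + j) z" "n - k"] n by simp
          have "norm (H n z - H k z) \<le> (\<Sum>j<n - k. g (k + j) z)"
            unfolding tel g_def by (rule order_trans[OF norm_sum]) simp
          also have "\<dots> \<le> (\<Sum>j. g (k + j) z)"
            using N False z st g0 by (intro sum_le_suminf) auto
          finally show ?thesis using False by (simp add: \<rho>'_def \<rho>_def)
        qed (simp add: \<rho>'_def)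
      qed
      also have "integral {s..t} \<rho>' = integral {s..t} (\<rho> k)"
        by (rule integral_spike[OF neg]) (auto simp: \<rho>'_def)
      finally show ?thesis by (simp add: integral_diff sub Hi)
    qed
    have "(\<lambda>n. integral {s..t} (H n)) \<longlonglongrightarrow> x t - x s"
      using LIMSEQ_subseq_LIMSEQ[OF lim[OF st] \<kappa>m] by (simp add: o_def H_def)
    then have "(\<lambda>n. norm (integral {s..t} (H n) - integral {s..t} (H k))) \<longlonglongrightarrow> norm ((x t - x s) - integral {s..t} (H k))"
      by (intro tendsto_norm tendsto_diff tendsto_const)
    then have "norm ((x t - x s) - integral {s..t} (H k)) \<le> integral {s..t} (\<rho> k)"
      by (rule LIMSEQ_le_const2) (use le in blast)
    then show "norm ((x t - integral {a..t} (H k)) - (x s - integral {a..s} (H k))) \<le> integral {s..t} (\<rho> k)"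
      using integral_diff_Icc[OF Hi st, of k] by (simp add: algebra_simps)
  qed (use \<rho>i \<rho>0 \<rho>I in auto)
  then show ?thesis by blast
qed

lemma has_integral_partition:
  fixes g :: "real \<Rightarrow> 'b::banach"
  assumes "\<And>j. j < n \<Longrightarrow> (g has_integral I j) {p j..p (Suc j)}" "\<And>j. j < n \<Longrightarrow> p j \<le> p (Suc j)"
  shows "(g has_integral (\<Sum>j<n. I j)) {p 0..p (n::nat)} \<and> p 0 \<le> p n"
  using assms
proof (induction n)
  case (Suc n)
  then have "(g has_integral (\<Sum>j<n. I j)) {p 0..p n} \<and> p 0 \<le> p n" by auto
  then show ?case
    using Suc.prems(1)[of n] Suc.prems(2)[of n] has_integral_combine[of "p 0" "p n" "p (Suc n)" g] by auto
qed auto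

lemma sum_div_group:
  fixes f :: "nat \<Rightarrow> nat \<Rightarrow> 'a::comm_monoid_add"
  assumes "K > 0"
  shows "(\<Sum>q<N * K. f (q div K) q) = (\<Sum>i<N. \<Sum>j<K. f i (i * K + j))"
proof (induction N)
  case (Suc N)
  have split: "(\<Sum>q<A + B. h q) = (\<Sum>q<A. h q) + (\<Sum>j<B. h (A + j))" for A B and h :: "nat \<Rightarrow> 'a"
    by (induction B) (auto simp: add.assoc)
  have "(\<Sum>q<Suc N * K. f (q div K) q) = (\<Sum>q<N * K. f (q div K) q) + (\<Sum>j<K. f ((N * K + j) div K) (N * K + j))"
    using split[of "\<lambda>q. f (q div K) q" "N * K" K] by (simp add: add.commute[of K])
  also have "(\<Sum>j<K. f ((N * K + j) div K) (N * K + j)) = (\<Sum>j<K. f N (N * K + j))"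
    using assms by (intro sum.cong) auto
  finally show ?case using Suc by simp
qed simp


subsection \<open>The Radon--Nikodym property of Hilbert spaces\<close>

definition dyadic_point :: "real \<Rightarrow> real \<Rightarrow> nat \<Rightarrow> nat \<Rightarrow> real" where
  "dyadic_point a b k i = a + real i * (b - a) / 2 ^ k"

definition dyadic_index :: "real \<Rightarrow> real \<Rightarrow> nat \<Rightarrow> real \<Rightarrow> nat" where
  "dyadic_index a b k t = nat \<lfloor>(t - a) * 2 ^ k / (b - a)\<rfloor>"

lemma dyadic_point_0 [simp]: "dyadic_point a b k 0 = a"
  by (simp add: dyadic_point_def)

lemma dyadic_point_last [simp]: "dyadic_point a b k (2 ^ k) = b"
  by (simp add: dyadic_point_def)

lemma dyadic_point_mono: "a \<le> b \<Longrightarrow> i \<le> j \<Longrightarrow> dyadic_point a b k i \<le> dyadic_point a b k j"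
  by (simp add: dyadic_point_def divide_right_mono mult_right_mono)

lemma dyadic_point_Suc: "dyadic_point a b k (Suc i) - dyadic_point a b k i = (b - a) / 2 ^ k"
  unfolding dyadic_point_def of_nat_Suc distrib_right add_divide_distrib by simp

lemma dyadic_point_refine: "dyadic_point a b (k + n) (i * 2 ^ n) = dyadic_point a b k i"
  by (simp add: dyadic_point_def power_add)

lemma dyadic_point_in: "a \<le> b \<Longrightarrow> i \<le> 2 ^ k \<Longrightarrow> dyadic_point a b k i \<in> {a..b}"
  using dyadic_point_mono[of a b 0 i k] dyadic_point_mono[of a b i "2 ^ k" k] by simp

lemma dyadic_index_eqI:
  assumes "a < b" "dyadic_point a b k i \<le> t" "t < dyadic_point a b k (Suc i)"
  shows "dyadic_index a b k t = i"
proof -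
  have "\<lfloor>(t - a) * 2 ^ k / (b - a)\<rfloor> = int i"
    using assms by (intro floor_unique) (simp_all add: dyadic_point_def field_simps)
  then show ?thesis by (simp add: dyadic_index_def)
qed

lemma dyadic_index_bounds:
  assumes "a < b" "a \<le> t"
  shows "dyadic_point a b k (dyadic_index a b k t) \<le> t" "t < dyadic_point a b k (Suc (dyadic_index a b k t))"
proof -
  define u where "u = (t - a) * 2 ^ k / (b - a)"
  have "u \<ge> 0" using assms by (simp add: u_def)
  then have "real (nat \<lfloor>u\<rfloor>) \<le> u" "u < real (nat \<lfloor>u\<rfloor>) + 1" by linarith+
  moreover have "t = a + u * ((b - a) / 2 ^ k)" using assms by (simp add: u_def)
  moreover have "(b - a) / 2 ^ k > 0" using assms by simp
  ultimately show "dyadic_point a b k (dyadic_index a b k t) \<le> t" "t < dyadic_point a b k (Suc (dyadic_index a b k t))"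
    using mult_right_mono[of "real (nat \<lfloor>u\<rfloor>)" u "(b - a) / 2 ^ k"]
      mult_strict_right_mono[of u "real (nat \<lfloor>u\<rfloor>) + 1" "(b - a) / 2 ^ k"]
    using assms by (simp_all add: dyadic_point_def dyadic_index_def u_def[symmetric] add.commute)
qed

lemma dyadic_index_less:
  assumes "a < b" "a \<le> t" "t < b"
  shows "dyadic_index a b k t < 2 ^ k"
proof (rule ccontr)
  assume "\<not> dyadic_index a b k t < 2 ^ k"
  then have "dyadic_point a b k (2 ^ k) \<le> dyadic_point a b k (dyadic_index a b k t)"
    using assms by (intro dyadic_point_mono) auto
  then show False using dyadic_index_bounds(1)[OF assms(1,2), of k] assms by simp
qed

lemma dyadic_index_le:
  assumes "a < b" "a \<le> t" "t \<le> b"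
  shows "dyadic_index a b k t \<le> 2 ^ k"
proof (cases "t = b")
  case True
  then have "(t - a) * 2 ^ k / (b - a) = real_of_int (2 ^ k)" using assms by simp
  then have "dyadic_index a b k t = nat (2 ^ k)" unfolding dyadic_index_def by (simp only: floor_of_int)
  then show ?thesis by (simp add: nat_power_eq)
next
  case False
  then show ?thesis using dyadic_index_less[of a b t k] assms by simp
qed

lemma dyadic_index_refine:
  assumes "a < b" "a \<le> t"
  shows "dyadic_index a b (k + n) t div 2 ^ n = dyadic_index a b k t"
proof -
  let ?q = "dyadic_index a b (k + n) t"
  let ?i = "?q div 2 ^ n"
  have 1: "?i * 2 ^ n \<le> ?q" by simp
  have 2: "Suc ?q \<le> Suc ?i * 2 ^ n"
    using dividend_less_div_times[of "2 ^ n" ?q] by (simp add: Suc_le_eq)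
  have "dyadic_point a b k ?i \<le> t"
    using dyadic_point_mono[OF less_imp_le[OF assms(1)] 1, of "k + n"] dyadic_index_bounds(1)[OF assms, of "k + n"]
      dyadic_point_refine[of a b k n ?i] by linarith
  moreover have "t < dyadic_point a b k (Suc ?i)"
    using dyadic_point_mono[OF less_imp_le[OF assms(1)] 2, of "k + n"] dyadic_index_bounds(2)[OF assms, of "k + n"]
      dyadic_point_refine[of a b k n "Suc ?i"] by linarith
  ultimately show ?thesis using dyadic_index_eqI[OF assms(1)] by metis
qed

lemma dyadic_point_index_tendsto:
  assumes "a < b" "a \<le> t"
  shows "(\<lambda>k. dyadic_point a b k (dyadic_index a b k t)) \<longlonglongrightarrow> t"
proof (rule tendsto_sandwich)
  have "(\<lambda>k. t - (b - a) * (1 / 2) ^ k) \<longlonglongrightarrow> t - (b - a) * 0"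
    by (intro tendsto_intros LIMSEQ_realpow_zero) auto
  then show "(\<lambda>k. t - (b - a) / 2 ^ k) \<longlonglongrightarrow> t" by (simp add: power_one_over)
  show "\<forall>\<^sub>F k in sequentially. t - (b - a) / 2 ^ k \<le> dyadic_point a b k (dyadic_index a b k t)"
  proof (rule always_eventually, rule allI)
    fix k
    show "t - (b - a) / 2 ^ k \<le> dyadic_point a b k (dyadic_index a b k t)"
      using dyadic_index_bounds(2)[OF assms, of k] dyadic_point_Suc[of a b k "dyadic_index a b k t"] by linarith
  qed
  show "\<forall>\<^sub>F k in sequentially. dyadic_point a b k (dyadic_index a b k t) \<le> t"
    using dyadic_index_bounds(1)[OF assms] by simp
qed (rule tendsto_const)

lemma dyadic_index_measurable: "dyadic_index a b k \<in> borel \<rightarrow>\<^sub>M count_space UNIV"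
  unfolding dyadic_index_def[abs_def] by measurable

lemma refinement_variance:
  fixes d :: "nat \<Rightarrow> 'h::real_inner" and w :: "nat \<Rightarrow> real"
  assumes w: "\<And>j. j < n \<Longrightarrow> w j > 0" and n: "n > 0"
  shows "(\<Sum>j<n. w j * (norm (d j /\<^sub>R w j - (\<Sum>j<n. d j) /\<^sub>R (\<Sum>j<n. w j)))\<^sup>2) =
    (\<Sum>j<n. (norm (d j))\<^sup>2 / w j) - (norm (\<Sum>j<n. d j))\<^sup>2 / (\<Sum>j<n. w j)"
proof -
  define D W where "D = (\<Sum>j<n. d j)" and "W = (\<Sum>j<n. w j)"
  have W: "W > 0" unfolding W_def using w n by (intro sum_pos) auto
  have "w j * (norm (d j /\<^sub>R w j - D /\<^sub>R W))\<^sup>2 = (norm (d j))\<^sup>2 / w j - 2 * (d j \<bullet> D) / W + w j * ((norm D)\<^sup>2 / W\<^sup>2)"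
    if j: "j < n" for j
  proof -
    have "(norm (d j /\<^sub>R w j - D /\<^sub>R W))\<^sup>2 = (norm (d j))\<^sup>2 / (w j)\<^sup>2 - 2 * (d j \<bullet> D) / (w j * W) + (norm D)\<^sup>2 / W\<^sup>2"
      unfolding power2_norm_eq_inner
      by (simp add: inner_diff_left inner_diff_right inner_commute power2_eq_square divide_inverse algebra_simps)
    then show ?thesis using w[OF j] W by (simp add: field_simps power2_eq_square)
  qed
  then have "(\<Sum>j<n. w j * (norm (d j /\<^sub>R w j - D /\<^sub>R W))\<^sup>2)
     = (\<Sum>j<n. (norm (d j))\<^sup>2 / w j - 2 * (d j \<bullet> D) / W + w j * ((norm D)\<^sup>2 / W\<^sup>2))"
    by (intro sum.cong) auto
  also have "\<dots> = (\<Sum>j<n. (norm (d j))\<^sup>2 / w j) - 2 * (D \<bullet> D) / W + W * ((norm D)\<^sup>2 / W\<^sup>2)"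
    by (simp add: sum.distrib sum_subtractf D_def W_def inner_sum_left sum_distrib_left sum_distrib_right sum_divide_distrib)
  also have "\<dots> = (\<Sum>j<n. (norm (d j))\<^sup>2 / w j) - (norm D)\<^sup>2 / W"
    unfolding power2_norm_eq_inner using W by (simp add: power2_eq_square)
  finally show ?thesis by (simp add: D_def W_def)
qed


lemma has_integral_scaleR_Ico:
  fixes m :: "real \<Rightarrow> real" and v :: "'b::real_normed_vector"
  assumes "(m has_integral w) {c..d}" "\<And>t. t \<in> {c..<d} \<Longrightarrow> F t = m t *\<^sub>R v"
  shows "(F has_integral w *\<^sub>R v) {c..d}"
  by (rule has_integral_spike[OF negligible_sing[of d] _ has_integral_scaleR_left[OF assms(1)]],
      rule assms(2)) auto

text \<open>The slopes of \<open>x\<close> on dyadic intervals, taken with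
  respect to the measure with density \<open>m\<close>, form a martingale bounded in \<open>L\<^sup>2\<close>; its increments are
  orthogonal, so that it converges in \<open>L\<^sup>1\<close>.\<close>

lemma differentiable_ae_of_integral_bound_ge_1:
  fixes x :: "real \<Rightarrow> 'h::{real_inner, banach}"
  assumes ab: "a < b" and m: "m integrable_on {a..b}" and m1: "\<And>t. t \<in> {a..b} \<Longrightarrow> 1 \<le> m t"
    and x: "\<And>s t. \<lbrakk>a \<le> s; s \<le> t; t \<le> b\<rbrakk> \<Longrightarrow> norm (x t - x s) \<le> integral {s..t} m"
  shows "\<exists>N. negligible N \<and> (\<forall>t\<in>{a<..<b} - N. \<exists>d. (x has_vector_derivative d) (at t))"
proof -
  let ?p = "dyadic_point a b" and ?idx = "dyadic_index a b"
  define M where "M t = integral {a..t} m" for t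
  have MI: "(m has_integral M t - M s) {s..t}" "t - s \<le> M t - M s" if "a \<le> s" "s \<le> t" "t \<le> b" for s t
  proof -
    have i: "m integrable_on {s..t}" using that by (intro integrable_on_subinterval[OF m]) auto
    have e: "integral {s..t} m = M t - M s" unfolding M_def using integral_diff_Icc[OF m that] by simp
    show *: "(m has_integral M t - M s) {s..t}" using i e by (metis integrable_integral)
    have "((\<lambda>_. 1::real) has_integral (t - s)) {s..t}" using has_integral_const_real[of "1::real" s t] that by simp
    then show "t - s \<le> M t - M s" by (rule has_integral_le[OF _ *]) (use m1 that in auto)
  qed
  have xM: "norm (x t - x s) \<le> M t - M s" if "a \<le> s" "s \<le> t" "t \<le> b" for s t
    using x[OF that] MI(1)[OF that] by (simp add: integral_unique)
  have pin: "a \<le> ?p k i" "?p k i \<le> b" if "i \<le> 2 ^ k" for k i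
    using dyadic_point_in[of a b i k] ab that by auto
  have pS: "?p k i \<le> ?p k (Suc i)" for k i using dyadic_point_mono[of a b i "Suc i" k] ab by simp
  define W where "W k i = M (?p k (Suc i)) - M (?p k i)" for k i
  define \<delta> where "\<delta> k i = x (?p k (Suc i)) - x (?p k i)" for k i
  define D where "D k i = (if i < 2 ^ k then \<delta> k i /\<^sub>R W k i else 0)" for k i
  define V where "V = M b - M a"
  have W: "W k i > 0" if "i < 2 ^ k" for k i
  proof -
    have "(b - a) / 2 ^ k \<le> W k i"
      using MI(2)[of "?p k i" "?p k (Suc i)"] pin[of i k] pin[of "Suc i" k] pS[of k i] that dyadic_point_Suc[of a b k i] by (simp add: W_def)
    moreover have "(b - a) / 2 ^ k > 0" using ab by simp
    ultimately show ?thesis by linarith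
  qed
  have \<delta>W: "norm (\<delta> k i) \<le> W k i" if "i < 2 ^ k" for k i
    unfolding \<delta>_def W_def using that by (intro xM pin pS) auto
  have D1: "norm (D k i) \<le> 1" for k i
    using W[of i k] \<delta>W[of i k] by (auto simp: D_def divide_inverse[symmetric] mult.commute)
  have WD: "W k i *\<^sub>R D k i = \<delta> k i" if "i < 2 ^ k" for k i
    using W[OF that] that by (simp add: D_def)
  have cell: "(m has_integral W k i) {?p k i..?p k (Suc i)}" if "i < 2 ^ k" for k i
    unfolding W_def using that by (intro MI pin pS) auto
  define G where "G k t = m t *\<^sub>R D k (?idx k t)" for k t
  have Gm: "norm (G k t) \<le> m t" if "t \<in> {a..b}" for k t
    using mult_left_mono[OF D1[of k "?idx k t"], of "m t"] m1[OF that] by (simp add: G_def)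
  have G: "G k bochner_integrable_on {a..b}" for k
  proof -
    have 1: "(\<lambda>t. if ?idx k t = i then m t else 0) bochner_integrable_on {a..b}" for i
    proof -
      have [measurable]: "m \<in> borel_measurable (lebesgue_on {a..b})" using m by (rule integrable_imp_measurable)
      have [measurable]: "?idx k \<in> lebesgue_on {a..b} \<rightarrow>\<^sub>M count_space UNIV"
        using dyadic_index_measurable[of a b k] by (intro measurable_restrict_space1 measurable_completion) simp
      have "(\<lambda>t. if ?idx k t = i then m t else 0) integrable_on {a..b}"
      proof (rule measurable_bounded_by_integrable_imp_integrable_real[OF _ m])
        show "(\<lambda>t. if ?idx k t = i then m t else 0) \<in> borel_measurable (lebesgue_on {a..b})" by measurable
        show "\<bar>if ?idx k t = i then m t else 0\<bar> \<le> m t" if "t \<in> {a..b}" for t using m1[OF that] by auto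
      qed simp
      then have "(\<lambda>t. if ?idx k t = i then m t else 0) measurable_on cbox a b"
        by (intro integrable_imp_measurable_on) simp
      then have "(\<lambda>t. if ?idx k t = i then m t else 0) bochner_integrable_on cbox a b"
      proof (rule measurable_on_imp_bochner_integrable_on)
        show "m integrable_on cbox a b" using m by simp
        show "norm (if ?idx k t = i then m t else 0) \<le> m t" if "t \<in> cbox a b" for t using m1[of t] that by auto
      qed
      then show ?thesis by simp
    qed
    have eq: "G k t = (\<Sum>i<2 ^ k. (if ?idx k t = i then m t else 0) *\<^sub>R D k i)" for t
    proof -
      have "(\<Sum>i<2 ^ k. (if ?idx k t = i then m t else 0) *\<^sub>R D k i) = (\<Sum>i<2 ^ k. if i = ?idx k t then m t *\<^sub>R D k i else 0)"
        by (intro sum.cong) auto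
      then show ?thesis by (simp add: G_def D_def)
    qed
    show ?thesis unfolding eq[abs_def]
      by (intro bochner_integrable_on_sum bochner_integrable_on_scaleR_const 1) simp
  qed
  have Gi: "G k integrable_on {a..b}" for k using bochner_integrable_on_Icc_integrable(1)[OF G] .
  have Gp: "(G k has_integral x (?p k i) - x a) {a..?p k i}" if i: "i \<le> 2 ^ k" for k i
  proof -
    have "(G k has_integral (\<Sum>j<i. \<delta> k j)) {?p k 0..?p k i}"
    proof (rule has_integral_partition[THEN conjunct1])
      fix j assume j: "j < i"
      have "(G k has_integral W k j *\<^sub>R D k j) {?p k j..?p k (Suc j)}"
        using i j by (intro has_integral_scaleR_Ico[OF cell]) (auto simp: G_def dyadic_index_eqI[OF ab])
      then show "(G k has_integral \<delta> k j) {?p k j..?p k (Suc j)}" using WD[of j k] i j by simp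
    qed (use pS in auto)
    moreover have "(\<Sum>j<i. \<delta> k j) = x (?p k i) - x a"
      unfolding \<delta>_def using sum_lessThan_telescope[of "\<lambda>j. x (?p k j)" i] by simp
    ultimately show ?thesis by simp
  qed
  have Mc: "continuous_on {a..b} M" unfolding M_def by (rule indefinite_integral_continuous_1[OF m])
  have Y: "(\<lambda>n. integral {a..t} (G n)) \<longlonglongrightarrow> x t - x a" if t: "a \<le> t" "t \<le> b" for t
  proof -
    define q where "q n = ?p n (?idx n t)" for n
    have q: "a \<le> q n" "q n \<le> t" for n
      unfolding q_def using pin dyadic_index_le[OF ab t] dyadic_index_bounds(1)[OF ab t(1)] by auto
    have "q \<longlonglongrightarrow> t" unfolding q_def using dyadic_point_index_tendsto[OF ab t(1)] .
    then have "(\<lambda>n. M (q n)) \<longlonglongrightarrow> M t"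
      using q t by (intro continuous_on_tendsto_compose[OF Mc]) (auto intro: order_trans always_eventually)
    then have lim: "(\<lambda>n. 2 * (M t - M (q n))) \<longlonglongrightarrow> 2 * (M t - M t)" by (intro tendsto_intros)
    have le: "norm (integral {a..t} (G n) - (x t - x a)) \<le> 2 * (M t - M (q n))" for n
    proof -
      have i1: "integral {a..q n} (G n) = x (q n) - x a"
        unfolding q_def using Gp[OF dyadic_index_le[OF ab t]] by (simp add: integral_unique)
      have i2: "integral {a..t} (G n) - integral {a..q n} (G n) = integral {q n..t} (G n)"
        using integral_diff_Icc[OF Gi q(1) q(2) t(2)] .
      have "norm (integral {q n..t} (G n)) \<le> integral {q n..t} m"
        using q[of n] t Gm by (intro integral_norm_bound_integral integrable_on_subinterval[OF Gi] integrable_on_subinterval[OF m]) auto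
      also have "\<dots> = M t - M (q n)" using MI(1)[OF q(1) q(2) t(2)] by (rule integral_unique)
      finally have 1: "norm (integral {q n..t} (G n)) \<le> M t - M (q n)" .
      have "integral {a..t} (G n) - (x t - x a) = integral {q n..t} (G n) - (x t - x (q n))"
        using i1 i2 by (simp add: algebra_simps)
      also have "norm \<dots> \<le> norm (integral {q n..t} (G n)) + norm (x t - x (q n))" by (rule norm_triangle_ineq4)
      also have "\<dots> \<le> (M t - M (q n)) + (M t - M (q n))" by (intro add_mono 1 xM q t)
      finally show ?thesis by simp
    qed
    have "(\<lambda>n. integral {a..t} (G n) - (x t - x a)) \<longlonglongrightarrow> 0"
      by (rule Lim_null_comparison[OF always_eventually[OF allI[OF le]]]) (use lim in simp)
    then show ?thesis by (simp add: LIM_zero_iff)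
  qed
  define E where "E k = (\<Sum>i<2 ^ k. (norm (\<delta> k i))\<^sup>2 / W k i)" for k
  have sumW: "(\<Sum>i<2 ^ k. W k i) = V" for k
    unfolding W_def V_def using sum_lessThan_telescope[of "\<lambda>j. M (?p k j)" "2 ^ k"] by simp
  have EV: "E k \<le> V" for k
    unfolding sumW[of k, symmetric] E_def
  proof (rule sum_mono)
    fix i assume i: "i \<in> {..<(2::nat) ^ k}"
    have "(norm (\<delta> k i))\<^sup>2 \<le> (W k i)\<^sup>2" using \<delta>W[of i k] i by (intro power_mono) auto
    then show "(norm (\<delta> k i))\<^sup>2 / W k i \<le> W k i" using W[of i k] i by (simp add: pos_divide_le_eq power2_eq_square)
  qed
  have var: "(\<Sum>q<2 ^ (k + n). W (k + n) q * (norm (D (k + n) q - D k (q div 2 ^ n)))\<^sup>2) = E (k + n) - E k" for k n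
  proof -
    let ?l = "k + n"
    have inner: "(\<Sum>j<2 ^ n. W ?l (i * 2 ^ n + j) * (norm (D ?l (i * 2 ^ n + j) - D k i))\<^sup>2)
       = (\<Sum>j<2 ^ n. (norm (\<delta> ?l (i * 2 ^ n + j)))\<^sup>2 / W ?l (i * 2 ^ n + j)) - (norm (\<delta> k i))\<^sup>2 / W k i"
      if i: "i < 2 ^ k" for i
    proof -
      have lt: "i * 2 ^ n + j < 2 ^ ?l" if j: "j < 2 ^ n" for j :: nat
      proof -
        have "i * 2 ^ n + j < Suc i * 2 ^ n" using j by simp
        also have "\<dots> \<le> 2 ^ k * 2 ^ n" using i by (intro mult_right_mono) auto
        finally show ?thesis by (simp add: power_add)
      qed
      have r: "?p ?l (i * 2 ^ n + 2 ^ n) = ?p k (Suc i)" "?p ?l (i * 2 ^ n) = ?p k i"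
        using dyadic_point_refine[of a b k n "Suc i"] dyadic_point_refine[of a b k n i] by (simp_all add: add.commute)
      have s1: "(\<Sum>j<2 ^ n. \<delta> ?l (i * 2 ^ n + j)) = \<delta> k i"
        unfolding \<delta>_def using sum_lessThan_telescope[of "\<lambda>j. x (?p ?l (i * 2 ^ n + j))" "2 ^ n"] r by simp
      have s2: "(\<Sum>j<2 ^ n. W ?l (i * 2 ^ n + j)) = W k i"
        unfolding W_def using sum_lessThan_telescope[of "\<lambda>j. M (?p ?l (i * 2 ^ n + j))" "2 ^ n"] r by simp
      have "(\<Sum>j<2 ^ n. W ?l (i * 2 ^ n + j) * (norm (D ?l (i * 2 ^ n + j) - D k i))\<^sup>2)
        = (\<Sum>j<2 ^ n. W ?l (i * 2 ^ n + j) * (norm (\<delta> ?l (i * 2 ^ n + j) /\<^sub>R W ?l (i * 2 ^ n + j) - \<delta> k i /\<^sub>R W k i))\<^sup>2)"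
        using lt i by (intro sum.cong) (auto simp: D_def)
      also have "\<dots> = (\<Sum>j<2 ^ n. (norm (\<delta> ?l (i * 2 ^ n + j)))\<^sup>2 / W ?l (i * 2 ^ n + j)) - (norm (\<delta> k i))\<^sup>2 / W k i"
        using refinement_variance[of "2 ^ n" "\<lambda>j. W ?l (i * 2 ^ n + j)" "\<lambda>j. \<delta> ?l (i * 2 ^ n + j)"] W lt
        unfolding s1 s2 by simp
      finally show ?thesis .
    qed
    have "(\<Sum>q<2 ^ k * 2 ^ n. W ?l q * (norm (D ?l q - D k (q div 2 ^ n)))\<^sup>2)
       = (\<Sum>i<2 ^ k. \<Sum>j<2 ^ n. W ?l (i * 2 ^ n + j) * (norm (D ?l (i * 2 ^ n + j) - D k i))\<^sup>2)"
      using sum_div_group[of "2 ^ n" "\<lambda>i q. W ?l q * (norm (D ?l q - D k i))\<^sup>2" "2 ^ k"] by simp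
    also have "\<dots> = (\<Sum>i<2 ^ k. \<Sum>j<2 ^ n. (norm (\<delta> ?l (i * 2 ^ n + j)))\<^sup>2 / W ?l (i * 2 ^ n + j)) - E k"
      using inner by (simp add: sum_subtractf E_def)
    also have "(\<Sum>i<2 ^ k. \<Sum>j<2 ^ n. (norm (\<delta> ?l (i * 2 ^ n + j)))\<^sup>2 / W ?l (i * 2 ^ n + j)) = E ?l"
      using sum_div_group[of "2 ^ n" "\<lambda>i q. (norm (\<delta> ?l q))\<^sup>2 / W ?l q" "2 ^ k"] by (simp add: E_def power_add)
    finally show ?thesis by (simp add: power_add)
  qed
  have Emono: "E k \<le> E (k + n)" for k n
  proof -
    have "0 \<le> (\<Sum>q<2 ^ (k + n). W (k + n) q * (norm (D (k + n) q - D k (q div 2 ^ n)))\<^sup>2)"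
      using W by (intro sum_nonneg mult_nonneg_nonneg) (auto simp: less_imp_le)
    then show ?thesis unfolding var by simp
  qed
  have L1: "integral {a..b} (\<lambda>t. norm (G (k + n) t - G k t)) = (\<Sum>q<2 ^ (k + n). W (k + n) q * norm (D (k + n) q - D k (q div 2 ^ n)))" for k n
  proof -
    let ?l = "k + n"
    have "((\<lambda>t. norm (G ?l t - G k t)) has_integral (\<Sum>q<2 ^ ?l. W ?l q * norm (D ?l q - D k (q div 2 ^ n)))) {?p ?l 0..?p ?l (2 ^ ?l)}"
    proof (rule has_integral_partition[THEN conjunct1])
      fix q :: nat assume q: "q < 2 ^ ?l"
      have "((\<lambda>t. norm (G ?l t - G k t)) has_integral W ?l q *\<^sub>R norm (D ?l q - D k (q div 2 ^ n))) {?p ?l q..?p ?l (Suc q)}"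
      proof (rule has_integral_scaleR_Ico[OF cell[OF q]])
        fix t assume t: "t \<in> {?p ?l q..<?p ?l (Suc q)}"
        have i: "?idx ?l t = q" using t by (intro dyadic_index_eqI[OF ab]) auto
        have at: "a \<le> t" "t \<le> b" using t pin[of q ?l] pin[of "Suc q" ?l] q by auto
        have "?idx k t = q div 2 ^ n" using dyadic_index_refine[OF ab at(1), of k n] i by simp
        then have "G ?l t - G k t = m t *\<^sub>R (D ?l q - D k (q div 2 ^ n))"
          using i by (simp add: G_def scaleR_diff_right)
        then show "norm (G ?l t - G k t) = m t *\<^sub>R norm (D ?l q - D k (q div 2 ^ n))"
          using m1[of t] at by simp
      qed
      then show "((\<lambda>t. norm (G ?l t - G k t)) has_integral W ?l q * norm (D ?l q - D k (q div 2 ^ n))) {?p ?l q..?p ?l (Suc q)}"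
        by simp
    qed (use pS in auto)
    then show ?thesis by (simp add: integral_unique)
  qed
  have V0: "V \<ge> 0" using MI(2)[of a b] ab by (simp add: V_def)
  have est: "integral {a..b} (\<lambda>t. norm (G (k + n) t - G k t)) \<le> \<eta> / 2 * V + (E (k + n) - E k) / (2 * \<eta>)" if \<eta>: "\<eta> > 0" for k n \<eta>
  proof -
    have am: "c \<le> \<eta> / 2 + c\<^sup>2 / (2 * \<eta>)" for c :: real
    proof -
      have "2 * \<eta> * c \<le> \<eta>\<^sup>2 + c\<^sup>2" using sum_squares_bound[of \<eta> c] by simp
      then show ?thesis using \<eta> by (simp add: field_simps power2_eq_square)
    qed
    have "integral {a..b} (\<lambda>t. norm (G (k + n) t - G k t)) \<le> (\<Sum>q<2 ^ (k + n). W (k + n) q * (\<eta> / 2 + (norm (D (k + n) q - D k (q div 2 ^ n)))\<^sup>2 / (2 * \<eta>)))"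
      unfolding L1 using W am by (intro sum_mono mult_left_mono) (auto simp: less_imp_le)
    also have "\<dots> = \<eta> / 2 * (\<Sum>q<2 ^ (k + n). W (k + n) q) + (\<Sum>q<2 ^ (k + n). W (k + n) q * (norm (D (k + n) q - D k (q div 2 ^ n)))\<^sup>2) / (2 * \<eta>)"
      by (simp add: distrib_left sum.distrib sum_distrib_left sum_divide_distrib mult_ac)
    finally show ?thesis unfolding var sumW .
  qed
  show ?thesis
  proof (rule differentiable_ae_of_L1_Cauchy[OF G])
    fix \<epsilon> :: real assume e: "\<epsilon> > 0"
    define \<eta> where "\<eta> = \<epsilon> / (V + 1)"
    have \<eta>: "\<eta> > 0" using e V0 by (simp add: \<eta>_def)
    have "convergent E"
    proof (rule Bseq_monoseq_convergent)
      have "incseq E" by (rule incseq_SucI) (use Emono[of _ 1] in simp)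
      then show "monoseq E" by (rule incseq_imp_monoseq)
      have "E 0 \<le> E k" for k using Emono[of 0 k] by simp
      then have "\<bar>E k\<bar> \<le> \<bar>E 0\<bar> + \<bar>V\<bar>" for k using EV[of k] by (smt (verit))
      then show "Bseq E" by (intro BseqI'[of _ "\<bar>E 0\<bar> + \<bar>V\<bar>"]) simp
    qed
    then have "Cauchy E" by (rule convergent_Cauchy)
    then obtain K where K: "\<And>k l. k \<ge> K \<Longrightarrow> l \<ge> K \<Longrightarrow> dist (E k) (E l) < \<epsilon> * \<eta>"
      using metric_CauchyD[of E "\<epsilon> * \<eta>"] e \<eta> by auto
    have "integral {a..b} (\<lambda>t. norm (G l t - G k t)) \<le> \<epsilon>" if kl: "K \<le> k" "k \<le> l" for l k
    proof -
      obtain n where n: "l = k + n" using kl(2) le_iff_add by blast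
      have "E l - E k \<le> \<epsilon> * \<eta>" using K[of k l] kl by (simp add: dist_real_def)
      then have "(E l - E k) / (2 * \<eta>) \<le> \<epsilon> / 2" using \<eta> by (simp add: field_simps)
      moreover have "\<eta> / 2 * V \<le> \<epsilon> / 2" using e V0 by (simp add: \<eta>_def field_simps)
      ultimately show ?thesis using est[OF \<eta>, of k n] unfolding n by linarith
    qed
    then show "\<exists>K. \<forall>l k. K \<le> k \<longrightarrow> k \<le> l \<longrightarrow> integral {a..b} (\<lambda>t. norm (G l t - G k t)) \<le> \<epsilon>" by blast
  next
    fix s t assume st: "a \<le> s" "s \<le> t" "t \<le> b"
    have "(\<lambda>n. integral {a..t} (G n) - integral {a..s} (G n)) \<longlonglongrightarrow> (x t - x a) - (x s - x a)"
      using st by (intro tendsto_diff Y) auto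
    then show "(\<lambda>n. integral {s..t} (G n)) \<longlonglongrightarrow> x t - x s"
      unfolding integral_diff_Icc[OF Gi st] by simp
  qed
qed

lemma differentiable_ae_of_integral_bound:
  fixes x :: "real \<Rightarrow> 'h::{real_inner, banach}"
  assumes ab: "a < b" and m: "m integrable_on {a..b}" and m0: "\<And>t. t \<in> {a..b} \<Longrightarrow> 0 \<le> m t"
    and x: "\<And>s t. \<lbrakk>a \<le> s; s \<le> t; t \<le> b\<rbrakk> \<Longrightarrow> norm (x t - x s) \<le> integral {s..t} m"
  shows "\<exists>N. negligible N \<and> (\<forall>t\<in>{a<..<b} - N. \<exists>d. (x has_vector_derivative d) (at t))"
proof (rule differentiable_ae_of_integral_bound_ge_1[OF ab])
  show "(\<lambda>t. m t + 1) integrable_on {a..b}" by (intro integrable_add m integrable_const_ivl)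
  show "1 \<le> m t + 1" if "t \<in> {a..b}" for t using m0[OF that] by simp
  fix s t assume st: "a \<le> s" "s \<le> t" "t \<le> b"
  have i: "m integrable_on {s..t}" using st by (intro integrable_on_subinterval[OF m]) auto
  have "integral {s..t} m \<le> integral {s..t} (\<lambda>t. m t + 1)"
    using i by (intro integral_le integrable_add integrable_const_ivl) auto
  then show "norm (x t - x s) \<le> integral {s..t} (\<lambda>t. m t + 1)" using x[OF st] by linarith
qed


subsection \<open>Projections onto closed convex sets, tangent and normal cones\<close>

lemma nearest_point_exists:
  fixes K :: "'h::{real_inner, banach} set"
  assumes K: "K \<noteq> {}" "closed K" "convex K"
  shows "\<exists>p\<in>K. \<forall>y\<in>K. dist u p \<le> dist u y"
proof -
  define d where "d = infdist u K"
  have dle: "d \<le> dist u y" if "y \<in> K" for y unfolding d_def by (rule infdist_le[OF that])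
  have d0: "d \<ge> 0" unfolding d_def by (rule infdist_nonneg)
  have "\<exists>y\<in>K. dist u y < d + e" if "e > 0" for e
  proof (rule ccontr)
    assume "\<not> ?thesis"
    then have "d + e \<le> (INF y\<in>K. dist u y)" using K(1) by (intro cINF_greatest) (auto simp: not_less)
    then show False using that K(1) by (simp add: d_def infdist_def)
  qed
  then have "\<forall>n::nat. \<exists>y. y \<in> K \<and> dist u y < d + 1 / real (Suc n)" by (metis of_nat_0_less_iff zero_less_Suc zero_less_divide_1_iff)
  from choice[OF this] obtain p where p: "\<And>n::nat. p n \<in> K" "\<And>n. dist u (p n) < d + 1 / real (Suc n)" by blast
  have par: "(dist (p m) (p n))\<^sup>2 \<le> 2 * (dist u (p m))\<^sup>2 + 2 * (dist u (p n))\<^sup>2 - 4 * d\<^sup>2" for m n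
  proof -
    define A B where "A = u - p m" and "B = u - p n"
    have "midpoint (p m) (p n) \<in> K"
      using convexD[OF K(3) p(1)[of m] p(1)[of n], of "1/2" "1/2"] by (simp add: midpoint_def scaleR_right_distrib)
    then have "d \<le> dist u (midpoint (p m) (p n))" by (rule dle)
    also have "u - midpoint (p m) (p n) = (1/2) *\<^sub>R (A + B)"
    proof -
      have "2 *\<^sub>R (u - midpoint (p m) (p n)) = A + B"
        by (simp add: midpoint_def A_def B_def scaleR_diff_right scaleR_2)
      then have "(1/2) *\<^sub>R (2 *\<^sub>R (u - midpoint (p m) (p n))) = (1/2) *\<^sub>R (A + B)" by (rule arg_cong)
      then show ?thesis by simp
    qed
    then have "dist u (midpoint (p m) (p n)) = norm (A + B) / 2" by (simp add: dist_norm)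
    finally have "(2 * d)\<^sup>2 \<le> (norm (A + B))\<^sup>2" using d0 by (intro power_mono) auto
    moreover have "(norm (A - B))\<^sup>2 + (norm (A + B))\<^sup>2 = 2 * (norm A)\<^sup>2 + 2 * (norm B)\<^sup>2"
      by (simp add: power2_norm_eq_inner algebra_simps inner_simps)
    moreover have "dist (p m) (p n) = norm (A - B)" by (simp add: A_def B_def dist_norm norm_minus_commute)
    ultimately show ?thesis by (simp add: A_def B_def dist_norm power_mult_distrib)
  qed
  have "Cauchy p"
  proof (rule metric_CauchyI)
    fix e :: real assume e: "e > 0"
    have "(\<lambda>n. 4 * (d + 1 / real (Suc n))\<^sup>2 - 4 * d\<^sup>2) \<longlonglongrightarrow> 4 * (d + 0)\<^sup>2 - 4 * d\<^sup>2"
      by (intro tendsto_intros LIMSEQ_Suc[OF lim_1_over_n])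
    then have "eventually (\<lambda>n. 4 * (d + 1 / real (Suc n))\<^sup>2 - 4 * d\<^sup>2 < e\<^sup>2) sequentially"
      using e by (intro order_tendstoD(2)) auto
    then obtain M where M: "4 * (d + 1 / real (Suc M))\<^sup>2 - 4 * d\<^sup>2 < e\<^sup>2"
      unfolding eventually_sequentially by blast
    have le: "(dist u (p n))\<^sup>2 \<le> (d + 1 / real (Suc M))\<^sup>2" if "n \<ge> M" for n
    proof (intro power_mono)
      have "1 / real (Suc n) \<le> 1 / real (Suc M)" using that by (simp add: frac_le)
      then show "dist u (p n) \<le> d + 1 / real (Suc M)" using p(2)[of n] by linarith
    qed simp
    have "dist (p m) (p n) < e" if "m \<ge> M" "n \<ge> M" for m n
    proof (rule power_less_imp_less_base)
      show "(dist (p m) (p n))\<^sup>2 < e\<^sup>2" using par[of m n] le[OF that(1)] le[OF that(2)] M by linarith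
    qed (use e in simp)
    then show "\<exists>M. \<forall>m\<ge>M. \<forall>n\<ge>M. dist (p m) (p n) < e" by blast
  qed
  then obtain q where q: "p \<longlonglongrightarrow> q" using Cauchy_convergent_iff convergent_def by blast
  have "q \<in> K" using closed_sequentially[OF K(2) p(1) q] .
  moreover have "dist u q \<le> d + 0"
  proof (rule LIMSEQ_le)
    show "(\<lambda>n. dist u (p n)) \<longlonglongrightarrow> dist u q" by (intro tendsto_intros q)
    show "(\<lambda>n. d + 1 / real (Suc n)) \<longlonglongrightarrow> d + 0" by (intro tendsto_intros LIMSEQ_Suc[OF lim_1_over_n])
    show "\<exists>N. \<forall>n\<ge>N. dist u (p n) \<le> d + 1 / real (Suc n)" using p(2) less_imp_le by blast
  qed
  ultimately show ?thesis using dle by (intro bexI[of _ q]) (auto intro: order_trans)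
qed

context
  fixes K :: "'h::{real_inner, banach} set"
  assumes K: "K \<noteq> {}" "closed K" "convex K"
begin

lemma metric_proj_nearest: "metric_proj K u \<in> K" "y \<in> K \<Longrightarrow> dist u (metric_proj K u) \<le> dist u y"
proof -
  obtain p where "p \<in> K" "\<forall>y\<in>K. dist u p \<le> dist u y" using nearest_point_exists[OF K] by blast
  then have "is_arg_min (\<lambda>p. dist u p) (\<lambda>p. p \<in> K) p" by (auto simp: is_arg_min_def not_less)
  then have "is_arg_min (\<lambda>p. dist u p) (\<lambda>p. p \<in> K) (metric_proj K u)"
    unfolding metric_proj_def arg_min_on_def arg_min_def by (rule someI)
  then show "metric_proj K u \<in> K" "y \<in> K \<Longrightarrow> dist u (metric_proj K u) \<le> dist u y"
    by (auto simp: is_arg_min_def not_less)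
qed

lemma metric_proj_inner_le: "y \<in> K \<Longrightarrow> inner (u - metric_proj K u) (y - metric_proj K u) \<le> 0"
  by (rule any_closest_point_dot[OF K(3) K(2) metric_proj_nearest(1)]) (auto intro: metric_proj_nearest(2))

lemma metric_proj_eqI:
  assumes p: "p \<in> K" "\<And>y. y \<in> K \<Longrightarrow> inner (u - p) (y - p) \<le> 0"
  shows "metric_proj K u = p"
proof -
  let ?q = "metric_proj K u"
  have "inner (u - p) (?q - p) \<le> 0" "inner (u - ?q) (p - ?q) \<le> 0"
    using p metric_proj_nearest(1) metric_proj_inner_le by auto
  moreover have "inner (?q - p) (?q - p) = inner (u - p) (?q - p) + inner (u - ?q) (p - ?q)"
    by (simp add: inner_diff_left inner_diff_right inner_commute)
  ultimately have "inner (?q - p) (?q - p) \<le> 0" by linarith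
  then show ?thesis by (simp add: inner_gt_zero_iff[symmetric] not_less[symmetric] del: inner_gt_zero_iff) (metis eq_iff_diff_eq_0 inner_gt_zero_iff)
qed

lemma metric_proj_step:
  assumes z: "z \<in> K"
  shows "norm (metric_proj K (z + \<delta>) - z) \<le> norm \<delta>" "norm (z + \<delta> - metric_proj K (z + \<delta>)) \<le> norm \<delta>"
proof -
  let ?q = "metric_proj K (z + \<delta>)"
  show "norm (z + \<delta> - ?q) \<le> norm \<delta>" using metric_proj_nearest(2)[OF z, of "z + \<delta>"] by (simp add: dist_norm)
  have "inner (?q - z) (?q - z) \<le> inner \<delta> (?q - z)"
    using metric_proj_inner_le[OF z, of "z + \<delta>"] by (simp add: inner_diff_left inner_diff_right inner_add_left inner_add_right inner_commute)
  also have "\<dots> \<le> norm \<delta> * norm (?q - z)" by (rule norm_cauchy_schwarz)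
  finally have "norm (?q - z) * norm (?q - z) \<le> norm \<delta> * norm (?q - z)" by (simp add: power2_norm_eq_inner[symmetric] power2_eq_square)
  then show "norm (?q - z) \<le> norm \<delta>" by (cases "norm (?q - z) = 0") (auto simp: mult_le_cancel_right)
qed

end

context
  fixes C :: "'h::{real_inner, banach} set" and x :: 'h
  assumes C: "convex C" and x: "x \<in> C"
begin

lemma tangent_cone_closed_convex: "closed (tangent_cone C x)" "convex (tangent_cone C x)"
proof -
  show "closed (tangent_cone C x)" using x by (simp add: tangent_cone_def)
  have "convex (\<Union>l\<in>{0<..}. (\<lambda>y. l *\<^sub>R (y - x)) ` C)" (is "convex ?U")
  proof (rule convexI)
    fix p q :: 'h and u v :: real
    assume "p \<in> ?U" "q \<in> ?U" and uv: "0 \<le> u" "0 \<le> v" "u + v = 1"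
    then obtain k y l z where p: "k > 0" "y \<in> C" "p = k *\<^sub>R (y - x)" and q: "l > 0" "z \<in> C" "q = l *\<^sub>R (z - x)"
      by auto
    define L where "L = u * k + v * l"
    have L: "L > 0"
    proof (cases "u = 0")
      case True
      then show ?thesis using uv q by (simp add: L_def)
    next
      case False
      then have "u * k > 0" "v * l \<ge> 0" using uv p q by auto
      then show ?thesis by (simp add: L_def)
    qed
    have "(u * k / L) *\<^sub>R y + (v * l / L) *\<^sub>R z \<in> C"
      using L uv p q by (intro convexD[OF C]) (auto simp: L_def add_divide_distrib[symmetric])
    moreover have "u *\<^sub>R p + v *\<^sub>R q = L *\<^sub>R ((u * k / L) *\<^sub>R y + (v * l / L) *\<^sub>R z - x)"
      using L by (simp add: p q scaleR_diff_right scaleR_add_right) (simp add: L_def scaleR_add_left algebra_simps)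
    ultimately show "u *\<^sub>R p + v *\<^sub>R q \<in> ?U" using L by blast
  qed
  then show "convex (tangent_cone C x)" using x by (simp add: tangent_cone_def)
qed

lemma diff_in_tangent_cone:
  assumes "y \<in> C" "l > 0"
  shows "l *\<^sub>R (y - x) \<in> tangent_cone C x"
proof -
  have "l *\<^sub>R (y - x) \<in> (\<Union>l\<in>{0<..}. (\<lambda>y. l *\<^sub>R (y - x)) ` C)" using assms by blast
  then have "l *\<^sub>R (y - x) \<in> closure (\<Union>l\<in>{0<..}. (\<lambda>y. l *\<^sub>R (y - x)) ` C)"
    by (rule subsetD[OF closure_subset])
  then show ?thesis using x by (simp add: tangent_cone_def)
qed

lemma zero_in_tangent_cone: "0 \<in> tangent_cone C x"
  using diff_in_tangent_cone[OF x, of 1] by simp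

lemma tangent_cone_scaleR:
  assumes v: "v \<in> tangent_cone C x" and c: "c > 0"
  shows "c *\<^sub>R v \<in> tangent_cone C x"
proof -
  let ?U = "\<Union>l\<in>{0<..}. (\<lambda>y. l *\<^sub>R (y - x)) ` C"
  have "(*\<^sub>R) c ` ?U \<subseteq> ?U"
  proof
    fix w assume "w \<in> (*\<^sub>R) c ` ?U"
    then obtain l y where "l > 0" "y \<in> C" "w = (c * l) *\<^sub>R (y - x)" by auto
    then show "w \<in> ?U" using c by (intro UN_I[of "c * l"]) auto
  qed
  then have "closure ((*\<^sub>R) c ` ?U) \<subseteq> closure ?U" by (rule closure_mono)
  moreover have "c *\<^sub>R v \<in> (*\<^sub>R) c ` closure ?U" using v x by (auto simp: tangent_cone_def)
  ultimately show ?thesis using x unfolding closure_scaleR by (auto simp: tangent_cone_def)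
qed

lemma tangent_cone_add:
  assumes "v \<in> tangent_cone C x" "w \<in> tangent_cone C x"
  shows "v + w \<in> tangent_cone C x"
proof -
  have "(1/2) *\<^sub>R v + (1/2) *\<^sub>R w \<in> tangent_cone C x"
    using assms by (intro convexD[OF tangent_cone_closed_convex(2)]) auto
  from tangent_cone_scaleR[OF this, of 2] show ?thesis by (simp add: scaleR_add_right)
qed

lemma normal_cone_tangent_cone_inner_le:
  assumes n: "n \<in> normal_cone C x" and v: "v \<in> tangent_cone C x"
  shows "inner n v \<le> 0"
proof -
  have "closed {v. inner n v \<le> 0}" by (intro closed_Collect_le continuous_intros)
  moreover have "(\<Union>l\<in>{0<..}. (\<lambda>y. l *\<^sub>R (y - x)) ` C) \<subseteq> {v. inner n v \<le> 0}"
    using n x by (auto simp: normal_cone_def mult_nonneg_nonpos)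
  ultimately have "closure (\<Union>l\<in>{0<..}. (\<lambda>y. l *\<^sub>R (y - x)) ` C) \<subseteq> {v. inner n v \<le> 0}"
    by (intro closure_minimal)
  then show ?thesis using v x by (auto simp: tangent_cone_def)
qed

lemma metric_proj_tangent_cone:
  shows "metric_proj (tangent_cone C x) h \<in> tangent_cone C x"
    and "h - metric_proj (tangent_cone C x) h \<in> normal_cone C x"
    and "inner (h - metric_proj (tangent_cone C x) h) (metric_proj (tangent_cone C x) h) = 0"
    and "norm (metric_proj (tangent_cone C x) h) \<le> norm h"
proof -
  have T: "tangent_cone C x \<noteq> {}" "closed (tangent_cone C x)" "convex (tangent_cone C x)"
    using zero_in_tangent_cone tangent_cone_closed_convex by auto
  let ?p = "metric_proj (tangent_cone C x) h"
  show p: "?p \<in> tangent_cone C x" by (rule metric_proj_nearest(1)[OF T])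
  note le = metric_proj_inner_le[OF T, of _ h]
  have "inner (h - ?p) (y - x) \<le> 0" if "y \<in> C" for y
    using le[OF tangent_cone_add[OF p diff_in_tangent_cone[OF that, of 1]]] by simp
  then show "h - ?p \<in> normal_cone C x" using x by (simp add: normal_cone_def)
  have "inner (h - ?p) (0 - ?p) \<le> 0" by (rule le[OF zero_in_tangent_cone])
  moreover have "inner (h - ?p) (?p + ?p - ?p) \<le> 0" by (rule le[OF tangent_cone_add[OF p p]])
  ultimately show orth: "inner (h - ?p) ?p = 0" by simp
  then have "inner ?p ?p = inner h ?p" by (simp add: inner_diff_left)
  also have "\<dots> \<le> norm h * norm ?p" by (rule norm_cauchy_schwarz)
  finally have "norm ?p * norm ?p \<le> norm h * norm ?p" by (simp add: power2_norm_eq_inner[symmetric] power2_eq_square)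
  then show "norm ?p \<le> norm h" by (cases "norm ?p = 0") (auto simp: mult_le_cancel_right)
qed

lemma moreau_decomposition:
  assumes n: "h - d \<in> normal_cone C x" and d: "d \<in> tangent_cone C x" and orth: "inner (h - d) d = 0"
  shows "metric_proj (tangent_cone C x) h = d"
    and "is_arg_min (\<lambda>\<nu>. norm (h - \<nu>)) (\<lambda>\<nu>. \<nu> \<in> normal_cone C x) (h - d)"
proof -
  have T: "tangent_cone C x \<noteq> {}" "closed (tangent_cone C x)" "convex (tangent_cone C x)"
    using zero_in_tangent_cone tangent_cone_closed_convex by auto
  show "metric_proj (tangent_cone C x) h = d"
    using normal_cone_tangent_cone_inner_le[OF n] orth
    by (intro metric_proj_eqI[OF T d]) (simp add: inner_diff_right)
  have "norm (h - (h - d)) \<le> norm (h - \<nu>)" if \<nu>: "\<nu> \<in> normal_cone C x" for \<nu>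
  proof -
    have "inner \<nu> d \<le> 0" by (rule normal_cone_tangent_cone_inner_le[OF \<nu> d])
    then have "inner d d \<le> inner (h - \<nu>) d" using orth by (simp add: inner_diff_left)
    also have "\<dots> \<le> norm (h - \<nu>) * norm d" by (rule norm_cauchy_schwarz)
    finally have "norm d * norm d \<le> norm (h - \<nu>) * norm d" by (simp add: power2_norm_eq_inner[symmetric] power2_eq_square)
    then show ?thesis by (cases "norm d = 0") (auto simp: mult_le_cancel_right)
  qed
  then show "is_arg_min (\<lambda>\<nu>. norm (h - \<nu>)) (\<lambda>\<nu>. \<nu> \<in> normal_cone C x) (h - d)"
    using n by (auto simp: is_arg_min_def not_less)
qed

end


subsection \<open>The catching-up algorithm\<close>

text \<open>The telescoped difference of one coarse step of the catching-up algorithm and \<open>n\<close> fine ones is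
  a sum of normal vectors, which monotonicity of the normal cone controls.\<close>

lemma coarse_fine_step:
  fixes C :: "'h::{real_inner, banach} set"
  assumes C: "C \<noteq> {}" "closed C" "convex C"
    and z0: "z 0 \<in> C" and z: "\<And>j. j < n \<Longrightarrow> z (Suc j) = metric_proj C (z j + d j)"
    and v: "\<And>j. j < n \<Longrightarrow> norm (d j) \<le> v j"
    and x: "x \<in> C" and x': "x' = metric_proj C (x + (\<Sum>j<n. d j))"
  shows "(norm (x' - z n))\<^sup>2 \<le> (norm (x - z 0))\<^sup>2 + 2 * (\<Sum>j<n. v j)\<^sup>2"
proof -
  have zC: "z j \<in> C" if "j \<le> n" for j
    using that z0 z metric_proj_nearest(1)[OF C] by (cases j) auto
  have v0: "0 \<le> v j" if "j < n" for j using v[OF that] norm_ge_zero order_trans by blast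
  have zstep: "norm (z (Suc j) - z j) \<le> v j" if "j < n" for j
    using metric_proj_step(1)[OF C zC[of j], of "d j"] z[OF that] v[OF that] that by simp
  define \<nu> where "\<nu> j = z j + d j - z (Suc j)" for j
  have \<nu>v: "norm (\<nu> j) \<le> v j" if "j < n" for j
    using metric_proj_step(2)[OF C zC[of j], of "d j"] z[OF that] v[OF that] that by (simp add: \<nu>_def)
  have x'C: "x' \<in> C" using x' metric_proj_nearest(1)[OF C] by simp
  have \<nu>n: "inner (\<nu> j) (y - z (Suc j)) \<le> 0" if "j < n" "y \<in> C" for j y
    using metric_proj_inner_le[OF C that(2), of "z j + d j"] z[OF that(1)] by (simp add: \<nu>_def)
  define N where "N = x + (\<Sum>j<n. d j) - x'"
  have Nn: "inner N (y - x') \<le> 0" if "y \<in> C" for y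
    using metric_proj_inner_le[OF C that, of "x + (\<Sum>j<n. d j)"] x' by (simp add: N_def)
  define w w' where "w = x - z 0" and "w' = x' - z n"
  have tail: "norm (z n - z (Suc j)) \<le> (\<Sum>i<n. v i)" if j: "j < n" for j
  proof -
    have "norm (z n - z (Suc j)) \<le> (\<Sum>i\<in>{Suc j..<n}. norm (z (Suc i) - z i))"
      using sum_Suc_diff'[of "Suc j" n z] j norm_sum[of "\<lambda>i. z (Suc i) - z i" "{Suc j..<n}"] by simp
    also have "\<dots> \<le> (\<Sum>i\<in>{Suc j..<n}. v i)" using zstep by (intro sum_mono) auto
    also have "\<dots> \<le> (\<Sum>i<n. v i)" using v0 by (intro sum_mono2) auto
    finally show ?thesis .
  qed
  have "(\<Sum>j<n. \<nu> j) = (\<Sum>j<n. d j) - (\<Sum>j<n. z (Suc j) - z j)"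
    by (simp add: \<nu>_def sum_subtractf[symmetric] algebra_simps)
  then have diff: "w' - w = (\<Sum>j<n. \<nu> j) - N"
    unfolding sum_lessThan_telescope by (simp add: w_def w'_def N_def)
  have "(norm w')\<^sup>2 = (norm w)\<^sup>2 + 2 * inner w' (w' - w) - (norm (w' - w))\<^sup>2"
    by (simp add: power2_norm_eq_inner inner_diff_left inner_diff_right inner_commute)
  also have "\<dots> \<le> (norm w)\<^sup>2 + 2 * inner w' (w' - w)" by simp
  also have "inner w' (w' - w) = (\<Sum>j<n. inner (\<nu> j) w') + inner N (z n - x')"
    unfolding diff by (simp add: inner_diff_right inner_sum_right w'_def inner_commute)
  also have "inner N (z n - x') \<le> 0" using Nn zC[of n] by simp
  also have "(\<Sum>j<n. inner (\<nu> j) w') \<le> (\<Sum>j<n. v j * (\<Sum>i<n. v i))"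
  proof (rule sum_mono)
    fix j assume "j \<in> {..<n}"
    then have j: "j < n" by simp
    have "inner (\<nu> j) w' = inner (\<nu> j) (x' - z (Suc j)) - inner (\<nu> j) (z n - z (Suc j))"
      by (simp add: w'_def inner_diff_right)
    also have "inner (\<nu> j) (x' - z (Suc j)) \<le> 0" by (rule \<nu>n[OF j x'C])
    also have "- inner (\<nu> j) (z n - z (Suc j)) \<le> norm (\<nu> j) * norm (z n - z (Suc j))"
      using Cauchy_Schwarz_ineq2[of "\<nu> j" "z n - z (Suc j)"] by linarith
    then have "0 - inner (\<nu> j) (z n - z (Suc j)) \<le> norm (\<nu> j) * norm (z n - z (Suc j))" by simp
    also have "\<dots> \<le> v j * (\<Sum>i<n. v i)" by (intro mult_mono \<nu>v tail j v0) auto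
    finally show "inner (\<nu> j) w' \<le> v j * (\<Sum>i<n. v i)" by simp
  qed
  also have "(\<Sum>j<n. v j * (\<Sum>i<n. v i)) = (\<Sum>j<n. v j)\<^sup>2" by (simp add: sum_distrib_right power2_eq_square)
  finally show ?thesis by (simp add: w_def w'_def)
qed

primrec catching_up :: "'h::{real_inner, banach} set \<Rightarrow> (nat \<Rightarrow> 'h) \<Rightarrow> 'h \<Rightarrow> nat \<Rightarrow> 'h" where
  "catching_up C d x0 0 = x0"
| "catching_up C d x0 (Suc i) = metric_proj C (catching_up C d x0 i + d i)"

lemma catching_up_in:
  assumes "C \<noteq> {}" "closed C" "convex C" "x0 \<in> C"
  shows "catching_up C d x0 i \<in> C"
  using assms metric_proj_nearest(1)[OF assms(1-3)] by (cases i) auto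

lemma catching_up_increment:
  assumes C: "C \<noteq> {}" "closed C" "convex C" "x0 \<in> C"
    and d: "\<And>q. q < j \<Longrightarrow> norm (d q) \<le> m (Suc q) - m q" and ij: "i \<le> j"
  shows "norm (catching_up C d x0 j - catching_up C d x0 i) \<le> m j - m i"
  using ij d
proof (induction j rule: dec_induct)
  case (step q)
  have "norm (catching_up C d x0 (Suc q) - catching_up C d x0 q) \<le> norm (d q)"
    using metric_proj_step(1)[OF C(1-3) catching_up_in[OF C, of d q]] by simp
  also have "\<dots> \<le> m (Suc q) - m q" using step by simp
  finally show ?case
    using step norm_triangle_ineq[of "catching_up C d x0 (Suc q) - catching_up C d x0 q" "catching_up C d x0 q - catching_up C d x0 i"]
    by simp
qed simp

lemma catching_up_variational:
  assumes C: "C \<noteq> {}" "closed C" "convex C" "x0 \<in> C" and y: "y \<in> C"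
    and d: "\<And>q. q < j \<Longrightarrow> d q = H (Suc q) - H q" "\<And>q. q < j \<Longrightarrow> norm (d q) \<le> m (Suc q) - m q" and ij: "i \<le> j"
  shows "(norm (catching_up C d x0 j - y))\<^sup>2 - (norm (catching_up C d x0 i - y))\<^sup>2
    \<le> 2 * inner (catching_up C d x0 i - y) (H j - H i) + 2 * (m j - m i)\<^sup>2"
  using ij d
proof (induction j rule: dec_induct)
  case (step q)
  let ?X = "catching_up C d x0"
  have mq: "0 \<le> m (Suc q) - m q" using step.prems(2)[of q] norm_ge_zero order_trans by blast
  have mi: "0 \<le> m q - m i"
    using catching_up_increment[OF C, of q d m i] step norm_ge_zero order_trans by (metis less_SucI)
  have inc: "norm (?X (Suc q) - ?X i) \<le> m (Suc q) - m i"
    using step by (intro catching_up_increment[OF C]) auto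
  have "(norm (?X (Suc q) - y))\<^sup>2 - (norm (?X q - y))\<^sup>2 = 2 * inner (?X (Suc q) - y) (?X (Suc q) - ?X q) - (norm (?X (Suc q) - ?X q))\<^sup>2"
    by (simp add: power2_norm_eq_inner inner_diff_left inner_diff_right inner_commute)
  also have "\<dots> \<le> 2 * inner (?X (Suc q) - y) (?X (Suc q) - ?X q)" by simp
  also have "inner (?X (Suc q) - y) (?X (Suc q) - ?X q) = inner (?X (Suc q) - y) (d q) + inner (?X q + d q - ?X (Suc q)) (y - ?X (Suc q))"
    by (simp add: inner_diff_left inner_diff_right inner_add_left inner_add_right inner_commute algebra_simps del: catching_up.simps)
  also have "inner (?X q + d q - ?X (Suc q)) (y - ?X (Suc q)) \<le> 0"
    using metric_proj_inner_le[OF C(1-3) y, of "?X q + d q"] by simp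
  also have "inner (?X (Suc q) - y) (d q) = inner (?X i - y) (d q) + inner (?X (Suc q) - ?X i) (d q)"
    by (simp add: inner_diff_left del: catching_up.simps)
  also have "inner (?X (Suc q) - ?X i) (d q) \<le> norm (?X (Suc q) - ?X i) * norm (d q)" by (rule norm_cauchy_schwarz)
  also have "\<dots> \<le> (m (Suc q) - m i) * (m (Suc q) - m q)"
    using inc step.prems(2)[of q] mq mi by (intro mult_mono) auto
  finally have 1: "(norm (?X (Suc q) - y))\<^sup>2 - (norm (?X q - y))\<^sup>2 \<le> 2 * (inner (?X i - y) (d q) + (m (Suc q) - m i) * (m (Suc q) - m q))"
    by simp
  have 2: "(norm (?X q - y))\<^sup>2 - (norm (?X i - y))\<^sup>2 \<le> 2 * inner (?X i - y) (H q - H i) + 2 * (m q - m i)\<^sup>2"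
    using step by simp
  have 3: "(m q - m i)\<^sup>2 + (m (Suc q) - m i) * (m (Suc q) - m q) \<le> (m (Suc q) - m i)\<^sup>2"
  proof -
    have "(m (Suc q) - m i)\<^sup>2 - ((m q - m i)\<^sup>2 + (m (Suc q) - m i) * (m (Suc q) - m q)) = (m q - m i) * (m (Suc q) - m q)"
      by (simp add: power2_eq_square algebra_simps)
    also have "\<dots> \<ge> 0" using mi mq by simp
    finally show ?thesis by simp
  qed
  have 4: "inner (?X i - y) (H (Suc q) - H i) = inner (?X i - y) (H q - H i) + inner (?X i - y) (d q)"
    using step.prems(1)[of q] by (simp add: inner_diff_right)
  have arith: "\<lbrakk>A - B \<le> 2 * (p + r); B - E \<le> 2 * u + 2 * s; s + r \<le> t\<rbrakk> \<Longrightarrow> A - E \<le> 2 * (u + p) + 2 * t"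
    for A B E p r s t u :: real by (simp add: distrib_left)
  show ?case unfolding 4 by (rule arith[OF 1 2 3])
qed simp


lemma indefinite_integral_bochner:
  fixes h :: "real \<Rightarrow> 'h::banach"
  assumes h: "h bochner_integrable_on {a..b}"
  shows "continuous_on {a..b} (\<lambda>t. integral {a..t} h)"
    and "continuous_on {a..b} (\<lambda>t. integral {a..t} (\<lambda>s. norm (h s)))"
    and "\<lbrakk>a \<le> s; s \<le> t; t \<le> b\<rbrakk> \<Longrightarrow> norm (integral {a..t} h - integral {a..s} h)
      \<le> integral {a..t} (\<lambda>s. norm (h s)) - integral {a..s} (\<lambda>s. norm (h s))"
proof -
  note i = bochner_integrable_on_Icc_integrable[OF h]
  show "continuous_on {a..b} (\<lambda>t. integral {a..t} h)"
    by (rule indefinite_integral_continuous_1[OF i(1)])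
  show "continuous_on {a..b} (\<lambda>t. integral {a..t} (\<lambda>s. norm (h s)))"
    by (rule indefinite_integral_continuous_1[OF i(2)])
  assume st: "a \<le> s" "s \<le> t" "t \<le> b"
  show "norm (integral {a..t} h - integral {a..s} h)
      \<le> integral {a..t} (\<lambda>s. norm (h s)) - integral {a..s} (\<lambda>s. norm (h s))"
    unfolding integral_diff_Icc[OF i(1) st] integral_diff_Icc[OF i(2) st]
    using st by (intro integral_norm_bound_integral integrable_on_subinterval[OF i(1)] integrable_on_subinterval[OF i(2)]) auto
qed

lemma catching_up_limit:
  fixes C :: "'h::{real_inner, banach} set" and H :: "real \<Rightarrow> 'h" and M :: "real \<Rightarrow> real"
  assumes ab: "a < b" and C: "C \<noteq> {}" "closed C" "convex C" "x0 \<in> C"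
    and Hc: "continuous_on {a..b} H" and Mc: "continuous_on {a..b} M"
    and HM: "\<And>s t. \<lbrakk>a \<le> s; s \<le> t; t \<le> b\<rbrakk> \<Longrightarrow> norm (H t - H s) \<le> M t - M s"
  shows "\<exists>x. x a = x0 \<and> (\<forall>t\<in>{a..b}. x t \<in> C) \<and>
    (\<forall>s t. a \<le> s \<longrightarrow> s \<le> t \<longrightarrow> t \<le> b \<longrightarrow> norm (x t - x s) \<le> M t - M s \<and>
      (\<forall>y\<in>C. (norm (x t - y))\<^sup>2 - (norm (x s - y))\<^sup>2 \<le> 2 * inner (x s - y) (H t - H s) + 2 * (M t - M s)\<^sup>2))"
proof -
  let ?p = "dyadic_point a b" and ?idx = "dyadic_index a b"
  have pin: "a \<le> ?p k i" "?p k i \<le> b" if "i \<le> 2 ^ k" for k i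
    using dyadic_point_in[of a b i k] ab that by auto
  have pm: "?p k i \<le> ?p k j" if "i \<le> j" for k i j using dyadic_point_mono[of a b i j k] ab that by simp
  have Mm: "M s \<le> M t" if "a \<le> s" "s \<le> t" "t \<le> b" for s t
    using HM[OF that] norm_ge_zero[of "H t - H s"] by linarith
  define d where "d k i = H (?p k (Suc i)) - H (?p k i)" for k i
  define mm where "mm k i = M (?p k i)" for k i
  define X where "X k = catching_up C (d k) x0" for k
  have XC: "X k i \<in> C" for k i unfolding X_def by (rule catching_up_in[OF C])
  have dm: "norm (d k q) \<le> mm k (Suc q) - mm k q" if "q < 2 ^ k" for k q
    unfolding d_def mm_def using that by (intro HM pin pm) auto
  have Xinc: "norm (X k j - X k i) \<le> mm k j - mm k i" if "i \<le> j" "j \<le> 2 ^ k" for k i j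
    unfolding X_def using that dm by (intro catching_up_increment[OF C]) auto
  have fine: "\<exists>K. \<forall>k\<ge>K. \<forall>i<2 ^ k. mm k (Suc i) - mm k i \<le> \<eta>" if \<eta>: "\<eta> > 0" for \<eta>
  proof -
    have "uniformly_continuous_on {a..b} M" using Mc by (intro compact_uniformly_continuous) auto
    then obtain r where r: "r > 0" "\<And>s t. s \<in> {a..b} \<Longrightarrow> t \<in> {a..b} \<Longrightarrow> dist t s < r \<Longrightarrow> dist (M t) (M s) < \<eta>"
      using \<eta> unfolding uniformly_continuous_on_def by metis
    have "(\<lambda>k. (b - a) * (1 / 2) ^ k) \<longlonglongrightarrow> (b - a) * 0" by (intro tendsto_intros LIMSEQ_realpow_zero) auto
    then have "eventually (\<lambda>k. (b - a) * (1 / 2) ^ k < r) sequentially"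
      using r(1) by (intro order_tendstoD(2)) auto
    then obtain K where K: "\<And>k. k \<ge> K \<Longrightarrow> (b - a) * (1 / 2) ^ k < r" unfolding eventually_sequentially by blast
    have "mm k (Suc i) - mm k i \<le> \<eta>" if "k \<ge> K" "i < 2 ^ k" for k i
    proof -
      have "dist (?p k (Suc i)) (?p k i) < r"
        using K[OF that(1)] dyadic_point_Suc[of a b k i] ab by (simp add: dist_real_def power_one_over)
      then have "dist (M (?p k (Suc i))) (M (?p k i)) < \<eta>" using that pin by (intro r(2)) auto
      then show ?thesis by (simp add: mm_def dist_real_def)
    qed
    then show ?thesis by blast
  qed
  have comp: "(norm (X k i - X (k + n) (i * 2 ^ n)))\<^sup>2 \<le> 2 * \<eta> * (mm k i - mm k 0)"
    if \<eta>: "\<And>i. i < 2 ^ k \<Longrightarrow> mm k (Suc i) - mm k i \<le> \<eta>" and i: "i \<le> 2 ^ k" for k n i \<eta>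
    using i
  proof (induction i)
    case 0
    then show ?case by (simp add: X_def)
  next
    case (Suc i)
    let ?l = "k + n"
    have r: "?p ?l (i * 2 ^ n + 2 ^ n) = ?p k (Suc i)" "?p ?l (i * 2 ^ n) = ?p k i"
      using dyadic_point_refine[of a b k n "Suc i"] dyadic_point_refine[of a b k n i] by (simp_all add: add.commute)
    have lt: "i * 2 ^ n + j < 2 ^ ?l" if j: "j < 2 ^ n" for j :: nat
    proof -
      have "i * 2 ^ n + j < Suc i * 2 ^ n" using j by simp
      also have "\<dots> \<le> 2 ^ k * 2 ^ n" using Suc.prems by (intro mult_right_mono) auto
      finally show ?thesis by (simp add: power_add)
    qed
    have s1: "(\<Sum>j<2 ^ n. d ?l (i * 2 ^ n + j)) = d k i"
      unfolding d_def using sum_lessThan_telescope[of "\<lambda>j. H (?p ?l (i * 2 ^ n + j))" "2 ^ n"] r by simp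
    have s2: "(\<Sum>j<2 ^ n. mm ?l (Suc (i * 2 ^ n + j)) - mm ?l (i * 2 ^ n + j)) = mm k (Suc i) - mm k i"
      unfolding mm_def using sum_lessThan_telescope[of "\<lambda>j. M (?p ?l (i * 2 ^ n + j))" "2 ^ n"] r by simp
    have "(norm (X k (Suc i) - X ?l (i * 2 ^ n + 2 ^ n)))\<^sup>2 \<le> (norm (X k i - X ?l (i * 2 ^ n + 0)))\<^sup>2
        + 2 * (\<Sum>j<2 ^ n. mm ?l (Suc (i * 2 ^ n + j)) - mm ?l (i * 2 ^ n + j))\<^sup>2"
    proof (rule coarse_fine_step[OF C(1-3), where d = "\<lambda>j. d ?l (i * 2 ^ n + j)"])
      show "X k (Suc i) = metric_proj C (X k i + (\<Sum>j<2 ^ n. d ?l (i * 2 ^ n + j)))" unfolding s1 by (simp add: X_def)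
      show "X ?l (i * 2 ^ n + Suc j) = metric_proj C (X ?l (i * 2 ^ n + j) + d ?l (i * 2 ^ n + j))" for j by (simp add: X_def)
    qed (use XC dm lt in auto)
    also have "\<dots> \<le> 2 * \<eta> * (mm k i - mm k 0) + 2 * (mm k (Suc i) - mm k i)\<^sup>2"
      unfolding s2 using Suc by simp
    also have "(mm k (Suc i) - mm k i)\<^sup>2 \<le> \<eta> * (mm k (Suc i) - mm k i)"
      unfolding power2_eq_square
    proof (rule mult_right_mono)
      show "mm k (Suc i) - mm k i \<le> \<eta>" using \<eta>[of i] Suc.prems by simp
      show "0 \<le> mm k (Suc i) - mm k i" using order_trans[OF norm_ge_zero dm[of i k]] Suc.prems by simp
    qed
    finally show ?case by (simp add: algebra_simps)
  qed
  define Y where "Y k t = X k (?idx k t)" for k t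
  have idx: "?idx k t \<le> 2 ^ k" if "a \<le> t" "t \<le> b" for k t using dyadic_index_le[OF ab that] .
  have Ycau: "Cauchy (\<lambda>k. Y k t)" if t: "a \<le> t" "t \<le> b" for t
  proof (rule metric_CauchyI)
    fix e :: real assume e: "e > 0"
    define V where "V = M b - M a"
    have V: "V \<ge> 0" using Mm[of a b] ab by (simp add: V_def)
    define \<eta> where "\<eta> = min (e / 8) ((e / 8)\<^sup>2 / (2 * (V + 1)))"
    have \<eta>: "\<eta> > 0" using e V by (simp add: \<eta>_def)
    have cancel: "2 * (A / (2 * c)) * c = A" if "c > 0" for A c :: real using that by simp
    have \<eta>V: "2 * \<eta> * V \<le> (e / 8)\<^sup>2"
    proof -
      have "2 * \<eta> * V \<le> 2 * ((e / 8)\<^sup>2 / (2 * (V + 1))) * (V + 1)"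
        using V \<eta> by (intro mult_mono) (auto simp: \<eta>_def)
      also have "\<dots> = (e / 8)\<^sup>2" by (rule cancel) (use V in simp)
      finally show ?thesis .
    qed
    obtain K where K: "\<And>k i. k \<ge> K \<Longrightarrow> i < 2 ^ k \<Longrightarrow> mm k (Suc i) - mm k i \<le> \<eta>" using fine[OF \<eta>] by blast
    have YK: "dist (Y (K + n) t) (Y K t) \<le> e / 4" for n
    proof -
      let ?l = "K + n" and ?i = "?idx K t" and ?q = "?idx (K + n) t"
      have iq: "?i * 2 ^ n \<le> ?q" using dyadic_index_refine[OF ab t(1), of K n] by (metis div_times_less_eq_dividend)
      have "(norm (X K ?i - X ?l (?i * 2 ^ n)))\<^sup>2 \<le> 2 * \<eta> * (mm K ?i - mm K 0)"
        by (rule comp[OF K idx[OF t]]) simp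
      also have "\<dots> \<le> 2 * \<eta> * V"
        using \<eta> idx[OF t, of K] Mm[of "?p K ?i" b] pin[of ?i K] by (intro mult_left_mono) (auto simp: mm_def V_def)
      also have "\<dots> \<le> (e / 8)\<^sup>2" by (rule \<eta>V)
      finally have 1: "norm (X K ?i - X ?l (?i * 2 ^ n)) \<le> e / 8" by (rule power2_le_imp_le) (use e in simp)
      have "norm (X ?l ?q - X ?l (?i * 2 ^ n)) \<le> mm ?l ?q - mm ?l (?i * 2 ^ n)"
        using idx[OF t] by (intro Xinc iq)
      also have "\<dots> = M (?p ?l ?q) - M (?p K ?i)" by (simp add: mm_def dyadic_point_refine)
      also have "\<dots> \<le> M t - M (?p K ?i)"
        using Mm[of "?p ?l ?q" t] pin[of ?q ?l] idx[OF t, of ?l] dyadic_index_bounds(1)[OF ab t(1), of ?l] t by simp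
      also have "\<dots> \<le> \<eta>"
      proof (cases "?i = 2 ^ K")
        case True
        then have "?p K ?i = b" by simp
        then have "t = b" using dyadic_index_bounds(1)[OF ab t(1), of K] t by simp
        then show ?thesis using \<open>?p K ?i = b\<close> \<eta> by simp
      next
        case False
        then have i: "?i < 2 ^ K" using idx[OF t, of K] by simp
        have "M t \<le> M (?p K (Suc ?i))"
          using dyadic_index_bounds(2)[OF ab t(1), of K] pin[of "Suc ?i" K] i t by (intro Mm) auto
        then show ?thesis using K[OF order_refl i] by (simp add: mm_def)
      qed
      also have "\<dots> \<le> e / 8" unfolding \<eta>_def by (rule min.cobounded1)
      finally have 2: "norm (X ?l ?q - X ?l (?i * 2 ^ n)) \<le> e / 8" .
      have "norm (X ?l ?q - X K ?i) \<le> norm (X ?l ?q - X ?l (?i * 2 ^ n)) + norm (X K ?i - X ?l (?i * 2 ^ n))" by norm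
      then show ?thesis using 1 2 by (simp add: Y_def dist_norm)
    qed
    have "dist (Y m t) (Y n t) < e" if "m \<ge> K" "n \<ge> K" for m n
      using YK[of "m - K"] YK[of "n - K"] that dist_triangle2[of "Y m t" "Y n t" "Y K t"] e by simp
    then show "\<exists>K. \<forall>m\<ge>K. \<forall>n\<ge>K. dist (Y m t) (Y n t) < e" by blast
  qed
  define x where "x t = lim (\<lambda>k. Y k t)" for t
  have Yx: "(\<lambda>k. Y k t) \<longlonglongrightarrow> x t" if "a \<le> t" "t \<le> b" for t
    unfolding x_def using Cauchy_convergent[OF Ycau[OF that]] by (simp add: convergent_LIMSEQ_iff)
  define q where "q t k = ?p k (?idx k t)" for t k
  have q: "a \<le> q t k" "q t k \<le> b" if "a \<le> t" "t \<le> b" for t k unfolding q_def using pin idx[OF that] by auto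
  have qlim: "q t \<longlonglongrightarrow> t" if "a \<le> t" "t \<le> b" for t unfolding q_def using dyadic_point_index_tendsto[OF ab that(1)] .
  have Hq: "(\<lambda>k. H (q t k)) \<longlonglongrightarrow> H t" if "a \<le> t" "t \<le> b" for t
    using q[OF that] that by (intro continuous_on_tendsto_compose[OF Hc qlim[OF that]]) auto
  have Mq: "(\<lambda>k. M (q t k)) \<longlonglongrightarrow> M t" if "a \<le> t" "t \<le> b" for t
    using q[OF that] that by (intro continuous_on_tendsto_compose[OF Mc qlim[OF that]]) auto
  have idxm: "?idx k s \<le> ?idx k t" if "s \<le> t" for s t k
    unfolding dyadic_index_def using that ab by (intro nat_mono floor_mono divide_right_mono mult_right_mono) auto
  show ?thesis
  proof (intro exI[of _ x] conjI ballI allI impI)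
    have "?idx k a = 0" for k by (simp add: dyadic_index_def)
    then have "Y k a = x0" for k by (simp add: Y_def X_def)
    then show "x a = x0" by (simp add: x_def)
    show "x t \<in> C" if "t \<in> {a..b}" for t
      using closed_sequentially[OF C(2) _ Yx[of t]] that XC by (auto simp: Y_def)
    fix s t assume st: "a \<le> s" "s \<le> t" "t \<le> b"
    then have s: "a \<le> s" "s \<le> b" and t: "a \<le> t" "t \<le> b" by auto
    show "norm (x t - x s) \<le> M t - M s"
    proof (rule LIMSEQ_le)
      show "(\<lambda>k. norm (Y k t - Y k s)) \<longlonglongrightarrow> norm (x t - x s)" by (intro tendsto_intros Yx s t)
      show "(\<lambda>k. M (q t k) - M (q s k)) \<longlonglongrightarrow> M t - M s" by (intro tendsto_intros Mq s t)
      show "\<exists>N. \<forall>k\<ge>N. norm (Y k t - Y k s) \<le> M (q t k) - M (q s k)"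
        using Xinc[OF idxm[OF st(2)] idx[OF t]] by (simp add: Y_def mm_def q_def)
    qed
    fix y assume y: "y \<in> C"
    show "(norm (x t - y))\<^sup>2 - (norm (x s - y))\<^sup>2 \<le> 2 * inner (x s - y) (H t - H s) + 2 * (M t - M s)\<^sup>2"
    proof (rule LIMSEQ_le)
      show "(\<lambda>k. (norm (Y k t - y))\<^sup>2 - (norm (Y k s - y))\<^sup>2) \<longlonglongrightarrow> (norm (x t - y))\<^sup>2 - (norm (x s - y))\<^sup>2"
        by (intro tendsto_intros Yx s t)
      show "(\<lambda>k. 2 * inner (Y k s - y) (H (q t k) - H (q s k)) + 2 * (M (q t k) - M (q s k))\<^sup>2) \<longlonglongrightarrow>
        2 * inner (x s - y) (H t - H s) + 2 * (M t - M s)\<^sup>2"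
        by (intro tendsto_intros Yx Hq Mq s t)
      have "(norm (Y k t - y))\<^sup>2 - (norm (Y k s - y))\<^sup>2
        \<le> 2 * inner (Y k s - y) (H (q t k) - H (q s k)) + 2 * (M (q t k) - M (q s k))\<^sup>2" for k
        unfolding Y_def X_def q_def
        by (rule catching_up_variational[OF C y, where H = "\<lambda>i. H (?p k i)" and m = "\<lambda>i. M (?p k i)"])
          (use dm[of _ k] idx[OF t, of k] idxm[OF st(2), of k] in \<open>auto simp: d_def mm_def\<close>)
      then show "\<exists>N. \<forall>k\<ge>N. (norm (Y k t - y))\<^sup>2 - (norm (Y k s - y))\<^sup>2
        \<le> 2 * inner (Y k s - y) (H (q t k) - H (q s k)) + 2 * (M (q t k) - M (q s k))\<^sup>2" by blast
    qed
  qed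
qed

lemma derivative_in_tangent_cone:
  fixes C :: "'h::{real_inner, banach} set"
  assumes C: "convex C" and der: "(x has_vector_derivative d) (at t)" and c: "c = 1 \<or> c = -1"
    and r: "r > 0" "\<And>u. \<bar>u - t\<bar> < r \<Longrightarrow> x u \<in> C"
  shows "c *\<^sub>R d \<in> tangent_cone C (x t)"
proof -
  have xt: "x t \<in> C" using r by simp
  have "c *\<^sub>R d \<in> closure (tangent_cone C (x t))"
    unfolding closure_approachable
  proof (intro allI impI)
    fix e :: real assume e: "e > 0"
    obtain r1 where r1: "r1 > 0" "\<And>u. \<bar>u - t\<bar> < r1 \<Longrightarrow> norm (x u - x t - (u - t) *\<^sub>R d) \<le> e / 2 * \<bar>u - t\<bar>"
      using der[unfolded has_vector_derivative_at_alt] half_gt_zero[OF e] by blast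
    define k where "k = min r r1 / 2"
    have k: "k > 0" "k < r" "k < r1" using r(1) r1(1) by (auto simp: k_def)
    define u where "u = t + c * k"
    have u: "\<bar>u - t\<bar> = k" "u - t = c * k" using k c by (auto simp: u_def abs_mult)
    have "(1 / k) *\<^sub>R (x u - x t) \<in> tangent_cone C (x t)"
      using k u by (intro diff_in_tangent_cone[OF C xt] r(2)) auto
    moreover have "dist ((1 / k) *\<^sub>R (x u - x t)) (c *\<^sub>R d) < e"
    proof -
      have "(1 / k) *\<^sub>R (x u - x t) - c *\<^sub>R d = (1 / k) *\<^sub>R (x u - x t - (u - t) *\<^sub>R d)"
        using k by (simp add: u(2) scaleR_diff_right)
      then have "dist ((1 / k) *\<^sub>R (x u - x t)) (c *\<^sub>R d) = norm (x u - x t - (u - t) *\<^sub>R d) / k"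
        using k by (simp add: dist_norm)
      also have "\<dots> \<le> (e / 2 * k) / k" using r1(2)[of u] u k by (intro divide_right_mono) auto
      also have "\<dots> < e" using k e by simp
      finally show ?thesis .
    qed
    ultimately show "\<exists>y\<in>tangent_cone C (x t). dist y (c *\<^sub>R d) < e" by blast
  qed
  then show ?thesis using tangent_cone_closed_convex(1)[OF C xt] by simp
qed

text \<open>The evolution variational inequality, differentiated at \<open>t\<close>.\<close>

lemma derivative_in_normal_cone:
  fixes C :: "'h::{real_inner, banach} set"
  assumes x: "(x has_vector_derivative d) (at t)" and H: "(H has_vector_derivative h) (at t)"
    and M: "(M has_real_derivative m) (at t)" and xt: "x t \<in> C" and r: "r > 0"
    and evi: "\<And>u y. \<lbrakk>t \<le> u; u < t + r; y \<in> C\<rbrakk> \<Longrightarrow>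
      (norm (x u - y))\<^sup>2 - (norm (x t - y))\<^sup>2 \<le> 2 * inner (x t - y) (H u - H t) + 2 * (M u - M t)\<^sup>2"
  shows "h - d \<in> normal_cone C (x t)"
proof -
  have "inner (h - d) (y - x t) \<le> 0" if y: "y \<in> C" for y
  proof (rule ccontr)
    assume neg: "\<not> ?thesis"
    define \<phi> where "\<phi> u = inner (x u - y) (x u - y) - 2 * inner (x t - y) (H u - H t) - 2 * (M u - M t)\<^sup>2" for u
    have 1: "((\<lambda>u. inner (x u - y) (x u - y)) has_real_derivative (inner (x t - y) d + inner d (x t - y))) (at t)"
      unfolding has_real_derivative_iff_has_vector_derivative
      by (intro bounded_bilinear.has_vector_derivative[OF bounded_bilinear_inner] has_vector_derivative_diff_const[THEN iffD2] x)
    have 2: "((\<lambda>u. inner (x t - y) (H u - H t)) has_real_derivative inner (x t - y) h) (at t)"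
      unfolding has_real_derivative_iff_has_vector_derivative
      by (intro bounded_linear.has_vector_derivative[OF bounded_linear_inner_right] has_vector_derivative_diff_const[THEN iffD2] H)
    have "(\<phi> has_real_derivative ((inner (x t - y) d + inner d (x t - y)) - 2 * inner (x t - y) h - 2 * 0)) (at t)"
      unfolding \<phi>_def
      by (rule derivative_eq_intros 1 2 M refl | simp)+
    moreover have "(inner (x t - y) d + inner d (x t - y)) - 2 * inner (x t - y) h - 2 * 0 = 2 * inner (h - d) (y - x t)"
      by (simp add: inner_diff_left inner_diff_right inner_commute)
    ultimately have "(\<phi> has_real_derivative 2 * inner (h - d) (y - x t)) (at t)" by simp
    from DERIV_pos_inc_right[OF this] neg obtain e where e: "e > 0" "\<And>k. k > 0 \<Longrightarrow> k < e \<Longrightarrow> \<phi> t < \<phi> (t + k)" by auto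
    define k where "k = min e r / 2"
    have k: "k > 0" "k < e" "k < r" using e(1) r by (auto simp: k_def)
    have "\<phi> (t + k) \<le> \<phi> t" using evi[of "t + k" y] k y by (simp add: \<phi>_def power2_norm_eq_inner)
    then show False using e(2)[OF k(1,2)] by simp
  qed
  then show ?thesis using xt by (simp add: normal_cone_def)
qed

definition projected_trajectory ::
  "real \<Rightarrow> real \<Rightarrow> 'h::{real_inner, banach} set \<Rightarrow> (real \<Rightarrow> 'h) \<Rightarrow> (real \<Rightarrow> 'h) \<Rightarrow> bool" where
  "projected_trajectory a b C h x \<longleftrightarrow> absolutely_continuous_fun_on x {a..b} \<and>
    (\<exists>N. negligible N \<and> (\<forall>t\<in>{a..b} - N. x t \<in> C \<and>
      (x has_vector_derivative metric_proj (tangent_cone C (x t)) (h t)) (at t within {a..b})))"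

lemma projected_trajectory_exists:
  fixes C :: "'h::{real_inner, banach} set"
  assumes ab: "a < b" and C: "C \<noteq> {}" "closed C" "convex C" "x0 \<in> C" and h: "h bochner_integrable_on {a..b}"
  shows "\<exists>x. x a = x0 \<and> projected_trajectory a b C h x"
proof -
  define H where "H t = integral {a..t} h" for t
  define M where "M t = integral {a..t} (\<lambda>s. norm (h s))" for t
  have mi: "(\<lambda>s. norm (h s)) integrable_on {a..b}" by (rule bochner_integrable_on_Icc_integrable(2)[OF h])
  have HM: "continuous_on {a..b} H" "continuous_on {a..b} M"
    "\<And>s t. \<lbrakk>a \<le> s; s \<le> t; t \<le> b\<rbrakk> \<Longrightarrow> norm (H t - H s) \<le> M t - M s"
    using indefinite_integral_bochner[OF h] unfolding H_def M_def by auto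
  from catching_up_limit[OF ab C HM] obtain x where x0: "x a = x0 \<and> (\<forall>t\<in>{a..b}. x t \<in> C) \<and>
    (\<forall>s t. a \<le> s \<longrightarrow> s \<le> t \<longrightarrow> t \<le> b \<longrightarrow> norm (x t - x s) \<le> M t - M s \<and>
      (\<forall>y\<in>C. (norm (x t - y))\<^sup>2 - (norm (x s - y))\<^sup>2 \<le> 2 * inner (x s - y) (H t - H s) + 2 * (M t - M s)\<^sup>2))" ..
  have x: "x a = x0" "\<And>t. t \<in> {a..b} \<Longrightarrow> x t \<in> C"
    "\<And>s t. \<lbrakk>a \<le> s; s \<le> t; t \<le> b\<rbrakk> \<Longrightarrow> norm (x t - x s) \<le> M t - M s"
    "\<And>s t y. \<lbrakk>a \<le> s; s \<le> t; t \<le> b; y \<in> C\<rbrakk> \<Longrightarrow>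
      (norm (x t - y))\<^sup>2 - (norm (x s - y))\<^sup>2 \<le> 2 * inner (x s - y) (H t - H s) + 2 * (M t - M s)\<^sup>2"
    using x0 by simp_all
  have xI: "norm (x t - x s) \<le> integral {s..t} (\<lambda>s. norm (h s))" if "a \<le> s" "s \<le> t" "t \<le> b" for s t
    using x(3)[OF that] integral_diff_Icc[OF mi that] by (simp add: M_def)
  have ac: "absolutely_continuous_fun_on x {a..b}"
    by (rule absolutely_continuous_fun_on_integral_bound[OF nonnegative_absolutely_integrable_1[OF mi] _ xI]) auto
  obtain N1 where N1: "negligible N1" "\<forall>t\<in>{a<..<b} - N1. \<exists>d. (x has_vector_derivative d) (at t)"
    using differentiable_ae_of_integral_bound[OF ab mi _ xI] by auto
  obtain N2 where N2: "negligible N2" "\<forall>t\<in>{a<..<b} - N2. (H has_vector_derivative h t) (at t)"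
    using bochner_integrable_on_indefinite_integral_derivative[OF h] unfolding H_def by auto
  obtain N3 where N3: "negligible N3" "\<And>t. t \<in> {a<..<b} - N3 \<Longrightarrow> (M has_real_derivative norm (h t)) (at t)"
    using indefinite_integral_differentiable_ae[OF mi] unfolding M_def by auto
  define N where "N = N1 \<union> N2 \<union> N3 \<union> {a, b}"
  have N: "negligible N" using N1(1) N2(1) N3(1) by (simp add: N_def)
  have main: "x t \<in> C \<and> (x has_vector_derivative metric_proj (tangent_cone C (x t)) (h t)) (at t within {a..b})"
    if t: "t \<in> {a..b} - N" for t
  proof -
    have t': "t \<in> {a<..<b}" "t \<notin> N1" "t \<notin> N2" "t \<notin> N3" using t by (auto simp: N_def less_le)
    obtain d where d: "(x has_vector_derivative d) (at t)" using N1(2) t' by blast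
    define r where "r = min (t - a) (b - t)"
    have r: "r > 0" "\<And>u. \<bar>u - t\<bar> < r \<Longrightarrow> u \<in> {a..b}" using t' by (auto simp: r_def)
    have xt: "x t \<in> C" using x(2) t by auto
    have T: "d \<in> tangent_cone C (x t)" "- d \<in> tangent_cone C (x t)"
      using derivative_in_tangent_cone[OF C(3) d, of 1 r] derivative_in_tangent_cone[OF C(3) d, of "-1" r] r x(2) by auto
    have n: "h t - d \<in> normal_cone C (x t)"
    proof (rule derivative_in_normal_cone[OF d _ _ xt r(1)])
      show "(H has_vector_derivative h t) (at t)" using N2(2) t' by blast
      show "(M has_real_derivative norm (h t)) (at t)" using N3(2) t' by blast
      show "(norm (x u - y))\<^sup>2 - (norm (x t - y))\<^sup>2 \<le> 2 * inner (x t - y) (H u - H t) + 2 * (M u - M t)\<^sup>2"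
        if "t \<le> u" "u < t + r" "y \<in> C" for u y
        using that t' r(2)[of u] by (intro x(4)) auto
    qed
    have "inner (h t - d) d = 0"
      using normal_cone_tangent_cone_inner_le[OF C(3) xt n T(1)] normal_cone_tangent_cone_inner_le[OF C(3) xt n T(2)] by simp
    from moreau_decomposition(1)[OF C(3) xt n T(1) this] show ?thesis
      using has_vector_derivative_at_within[OF d] xt by simp
  qed
  show ?thesis unfolding projected_trajectory_def using ac x(1) N main by blast
qed


subsection \<open>Stability with respect to the driving term\<close>

lemma absolutely_continuous_fun_on_subset:
  assumes "absolutely_continuous_fun_on x S" "S' \<subseteq> S"
  shows "absolutely_continuous_fun_on x S'"
  using assms unfolding absolutely_continuous_fun_on_def by (meson subset_trans)

lemma absolutely_continuous_fun_on_diff: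
  fixes x y :: "real \<Rightarrow> 'h::real_normed_vector"
  assumes x: "absolutely_continuous_fun_on x S" and y: "absolutely_continuous_fun_on y S"
  shows "absolutely_continuous_fun_on (\<lambda>t. x t - y t) S"
  unfolding absolutely_continuous_fun_on_def
proof (intro allI impI)
  fix e :: real assume e: "0 < e"
  obtain d1 where d1: "d1 > 0" "\<forall>(n::nat) A B. (\<forall>i<n. A i \<le> B i \<and> {A i..B i} \<subseteq> S) \<longrightarrow>
      disjoint_family_on (\<lambda>i. {A i<..<B i}) {..<n} \<longrightarrow> (\<Sum>i<n. B i - A i) < d1 \<longrightarrow>
      (\<Sum>i<n. norm (x (B i) - x (A i))) < e / 2"
    using x half_gt_zero[OF e] unfolding absolutely_continuous_fun_on_def by blast
  obtain d2 where d2: "d2 > 0" "\<forall>(n::nat) A B. (\<forall>i<n. A i \<le> B i \<and> {A i..B i} \<subseteq> S) \<longrightarrow>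
      disjoint_family_on (\<lambda>i. {A i<..<B i}) {..<n} \<longrightarrow> (\<Sum>i<n. B i - A i) < d2 \<longrightarrow>
      (\<Sum>i<n. norm (y (B i) - y (A i))) < e / 2"
    using y half_gt_zero[OF e] unfolding absolutely_continuous_fun_on_def by blast
  have "(\<Sum>i<n. norm ((x (B i) - y (B i)) - (x (A i) - y (A i)))) < e"
    if AB: "\<forall>i<n. A i \<le> B i \<and> {A i..B i} \<subseteq> S" and
      *: "disjoint_family_on (\<lambda>i. {A i<..<B i}) {..<n}" "(\<Sum>i<n. B i - A i) < min d1 d2" for n :: nat and A B
  proof -
    have "(\<Sum>i<n. norm ((x (B i) - y (B i)) - (x (A i) - y (A i)))) \<le>
        (\<Sum>i<n. norm (x (B i) - x (A i)) + norm (y (B i) - y (A i)))"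
      by (intro sum_mono) norm
    also have "\<dots> = (\<Sum>i<n. norm (x (B i) - x (A i))) + (\<Sum>i<n. norm (y (B i) - y (A i)))"
      by (rule sum.distrib)
    also have "(\<Sum>i<n. norm (x (B i) - x (A i))) < e / 2" using d1(2) AB * by simp
    also have "(\<Sum>i<n. norm (y (B i) - y (A i))) < e / 2" using d2(2) AB * by simp
    finally show ?thesis by simp
  qed
  then show "\<exists>\<delta>>0. \<forall>(n::nat) A B. (\<forall>i<n. A i \<le> B i \<and> {A i..B i} \<subseteq> S) \<longrightarrow>
      disjoint_family_on (\<lambda>i. {A i<..<B i}) {..<n} \<longrightarrow> (\<Sum>i<n. B i - A i) < \<delta> \<longrightarrow>
      (\<Sum>i<n. norm ((x (B i) - y (B i)) - (x (A i) - y (A i)))) < e"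
    using d1(1) d2(1) by (intro exI[of _ "min d1 d2"]) simp
qed

lemma norm_diff_le_integral_of_derivative_bound:
  fixes x :: "real \<Rightarrow> 'h::banach"
  assumes ac: "absolutely_continuous_fun_on x {a..b}" and ab: "a \<le> b" and N: "negligible N"
    and der: "\<And>t. t \<in> {a..b} - N \<Longrightarrow> (x has_vector_derivative d t) (at t within {a..b})"
    and le: "\<And>t. t \<in> {a..b} - N \<Longrightarrow> norm (d t) \<le> \<rho> t" and \<rho>: "\<rho> integrable_on {a..b}"
  shows "norm (x b - x a) \<le> integral {a..b} \<rho>"
proof -
  have 1: "(d has_integral (x b - x a)) {a..b}" by (rule has_integral_absolutely_continuous[OF ab ac N der])
  define \<rho>' where "\<rho>' t = (if t \<in> N then norm (d t) else \<rho> t)" for t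
  have "\<rho>' integrable_on {a..b}" by (rule integrable_spike[OF \<rho> N]) (auto simp: \<rho>'_def)
  then have "norm (integral {a..b} d) \<le> integral {a..b} \<rho>'"
    using 1 le by (intro integral_norm_bound_integral) (auto simp: \<rho>'_def has_integral_integrable)
  also have "integral {a..b} \<rho>' = integral {a..b} \<rho>" by (rule integral_spike[OF N]) (auto simp: \<rho>'_def)
  finally show ?thesis using 1 by (simp add: integral_unique)
qed

lemma diff_le_integral_of_derivative_le:
  fixes u :: "real \<Rightarrow> real"
  assumes ac: "absolutely_continuous_fun_on u {a..b}" and ab: "a \<le> b" and N: "negligible N"
    and der: "\<And>t. t \<in> {a..b} - N \<Longrightarrow> (u has_real_derivative d t) (at t within {a..b})"
    and le: "\<And>t. t \<in> {a..b} - N \<Longrightarrow> d t \<le> \<rho> t" and \<rho>: "\<rho> integrable_on {a..b}"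
  shows "u b - u a \<le> integral {a..b} \<rho>"
proof -
  have 1: "(d has_integral (u b - u a)) {a..b}"
    using der by (intro has_integral_absolutely_continuous[OF ab ac N]) (simp add: has_real_derivative_iff_has_vector_derivative)
  have "((\<lambda>t. if t \<in> N then \<rho> t else d t) has_integral (u b - u a)) {a..b}"
    by (rule has_integral_spike[OF N _ 1]) auto
  then show ?thesis by (rule has_integral_le[OF _ integrable_integral[OF \<rho>]]) (use le in auto)
qed

text \<open>The smoothing \<open>(\<lambda>w. sqrt (\<parallel>w\<parallel>\<^sup>2 + \<epsilon>\<^sup>2))\<close> of the norm avoids the zeros of \<open>x - y\<close>.\<close>

lemma projected_trajectory_diff_le:
  fixes C :: "'h::{real_inner, banach} set"
  assumes C: "convex C" and x: "projected_trajectory a b C h1 x" and y: "projected_trajectory a b C h2 y"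
    and N: "negligible N" and h: "\<And>t. t \<in> {a..b} - N \<Longrightarrow> norm (h1 t - h2 t) \<le> \<rho> t"
    and \<rho>: "\<rho> integrable_on {a..b}" and init: "x a = y a" and t: "t \<in> {a..b}"
  shows "norm (x t - y t) \<le> integral {a..t} \<rho>"
proof (rule field_le_epsilon)
  fix e :: real assume e: "e > 0"
  obtain Nx where Nx: "negligible Nx" "\<And>s. s \<in> {a..b} - Nx \<Longrightarrow> x s \<in> C \<and>
      (x has_vector_derivative metric_proj (tangent_cone C (x s)) (h1 s)) (at s within {a..b})"
    using x unfolding projected_trajectory_def by blast
  obtain Ny where Ny: "negligible Ny" "\<And>s. s \<in> {a..b} - Ny \<Longrightarrow> y s \<in> C \<and>
      (y has_vector_derivative metric_proj (tangent_cone C (y s)) (h2 s)) (at s within {a..b})"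
    using y unfolding projected_trajectory_def by blast
  have acx: "absolutely_continuous_fun_on x {a..b}" and acy: "absolutely_continuous_fun_on y {a..b}"
    using x y by (auto simp: projected_trajectory_def)
  define w where "w s = x s - y s" for s
  define u where "u s = sqrt (inner (w s) (w s) + e\<^sup>2)" for s
  define dw where "dw s = metric_proj (tangent_cone C (x s)) (h1 s) - metric_proj (tangent_cone C (y s)) (h2 s)" for s
  define M where "M = Nx \<union> Ny \<union> N"
  have M: "negligible M" using Nx(1) Ny(1) N by (simp add: M_def)
  have upos: "inner (w s) (w s) + e\<^sup>2 > 0" for s using e by (simp add: add_nonneg_pos)
  have u0: "u s > 0" for s using upos[of s] by (simp add: u_def)
  have wu: "norm (w s) \<le> u s" for s unfolding u_def norm_eq_sqrt_inner by (intro real_sqrt_le_mono) simp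
  have un: "u s = norm (w s, e)" for s by (simp add: u_def norm_Pair power2_norm_eq_inner)
  have "absolutely_continuous_fun_on u {a..b}"
  proof (rule absolutely_continuous_fun_on_compose_lipschitz[OF absolutely_continuous_fun_on_diff[OF acx acy], of 1])
    fix s r
    have "norm (u s - u r) \<le> norm ((w s, e) - (w r, e))" unfolding un real_norm_def by (rule norm_triangle_ineq3)
    also have "\<dots> = norm (w s - w r)" by (simp add: norm_Pair)
    finally show "norm (u s - u r) \<le> 1 * norm ((x s - y s) - (x r - y r))" by (simp add: w_def)
  qed simp
  then have acu: "absolutely_continuous_fun_on u {a..t}" by (rule absolutely_continuous_fun_on_subset) (use t in auto)
  have "u t - u a \<le> integral {a..t} \<rho>"
  proof (rule diff_le_integral_of_derivative_le[OF acu _ M])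
    show "\<rho> integrable_on {a..t}" using t by (intro integrable_on_subinterval[OF \<rho>]) auto
    fix s assume s: "s \<in> {a..t} - M"
    then have s': "s \<in> {a..b} - Nx" "s \<in> {a..b} - Ny" "s \<in> {a..b} - N" using t by (auto simp: M_def)
    have "(w has_vector_derivative dw s) (at s within {a..b})"
      unfolding w_def dw_def using Nx(2)[OF s'(1)] Ny(2)[OF s'(2)] by (intro has_vector_derivative_diff) auto
    then have wd: "(w has_vector_derivative dw s) (at s within {a..t})"
      by (rule has_vector_derivative_within_subset) (use t in auto)
    have "((\<lambda>s. inner (w s) (w s)) has_real_derivative (inner (w s) (dw s) + inner (dw s) (w s))) (at s within {a..t})"
      unfolding has_real_derivative_iff_has_vector_derivative
      by (intro bounded_bilinear.has_vector_derivative[OF bounded_bilinear_inner] wd)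
    then have "((\<lambda>s. inner (w s) (w s) + e\<^sup>2) has_real_derivative 2 * inner (w s) (dw s)) (at s within {a..t})"
      by (auto intro!: derivative_eq_intros simp: inner_commute)
    from DERIV_chain2[OF DERIV_real_sqrt[OF upos] this]
    show "(u has_real_derivative (inverse (u s) / 2 * (2 * inner (w s) (dw s)))) (at s within {a..t})"
      unfolding u_def .
    have xC: "x s \<in> C" and yC: "y s \<in> C" using Nx(2)[OF s'(1)] Ny(2)[OF s'(2)] by auto
    have 1: "inner (h1 s - metric_proj (tangent_cone C (x s)) (h1 s)) (y s - x s) \<le> 0"
      using metric_proj_tangent_cone(2)[OF C xC, of "h1 s"] xC yC by (simp add: normal_cone_def)
    have 2: "inner (h2 s - metric_proj (tangent_cone C (y s)) (h2 s)) (x s - y s) \<le> 0"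
      using metric_proj_tangent_cone(2)[OF C yC, of "h2 s"] xC yC by (simp add: normal_cone_def)
    have "inner (w s) (dw s) = inner (w s) (h1 s - h2 s) + inner (h1 s - metric_proj (tangent_cone C (x s)) (h1 s)) (y s - x s)
        + inner (h2 s - metric_proj (tangent_cone C (y s)) (h2 s)) (x s - y s)"
      by (simp add: w_def dw_def inner_diff_left inner_diff_right inner_commute)
    also have "\<dots> \<le> inner (w s) (h1 s - h2 s)" using 1 2 by simp
    also have "\<dots> \<le> norm (w s) * norm (h1 s - h2 s)" by (rule norm_cauchy_schwarz)
    also have "\<dots> \<le> u s * \<rho> s" using wu h[OF s'(3)] u0[of s] by (intro mult_mono) auto
    finally show "inverse (u s) / 2 * (2 * inner (w s) (dw s)) \<le> \<rho> s" using u0[of s] by (simp add: field_simps)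
  qed (use t in auto)
  moreover have "u a = e" using e init by (simp add: u_def w_def)
  ultimately show "norm (x t - y t) \<le> integral {a..t} \<rho> + e" using wu[of t] by (simp add: w_def)
qed

lemma projected_trajectory_norm_le:
  fixes C :: "'h::{real_inner, banach} set"
  assumes C: "convex C" and x: "projected_trajectory a b C h x"
    and N: "negligible N" and h: "\<And>t. t \<in> {a..b} - N \<Longrightarrow> norm (h t) \<le> \<rho> t"
    and \<rho>: "\<rho> integrable_on {a..b}" and t: "t \<in> {a..b}"
  shows "norm (x t - x a) \<le> integral {a..t} \<rho>"
proof -
  obtain Nx where Nx: "negligible Nx" "\<And>s. s \<in> {a..b} - Nx \<Longrightarrow> x s \<in> C \<and>
      (x has_vector_derivative metric_proj (tangent_cone C (x s)) (h s)) (at s within {a..b})"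
    using x unfolding projected_trajectory_def by blast
  have acx: "absolutely_continuous_fun_on x {a..b}" using x by (auto simp: projected_trajectory_def)
  show ?thesis
  proof (rule norm_diff_le_integral_of_derivative_bound)
    show "absolutely_continuous_fun_on x {a..t}"
      by (rule absolutely_continuous_fun_on_subset[OF acx]) (use t in auto)
    show "negligible (Nx \<union> N)" using Nx(1) N by simp
    show "\<rho> integrable_on {a..t}" using t by (intro integrable_on_subinterval[OF \<rho>]) auto
    fix s assume s: "s \<in> {a..t} - (Nx \<union> N)"
    then have s': "s \<in> {a..b} - Nx" "s \<in> {a..b} - N" using t by auto
    show "(x has_vector_derivative metric_proj (tangent_cone C (x s)) (h s)) (at s within {a..t})"
      using Nx(2)[OF s'(1)] by (rule has_vector_derivative_within_subset[OF conjunct2]) (use t in auto)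
    show "norm (metric_proj (tangent_cone C (x s)) (h s)) \<le> \<rho> s"
      using metric_proj_tangent_cone(4)[OF C, of "x s" "h s"] Nx(2)[OF s'(1)] h[OF s'(2)] by simp
  qed (use t in auto)
qed

lemma exp_diff_le:
  fixes u v B :: real
  assumes "u \<le> B" "v \<le> B"
  shows "\<bar>exp u - exp v\<bar> \<le> exp B * \<bar>u - v\<bar>"
proof -
  have *: "exp u - exp v \<le> exp B * (u - v)" if "v \<le> u" "u \<le> B" for u v :: real
  proof -
    have "exp u - exp v = exp u * (1 - exp (v - u))" by (simp add: exp_diff right_diff_distrib)
    also have "1 - exp (v - u) \<le> u - v" using exp_ge_add_one_self[of "v - u"] by linarith
    then have "exp u * (1 - exp (v - u)) \<le> exp u * (u - v)" by (intro mult_left_mono) auto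
    also have "\<dots> \<le> exp B * (u - v)" using that by (intro mult_right_mono) auto
    finally show ?thesis .
  qed
  show ?thesis using *[of u v] *[of v u] assms by (cases "v \<le> u") (auto simp: abs_if)
qed

lemma has_integral_exp_indefinite_integral:
  fixes \<gamma> :: "real \<Rightarrow> real"
  assumes \<gamma>: "\<gamma> integrable_on {a..b}" and pos: "\<And>t. t \<in> {a..b} \<Longrightarrow> 0 \<le> \<gamma> t" and t: "t \<in> {a..b}"
  shows "((\<lambda>s. \<gamma> s * (c * exp (c * integral {a..s} \<gamma>))) has_integral (exp (c * integral {a..t} \<gamma>) - 1)) {a..t}"
proof -
  define K where "K s = integral {a..s} \<gamma>" for s
  have Kd: "K s - K r = integral {r..s} \<gamma>" if "a \<le> r" "r \<le> s" "s \<le> b" for r s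
    unfolding K_def by (rule integral_diff_Icc[OF \<gamma> that])
  have sub: "\<gamma> integrable_on {r..s}" if "a \<le> r" "s \<le> b" for r s
    using that by (intro integrable_on_subinterval[OF \<gamma>]) auto
  have Km: "K r \<le> K s" if "a \<le> r" "r \<le> s" "s \<le> b" for r s
    using Kd[OF that] integral_nonneg[OF sub[OF that(1,3)]] pos that by auto
  have acK: "absolutely_continuous_fun_on K {a..b}"
  proof (rule absolutely_continuous_fun_on_integral_bound[OF nonnegative_absolutely_integrable_1[OF \<gamma> pos] pos])
    show "norm (K s - K r) \<le> integral {r..s} \<gamma>" if "a \<le> r" "r \<le> s" "s \<le> b" for r s
      using Km[OF that] Kd[OF that] by simp
  qed
  define B where "B = \<bar>c\<bar> * K b"
  have cB: "c * K s \<le> B" if "s \<in> {a..b}" for s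
  proof -
    have "0 \<le> K s" using Km[of a s] that by (simp add: K_def)
    then have "c * K s \<le> \<bar>c\<bar> * K s" by (intro mult_right_mono) auto
    also have "\<dots> \<le> B" using Km[of s b] that by (auto simp: B_def intro!: mult_left_mono)
    finally show ?thesis .
  qed
  define E where "E s = exp (c * K s)" for s
  have "absolutely_continuous_fun_on E {a..b}"
  proof (rule absolutely_continuous_fun_on_compose_lipschitz[OF acK, of "exp B * (\<bar>c\<bar> + 1)"])
    show "0 < exp B * (\<bar>c\<bar> + 1)" by simp
    fix r s assume rs: "r \<in> {a..b}" "s \<in> {a..b}"
    have "\<bar>E r - E s\<bar> \<le> exp B * \<bar>c * K r - c * K s\<bar>" unfolding E_def by (intro exp_diff_le cB rs)
    also have "\<dots> = exp B * (\<bar>c\<bar> * \<bar>K r - K s\<bar>)" by (simp add: abs_mult[symmetric] right_diff_distrib)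
    also have "\<dots> \<le> exp B * ((\<bar>c\<bar> + 1) * \<bar>K r - K s\<bar>)" by (intro mult_left_mono mult_right_mono) auto
    finally show "norm (E r - E s) \<le> exp B * (\<bar>c\<bar> + 1) * norm (K r - K s)" by (simp add: mult.assoc)
  qed
  then have acE: "absolutely_continuous_fun_on E {a..t}" by (rule absolutely_continuous_fun_on_subset) (use t in auto)
  obtain N where N: "negligible N" "\<And>s. s \<in> {a<..<b} - N \<Longrightarrow> (K has_real_derivative \<gamma> s) (at s)"
    using indefinite_integral_differentiable_ae[OF \<gamma>] unfolding K_def by blast
  have "((\<lambda>s. \<gamma> s * (c * E s)) has_integral (E t - E a)) {a..t}"
  proof (rule has_integral_absolutely_continuous[OF _ acE])
    show "negligible (N \<union> {a, b})" using N(1) by simp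
    fix s assume s: "s \<in> {a..t} - (N \<union> {a, b})"
    then have "s \<in> {a<..<b} - N" using t by auto
    from N(2)[OF this] have "(E has_real_derivative \<gamma> s * (c * E s)) (at s)"
      unfolding E_def by (auto intro!: derivative_eq_intros)
    then show "(E has_vector_derivative \<gamma> s * (c * E s)) (at s within {a..t})"
      by (simp add: has_real_derivative_iff_has_vector_derivative has_vector_derivative_at_within)
  qed (use t in auto)
  then show ?thesis by (simp add: E_def K_def)
qed


subsection \<open>The drift along a continuous curve\<close>

lemma AE_lebesgue_on_Icc_iff:
  "(AE t in lebesgue_on {a..b::real}. P t) \<longleftrightarrow> (\<exists>N. negligible N \<and> (\<forall>t\<in>{a..b} - N. P t))"
proof -
  have "(AE t in lebesgue_on {a..b}. P t) \<longleftrightarrow> (AE t in lebesgue. t \<in> {a..b} \<longrightarrow> P t)"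
    by (rule AE_restrict_space_iff) simp
  also have "\<dots> \<longleftrightarrow> (\<exists>N. negligible N \<and> (\<forall>t\<in>{a..b} - N. P t))"
  proof -
    have "{t \<in> space lebesgue. \<not> (t \<in> {a..b} \<longrightarrow> P t)} \<subseteq> N \<longleftrightarrow> (\<forall>t\<in>{a..b} - N. P t)" for N by auto
    then show ?thesis unfolding eventually_ae_filter negligible_iff_null_sets by blast
  qed
  finally show ?thesis .
qed

lemma integrable_on_restrict_subset:
  fixes f :: "'a::euclidean_space \<Rightarrow> 'b::banach"
  assumes "S \<subseteq> S'"
  shows "(\<lambda>x. if x \<in> S then f x else 0) integrable_on S' \<longleftrightarrow> f integrable_on S"
    and "integral S' (\<lambda>x. if x \<in> S then f x else 0) = integral S f"
  using assms by (auto simp: integrable_on_def integral_restrict_Int Int_absorb2)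

lemma measurable_on_restrict_subset:
  fixes f :: "'a::euclidean_space \<Rightarrow> 'b::real_normed_vector"
  assumes f: "f measurable_on S'" and S: "S \<in> sets lebesgue" "S \<subseteq> S'"
  shows "(\<lambda>x. if x \<in> S then f x else 0) measurable_on S'"
proof -
  have "(\<lambda>x. if x \<in> S' then f x else 0) measurable_on UNIV" using f by (simp only: measurable_on_UNIV)
  from measurable_on_restrict[OF this S(1)]
  have "(\<lambda>x. if x \<in> S then if x \<in> S' then f x else 0 else 0) measurable_on UNIV" .
  also have "(\<lambda>x. if x \<in> S then if x \<in> S' then f x else 0 else 0) = (\<lambda>x. if x \<in> S' then if x \<in> S then f x else 0 else 0)"
    using S(2) by auto
  finally show ?thesis by (simp only: measurable_on_UNIV)
qed

lemma triangle_section: "t \<in> {T0..T} \<Longrightarrow> (t, s) \<in> triangle T0 T \<longleftrightarrow> s \<in> {T0..t}"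
  by (auto simp: triangle_def)

lemma triangle_subset: "triangle T0 T \<subseteq> cbox (T0, T0) (T, T)"
  by (auto simp: triangle_def cbox_Pair_eq)

lemma triangle_lebesgue: "triangle T0 T \<in> sets lebesgue"
proof -
  have "triangle T0 T = cbox (T0, T0) (T, T) \<inter> {z. snd z \<le> fst z}"
    by (auto simp: triangle_def cbox_Pair_eq)
  moreover have "closed (cbox (T0, T0) (T, T) \<inter> {z. snd z \<le> fst z})"
    by (intro closed_Int closed_cbox closed_Collect_le continuous_intros)
  ultimately show ?thesis by (simp add: borel_closed)
qed

definition growth_rate :: "real \<Rightarrow> (real \<Rightarrow> real) \<Rightarrow> (real \<Rightarrow> real \<Rightarrow> real) \<Rightarrow> real \<Rightarrow> real" where
  "growth_rate T0 \<beta> \<sigma> = (\<lambda>t. 2 * \<beta> t + 2 * integral {T0..t} (\<sigma> t))"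

context
  fixes T0 T :: real
    and f :: "real \<Rightarrow> 'h::{real_inner, banach} \<Rightarrow> 'h"
    and g :: "real \<Rightarrow> real \<Rightarrow> 'h \<Rightarrow> 'h"
    and \<beta> :: "real \<Rightarrow> real" and \<sigma> :: "real \<Rightarrow> real \<Rightarrow> real"
  assumes T: "T0 < T" and f: "cond_f T0 T f \<beta>" and g: "cond_g T0 T g \<sigma>"
begin

lemma \<sigma>_extension_integrable:
  "(\<lambda>z. if z \<in> triangle T0 T then \<sigma> (fst z) (snd z) else 0) integrable_on cbox (T0, T0) (T, T)"
proof -
  have "(\<lambda>(t, s). \<sigma> t s) integrable_on triangle T0 T"
    using g set_lebesgue_integral_eq_integral(1) unfolding cond_g_def by blast
  then show ?thesis using triangle_subset[of T0 T] by (simp add: integrable_on_restrict_subset split_def)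
qed

lemma \<sigma>_nonneg: "(t, s) \<in> triangle T0 T \<Longrightarrow> 0 \<le> \<sigma> t s"
  using g unfolding cond_g_def by auto

lemma \<sigma>_integral:
  shows "\<exists>N. negligible N \<and> (\<forall>t\<in>{T0..T} - N. \<sigma> t integrable_on {T0..t})"
    and "(\<lambda>t. integral {T0..t} (\<sigma> t)) integrable_on {T0..T}"
proof -
  let ?\<sigma> = "\<lambda>z. if z \<in> triangle T0 T then \<sigma> (fst z) (snd z) else 0"
  have eq: "(\<lambda>s. ?\<sigma> (t, s)) = (\<lambda>s. if s \<in> {T0..t} then \<sigma> t s else 0)" if "t \<in> {T0..T}" for t
    by (rule ext) (simp add: triangle_section[OF that])
  have sub: "{T0..t} \<subseteq> {T0..T}" if "t \<in> {T0..T}" for t using that by auto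
  have pos: "0 \<le> ?\<sigma> z" for z using \<sigma>_nonneg[of "fst z" "snd z"] by auto
  note F = integrable_on_cbox_Fubini[OF \<sigma>_extension_integrable pos]
  obtain N where N: "negligible N" "\<forall>t\<in>{T0..T} - N. (\<lambda>s. ?\<sigma> (t, s)) integrable_on {T0..T}" using F(1) by blast
  have "\<sigma> t integrable_on {T0..t}" if t: "t \<in> {T0..T} - N" for t
  proof -
    have t': "t \<in> {T0..T}" using t by simp
    have "(\<lambda>s. ?\<sigma> (t, s)) integrable_on {T0..T}" using N(2) t by blast
    then show ?thesis unfolding eq[OF t'] integrable_on_restrict_subset(1)[OF sub[OF t']] .
  qed
  then show "\<exists>N. negligible N \<and> (\<forall>t\<in>{T0..T} - N. \<sigma> t integrable_on {T0..t})" using N(1) by blast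
  have "integral {T0..T} (\<lambda>s. ?\<sigma> (t, s)) = integral {T0..t} (\<sigma> t)" if t: "t \<in> {T0..T}" for t
    unfolding eq[OF t] integrable_on_restrict_subset(2)[OF sub[OF t]] ..
  then show "(\<lambda>t. integral {T0..t} (\<sigma> t)) integrable_on {T0..T}"
    using F(2) by (rule integrable_eq[rotated]) auto
qed

lemma \<beta>_integrable_nonneg: "\<beta> integrable_on {T0..T}" "t \<in> {T0..T} \<Longrightarrow> 0 \<le> \<beta> t"
  using f set_lebesgue_integral_eq_integral(1)[of "{T0..T}" \<beta>] unfolding cond_f_def by auto

lemma growth_rate_integrable: "growth_rate T0 \<beta> \<sigma> integrable_on {T0..T}"
  unfolding growth_rate_def by (intro integrable_add integrable_on_mult_right \<beta>_integrable_nonneg(1) \<sigma>_integral(2))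

lemma growth_rate_nonneg:
  assumes t: "t \<in> {T0..T}"
  shows "0 \<le> growth_rate T0 \<beta> \<sigma> t"
proof -
  have "0 \<le> integral {T0..t} (\<sigma> t)"
  proof (cases "\<sigma> t integrable_on {T0..t}")
    case True
    then show ?thesis using \<sigma>_nonneg triangle_section[OF t] by (intro integral_nonneg) auto
  qed (simp add: not_integrable_integral)
  then show ?thesis using \<beta>_integrable_nonneg(2)[OF t] by (simp add: growth_rate_def)
qed

lemma f_lipschitz:
  assumes R: "R > 0"
  shows "\<exists>\<kappa>. \<kappa> integrable_on {T0..T} \<and> (\<forall>t\<in>{T0..T}. 0 \<le> \<kappa> t) \<and>
    (\<forall>t\<in>{T0..T}. \<forall>u v. norm u \<le> R \<longrightarrow> norm v \<le> R \<longrightarrow> norm (f t u - f t v) \<le> \<kappa> t * norm (u - v))"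
proof -
  have "\<forall>r>0. \<exists>\<kappa>::real \<Rightarrow> real. \<kappa> absolutely_integrable_on {T0..T} \<and> (\<forall>t\<in>{T0..T}. 0 \<le> \<kappa> t) \<and>
      (\<forall>t\<in>{T0..T}. \<forall>x\<in>cball 0 r. \<forall>y\<in>cball 0 r. norm (f t x - f t y) \<le> \<kappa> t * norm (x - y))"
    using f unfolding cond_f_def by (elim conjE)
  from this[rule_format, OF R] obtain \<kappa> where
    "\<kappa> absolutely_integrable_on {T0..T} \<and> (\<forall>t\<in>{T0..T}. 0 \<le> \<kappa> t) \<and>
      (\<forall>t\<in>{T0..T}. \<forall>x\<in>cball 0 R. \<forall>y\<in>cball 0 R. norm (f t x - f t y) \<le> \<kappa> t * norm (x - y))" ..
  then show ?thesis
    by (intro exI[of _ \<kappa>]) (simp add: mem_cball_0 set_lebesgue_integral_eq_integral(1))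
qed

lemma g_lipschitz:
  assumes R: "R > 0"
  shows "\<exists>\<mu>. \<mu> integrable_on {T0..T} \<and> (\<forall>t\<in>{T0..T}. 0 \<le> \<mu> t) \<and>
    (\<forall>t s. (t, s) \<in> triangle T0 T \<longrightarrow>
      (\<forall>u v. norm u \<le> R \<longrightarrow> norm v \<le> R \<longrightarrow> norm (g t s u - g t s v) \<le> \<mu> t * norm (u - v)))"
proof -
  have "\<forall>r>0. \<exists>\<mu>::real \<Rightarrow> real. \<mu> absolutely_integrable_on {T0..T} \<and> (\<forall>t\<in>{T0..T}. 0 \<le> \<mu> t) \<and>
      (\<forall>(t, s)\<in>triangle T0 T. \<forall>x\<in>cball 0 r. \<forall>y\<in>cball 0 r. norm (g t s x - g t s y) \<le> \<mu> t * norm (x - y))"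
    using g unfolding cond_g_def by (elim conjE)
  from this[rule_format, OF R] obtain \<mu> where
    "\<mu> absolutely_integrable_on {T0..T} \<and> (\<forall>t\<in>{T0..T}. 0 \<le> \<mu> t) \<and>
      (\<forall>(t, s)\<in>triangle T0 T. \<forall>x\<in>cball 0 R. \<forall>y\<in>cball 0 R. norm (g t s x - g t s y) \<le> \<mu> t * norm (x - y))" ..
  then show ?thesis
    by (intro exI[of _ \<mu>]) (fastforce simp: mem_cball_0 set_lebesgue_integral_eq_integral(1))
qed

lemma drift_bochner_integrable:
  assumes x: "continuous_on {T0..T} x"
  shows "drift T0 f g x bochner_integrable_on {T0..T}"
    and "\<exists>N. negligible N \<and> (\<forall>t\<in>{T0..T} - N. (\<lambda>s. g t s (x s)) integrable_on {T0..t})"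
proof -
  define K where "K = x ` {T0..T}"
  have K: "compact K" unfolding K_def using x by (intro compact_continuous_image) auto
  then obtain R where R: "R > 0" "\<And>v. v \<in> K \<Longrightarrow> norm v \<le> R"
    using compact_imp_bounded bounded_pos by metis
  define c where "c = clamp T0 T"
  have cI: "c t \<in> {T0..T}" for t using clamp_in_interval[of T0 T t] T by (simp add: c_def)
  have ceq: "c t = t" if "t \<in> {T0..T}" for t using clamp_cancel_cbox[of t T0 T] that by (simp add: c_def)
  have xc: "continuous_on UNIV (\<lambda>t. x (c t))"
    unfolding c_def using x by (intro clamp_continuous_on) simp
  from f_lipschitz[OF R(1)] obtain \<kappa> where "\<kappa> integrable_on {T0..T} \<and> (\<forall>t\<in>{T0..T}. 0 \<le> \<kappa> t) \<and>
    (\<forall>t\<in>{T0..T}. \<forall>u v. norm u \<le> R \<longrightarrow> norm v \<le> R \<longrightarrow> norm (f t u - f t v) \<le> \<kappa> t * norm (u - v))" ..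
  then have \<kappa>: "\<kappa> integrable_on {T0..T}" "\<And>t. t \<in> {T0..T} \<Longrightarrow> 0 \<le> \<kappa> t"
    "\<And>t u v. \<lbrakk>t \<in> {T0..T}; norm u \<le> R; norm v \<le> R\<rbrakk> \<Longrightarrow> norm (f t u - f t v) \<le> \<kappa> t * norm (u - v)"
    by simp_all
  from g_lipschitz[OF R(1)] obtain \<mu> where "\<mu> integrable_on {T0..T} \<and> (\<forall>t\<in>{T0..T}. 0 \<le> \<mu> t) \<and>
    (\<forall>t s. (t, s) \<in> triangle T0 T \<longrightarrow>
      (\<forall>u v. norm u \<le> R \<longrightarrow> norm v \<le> R \<longrightarrow> norm (g t s u - g t s v) \<le> \<mu> t * norm (u - v)))" ..
  then have \<mu>: "\<mu> integrable_on {T0..T}" "\<And>t. t \<in> {T0..T} \<Longrightarrow> 0 \<le> \<mu> t"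
    "\<And>t s u v. \<lbrakk>(t, s) \<in> triangle T0 T; norm u \<le> R; norm v \<le> R\<rbrakk> \<Longrightarrow> norm (g t s u - g t s v) \<le> \<mu> t * norm (u - v)"
    by simp_all
  have "(\<lambda>t. f t (x (c t))) bochner_integrable_on cbox T0 T"
  proof (rule bochner_integrable_on_Caratheodory[where G = f and x = "\<lambda>t. x (c t)" and \<kappa> = \<kappa> and R = R and \<beta> = \<beta> and K = K])
    show "(\<lambda>t. f t v) measurable_on cbox T0 T" for v using f unfolding cond_f_def by simp
    show "\<kappa> measurable_on cbox T0 T"
      using \<kappa>(1) by (intro integrable_imp_measurable_on) simp
    show "norm (f t v) \<le> \<beta> t * (1 + norm v)" if "t \<in> cbox T0 T" for t v
      using f that unfolding cond_f_def by auto
    show "range (\<lambda>t. x (c t)) \<subseteq> K" using cI by (auto simp: K_def)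
  qed (use \<kappa> \<beta>_integrable_nonneg R K xc in auto)
  then have "(\<lambda>t. f t (x (c t))) bochner_integrable_on {T0..T}" by simp
  then have F: "(\<lambda>t. f t (x t)) bochner_integrable_on {T0..T}"
    by (rule bochner_integrable_on_spike[OF _ negligible_empty]) (simp add: ceq)
  define G where "G z v = (if z \<in> triangle T0 T then g (fst z) (snd z) v else 0)" for z v
  have "(\<lambda>z. G z (x (c (snd z)))) bochner_integrable_on cbox (T0, T0) (T, T)"
  proof (rule bochner_integrable_on_Caratheodory[where G = G and x = "\<lambda>z. x (c (snd z))" and \<kappa> = "\<lambda>z. \<mu> (fst z)" and R = R and K = K
        and \<beta> = "\<lambda>z. if z \<in> triangle T0 T then \<sigma> (fst z) (snd z) else 0"])
    show "(\<lambda>z. G z v) measurable_on cbox (T0, T0) (T, T)" for v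
    proof -
      have "(\<lambda>(t, s). g t s v) measurable_on cbox (T0, T0) (T, T)"
        using g unfolding cond_g_def by (simp add: cbox_Pair_eq)
      from measurable_on_restrict_subset[OF this triangle_lebesgue triangle_subset]
      show ?thesis unfolding G_def split_def .
    qed
    show "(\<lambda>z. \<mu> (fst z)) measurable_on cbox (T0, T0) (T, T)"
      using integrable_imp_measurable_on[of \<mu> T0 T] \<mu>(1) by (intro measurable_on_fst) simp
    show "0 \<le> \<mu> (fst z)" if "z \<in> cbox (T0, T0) (T, T)" for z
      using that \<mu>(2) by (auto simp: cbox_Pair_eq)
    show "norm (G z u - G z v) \<le> \<mu> (fst z) * norm (u - v)"
      if "z \<in> cbox (T0, T0) (T, T)" "norm u \<le> R" "norm v \<le> R" for z u v
      using that \<mu>(2)[of "fst z"] \<mu>(3)[of "fst z" "snd z" u v] by (auto simp: G_def cbox_Pair_eq)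
    show "(\<lambda>z. if z \<in> triangle T0 T then \<sigma> (fst z) (snd z) else 0) integrable_on cbox (T0, T0) (T, T)"
      by (rule \<sigma>_extension_integrable)
    show "norm (G z v) \<le> (if z \<in> triangle T0 T then \<sigma> (fst z) (snd z) else 0) * (1 + norm v)" for z v
      using g unfolding cond_g_def by (auto simp: G_def split_def)
    show "continuous_on UNIV (\<lambda>z::real \<times> real. x (c (snd z)))"
      by (rule continuous_on_compose2[OF xc continuous_on_snd[OF continuous_on_id]]) auto
    show "range (\<lambda>z. x (c (snd z))) \<subseteq> K" using cI by (auto simp: K_def)
  qed (use R K in auto)
  note Fub = bochner_integrable_on_Fubini[OF this]
  have eq: "G (t, s) (x (c (snd (t, s)))) = (if s \<in> {T0..t} then g t s (x s) else 0)" if t: "t \<in> {T0..T}" for t s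
    using t by (auto simp: G_def triangle_section[OF t] ceq)
  have sub: "{T0..t} \<subseteq> {T0..T}" if "t \<in> {T0..T}" for t using that by auto
  obtain N where N: "negligible N" "\<forall>t\<in>{T0..T} - N. (\<lambda>s. G (t, s) (x (c (snd (t, s))))) bochner_integrable_on {T0..T}"
    using Fub(1) by blast
  have "(\<lambda>s. g t s (x s)) integrable_on {T0..t}" if t: "t \<in> {T0..T} - N" for t
  proof -
    have t': "t \<in> {T0..T}" using t by simp
    have "(\<lambda>s. G (t, s) (x (c (snd (t, s))))) integrable_on {T0..T}"
      using N(2) t bochner_integrable_on_Icc_integrable(1) by blast
    then show ?thesis unfolding eq[OF t'] integrable_on_restrict_subset(1)[OF sub[OF t']] .
  qed
  then show "\<exists>N. negligible N \<and> (\<forall>t\<in>{T0..T} - N. (\<lambda>s. g t s (x s)) integrable_on {T0..t})"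
    using N(1) by blast
  have "(\<lambda>t. integral {T0..t} (\<lambda>s. g t s (x s))) bochner_integrable_on {T0..T}"
  proof (rule bochner_integrable_on_spike[OF Fub(2) negligible_empty])
    fix t assume "t \<in> {T0..T} - {}"
    then have t: "t \<in> {T0..T}" by simp
    show "integral {T0..t} (\<lambda>s. g t s (x s)) = integral {T0..T} (\<lambda>s. G (t, s) (x (c (snd (t, s)))))"
      unfolding eq[OF t] integrable_on_restrict_subset(2)[OF sub[OF t]] ..
  qed
  then show "drift T0 f g x bochner_integrable_on {T0..T}"
    unfolding drift_def[abs_def] by (intro bochner_integrable_on_add F)
qed

lemma norm_drift_le:
  assumes x: "continuous_on {T0..T} x" and w: "\<And>s. s \<in> {T0..T} \<Longrightarrow> 1 + norm (x s) \<le> w s"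
    and mono: "\<And>s t. \<lbrakk>T0 \<le> s; s \<le> t; t \<le> T\<rbrakk> \<Longrightarrow> w s \<le> w t"
  shows "\<exists>N. negligible N \<and> (\<forall>t\<in>{T0..T} - N. norm (drift T0 f g x t) \<le> growth_rate T0 \<beta> \<sigma> t / 2 * w t)"
proof -
  obtain N1 where N1: "negligible N1" "\<forall>t\<in>{T0..T} - N1. \<sigma> t integrable_on {T0..t}" using \<sigma>_integral(1) by blast
  obtain N2 where N2: "negligible N2" "\<forall>t\<in>{T0..T} - N2. (\<lambda>s. g t s (x s)) integrable_on {T0..t}"
    using drift_bochner_integrable(2)[OF x] by blast
  have "norm (drift T0 f g x t) \<le> growth_rate T0 \<beta> \<sigma> t / 2 * w t" if t: "t \<in> {T0..T} - (N1 \<union> N2)" for t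
  proof -
    have tI: "t \<in> {T0..T}" using t by simp
    have "norm (f t (x t)) \<le> \<beta> t * (1 + norm (x t))" using f tI unfolding cond_f_def by blast
    also have "\<dots> \<le> \<beta> t * w t" using w[OF tI] \<beta>_integrable_nonneg(2)[OF tI] by (intro mult_left_mono) auto
    finally have 1: "norm (f t (x t)) \<le> \<beta> t * w t" .
    have si: "(\<lambda>s. \<sigma> t s * w t) integrable_on {T0..t}" using N1(2) t by (intro integrable_on_mult_left) blast
    have "norm (integral {T0..t} (\<lambda>s. g t s (x s))) \<le> integral {T0..t} (\<lambda>s. \<sigma> t s * w t)"
    proof (rule integral_norm_bound_integral[OF _ si])
      show "(\<lambda>s. g t s (x s)) integrable_on {T0..t}" using N2(2) t by blast
      fix s assume s: "s \<in> {T0..t}"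
      then have tri: "(t, s) \<in> triangle T0 T" using triangle_section[OF tI] by simp
      have "norm (g t s (x s)) \<le> \<sigma> t s * (1 + norm (x s))" using g tri unfolding cond_g_def by auto
      also have "\<dots> \<le> \<sigma> t s * w t"
        using w[of s] mono[of s t] s tI \<sigma>_nonneg[OF tri] by (intro mult_left_mono) auto
      finally show "norm (g t s (x s)) \<le> \<sigma> t s * w t" .
    qed
    also have "\<dots> = integral {T0..t} (\<sigma> t) * w t" by simp
    finally have 2: "norm (integral {T0..t} (\<lambda>s. g t s (x s))) \<le> integral {T0..t} (\<sigma> t) * w t" .
    have "norm (drift T0 f g x t) \<le> \<beta> t * w t + integral {T0..t} (\<sigma> t) * w t"
      unfolding drift_def by (rule order_trans[OF norm_triangle_ineq add_mono[OF 1 2]])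
    then show ?thesis by (simp add: growth_rate_def algebra_simps)
  qed
  moreover have "negligible (N1 \<union> N2)" using N1(1) N2(1) by simp
  ultimately show ?thesis by blast
qed

lemma drift_diff_le:
  assumes R: "R > 0"
  shows "\<exists>k. k integrable_on {T0..T} \<and> (\<forall>t\<in>{T0..T}. 0 \<le> k t) \<and>
    (\<forall>x y c. continuous_on {T0..T} x \<longrightarrow> continuous_on {T0..T} y \<longrightarrow>
      (\<forall>t\<in>{T0..T}. norm (x t) \<le> R \<and> norm (y t) \<le> R \<and> norm (x t - y t) \<le> c t) \<longrightarrow>
      (\<forall>s t. T0 \<le> s \<longrightarrow> s \<le> t \<longrightarrow> t \<le> T \<longrightarrow> c s \<le> c t) \<longrightarrow>
      (\<exists>N. negligible N \<and> (\<forall>t\<in>{T0..T} - N. norm (drift T0 f g x t - drift T0 f g y t) \<le> k t * c t)))"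
proof -
  from f_lipschitz[OF R(1)] obtain \<kappa> where "\<kappa> integrable_on {T0..T} \<and> (\<forall>t\<in>{T0..T}. 0 \<le> \<kappa> t) \<and>
    (\<forall>t\<in>{T0..T}. \<forall>u v. norm u \<le> R \<longrightarrow> norm v \<le> R \<longrightarrow> norm (f t u - f t v) \<le> \<kappa> t * norm (u - v))" ..
  then have \<kappa>: "\<kappa> integrable_on {T0..T}" "\<And>t. t \<in> {T0..T} \<Longrightarrow> 0 \<le> \<kappa> t"
    "\<And>t u v. \<lbrakk>t \<in> {T0..T}; norm u \<le> R; norm v \<le> R\<rbrakk> \<Longrightarrow> norm (f t u - f t v) \<le> \<kappa> t * norm (u - v)"
    by simp_all
  from g_lipschitz[OF R(1)] obtain \<mu> where "\<mu> integrable_on {T0..T} \<and> (\<forall>t\<in>{T0..T}. 0 \<le> \<mu> t) \<and>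
    (\<forall>t s. (t, s) \<in> triangle T0 T \<longrightarrow>
      (\<forall>u v. norm u \<le> R \<longrightarrow> norm v \<le> R \<longrightarrow> norm (g t s u - g t s v) \<le> \<mu> t * norm (u - v)))" ..
  then have \<mu>: "\<mu> integrable_on {T0..T}" "\<And>t. t \<in> {T0..T} \<Longrightarrow> 0 \<le> \<mu> t"
    "\<And>t s u v. \<lbrakk>(t, s) \<in> triangle T0 T; norm u \<le> R; norm v \<le> R\<rbrakk> \<Longrightarrow> norm (g t s u - g t s v) \<le> \<mu> t * norm (u - v)"
    by simp_all
  define k where "k t = \<kappa> t + \<mu> t * (T - T0)" for t
  have main: "\<exists>N. negligible N \<and> (\<forall>t\<in>{T0..T} - N. norm (drift T0 f g x t - drift T0 f g y t) \<le> k t * c t)"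
    if x: "continuous_on {T0..T} x" and y: "continuous_on {T0..T} y"
      and b: "\<forall>t\<in>{T0..T}. norm (x t) \<le> R \<and> norm (y t) \<le> R \<and> norm (x t - y t) \<le> c t"
      and mono: "\<forall>s t. T0 \<le> s \<longrightarrow> s \<le> t \<longrightarrow> t \<le> T \<longrightarrow> c s \<le> c t" for x y c
  proof -
    obtain N1 where N1: "negligible N1" "\<forall>t\<in>{T0..T} - N1. (\<lambda>s. g t s (x s)) integrable_on {T0..t}"
      using drift_bochner_integrable(2)[OF x] by blast
    obtain N2 where N2: "negligible N2" "\<forall>t\<in>{T0..T} - N2. (\<lambda>s. g t s (y s)) integrable_on {T0..t}"
      using drift_bochner_integrable(2)[OF y] by blast
    have "norm (drift T0 f g x t - drift T0 f g y t) \<le> k t * c t" if t: "t \<in> {T0..T} - (N1 \<union> N2)" for t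
    proof -
      have tI: "t \<in> {T0..T}" using t by simp
      have c0: "0 \<le> c t" using b tI norm_ge_zero order_trans by blast
      have "norm (f t (x t) - f t (y t)) \<le> \<kappa> t * norm (x t - y t)" using b tI by (intro \<kappa>(3)) auto
      also have "\<dots> \<le> \<kappa> t * c t" using b tI \<kappa>(2) by (intro mult_left_mono) auto
      finally have 1: "norm (f t (x t) - f t (y t)) \<le> \<kappa> t * c t" .
      have ix: "(\<lambda>s. g t s (x s)) integrable_on {T0..t}" using N1(2) t by blast
      have iy: "(\<lambda>s. g t s (y s)) integrable_on {T0..t}" using N2(2) t by blast
      have "norm (integral {T0..t} (\<lambda>s. g t s (x s) - g t s (y s))) \<le> integral {T0..t} (\<lambda>s. \<mu> t * c t)"
      proof (rule integral_norm_bound_integral[OF integrable_diff[OF ix iy] integrable_const_ivl])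
        fix s assume s: "s \<in> {T0..t}"
        then have sI: "s \<in> {T0..T}" and tri: "(t, s) \<in> triangle T0 T" using tI triangle_section[OF tI] by auto
        have "norm (g t s (x s) - g t s (y s)) \<le> \<mu> t * norm (x s - y s)" using b sI by (intro \<mu>(3) tri) auto
        also have "norm (x s - y s) \<le> c t" using b sI mono s tI by (meson atLeastAtMost_iff order_trans)
        then have "\<mu> t * norm (x s - y s) \<le> \<mu> t * c t" using \<mu>(2)[OF tI] by (rule mult_left_mono)
        finally show "norm (g t s (x s) - g t s (y s)) \<le> \<mu> t * c t" .
      qed
      also have "\<dots> = (t - T0) * (\<mu> t * c t)" using tI by simp
      also have "\<dots> \<le> (T - T0) * (\<mu> t * c t)" using tI \<mu>(2)[OF tI] c0 by (intro mult_right_mono) auto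
      finally have 2: "norm (integral {T0..t} (\<lambda>s. g t s (x s)) - integral {T0..t} (\<lambda>s. g t s (y s))) \<le> (T - T0) * (\<mu> t * c t)"
        unfolding integral_diff[OF ix iy] .
      have "drift T0 f g x t - drift T0 f g y t = (f t (x t) - f t (y t))
        + (integral {T0..t} (\<lambda>s. g t s (x s)) - integral {T0..t} (\<lambda>s. g t s (y s)))" by (simp add: drift_def)
      also have "norm \<dots> \<le> \<kappa> t * c t + (T - T0) * (\<mu> t * c t)"
        by (rule order_trans[OF norm_triangle_ineq add_mono[OF 1 2]])
      also have "\<dots> = k t * c t" by (simp add: k_def algebra_simps)
      finally show ?thesis .
    qed
    moreover have "negligible (N1 \<union> N2)" using N1(1) N2(1) by simp
    ultimately show ?thesis by blast
  qed
  have "k integrable_on {T0..T}" unfolding k_def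
    by (intro integrable_add integrable_on_mult_left \<kappa>(1) \<mu>(1))
  moreover have "\<forall>t\<in>{T0..T}. 0 \<le> k t" using \<kappa>(2) \<mu>(2) T by (simp add: k_def)
  ultimately show ?thesis using main by blast
qed

end


subsection \<open>Picard iteration\<close>

text \<open>In the norm weighted by \<open>exp (-2 K)\<close>, the solution operator has Lipschitz constant \<open>1/2\<close>.\<close>

lemma weighted_contraction:
  fixes C :: "'h::{real_inner, banach} set"
  assumes C: "convex C" and k: "k integrable_on {a..b}" "\<And>t. t \<in> {a..b} \<Longrightarrow> 0 \<le> k t" and c: "0 \<le> c"
    and lip: "\<exists>N. negligible N \<and> (\<forall>t\<in>{a..b} - N. norm (h1 t - h2 t) \<le> k t * (c * exp (2 * integral {a..t} k)))"
    and X: "projected_trajectory a b C h1 X" and Y: "projected_trajectory a b C h2 Y"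
    and init: "X a = Y a" and t: "t \<in> {a..b}"
  shows "norm (X t - Y t) \<le> c / 2 * exp (2 * integral {a..t} k)"
proof -
  have I: "((\<lambda>s. k s * (c * exp (2 * integral {a..s} k))) has_integral c / 2 * (exp (2 * integral {a..t} k) - 1)) {a..t}"
    if "t \<in> {a..b}" for t
    using has_integral_mult_right[OF has_integral_exp_indefinite_integral[OF k that, of 2], of "c / 2"]
    by (simp add: mult_ac)
  have "(\<lambda>s. k s * (c * exp (2 * integral {a..s} k))) integrable_on {a..b}"
    using t by (intro has_integral_integrable[OF I]) auto
  moreover obtain N where "negligible N" "\<And>t. t \<in> {a..b} - N \<Longrightarrow> norm (h1 t - h2 t) \<le> k t * (c * exp (2 * integral {a..t} k))"
    using lip by blast
  ultimately have "norm (X t - Y t) \<le> integral {a..t} (\<lambda>s. k s * (c * exp (2 * integral {a..s} k)))"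
    by (intro projected_trajectory_diff_le[OF C X Y _ _ _ init t])
  also have "\<dots> = c / 2 * (exp (2 * integral {a..t} k) - 1)" by (rule integral_unique[OF I[OF t]])
  also have "\<dots> \<le> c / 2 * exp (2 * integral {a..t} k)" using c by (intro mult_left_mono) auto
  finally show ?thesis .
qed

lemma le_0_of_le_half_powers:
  fixes u v :: real
  assumes "\<And>n::nat. u \<le> v / 2 ^ n"
  shows "u \<le> 0"
proof (rule LIMSEQ_le_const)
  have "(\<lambda>n. v * (1 / 2) ^ n) \<longlonglongrightarrow> v * 0" by (intro tendsto_intros LIMSEQ_realpow_zero) auto
  then show "(\<lambda>n. v / 2 ^ n) \<longlonglongrightarrow> 0" by (simp add: power_one_over)
  show "\<exists>N. \<forall>n\<ge>N. u \<le> v / 2 ^ n" using assms by blast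
qed

lemma indefinite_integral_mono:
  fixes k :: "real \<Rightarrow> real"
  assumes k: "k integrable_on {a..b}" "\<And>t. t \<in> {a..b} \<Longrightarrow> 0 \<le> k t" and st: "a \<le> s" "s \<le> t" "t \<le> b"
  shows "integral {a..s} k \<le> integral {a..t} k"
proof -
  have "0 \<le> integral {s..t} k"
    using st k(2) by (intro integral_nonneg integrable_on_subinterval[OF k(1)]) auto
  then show ?thesis using integral_diff_Icc[OF k(1) st] by simp
qed

lemma indefinite_integral_nonneg:
  fixes k :: "real \<Rightarrow> real"
  assumes "k integrable_on {a..b}" "\<And>t. t \<in> {a..b} \<Longrightarrow> 0 \<le> k t" "t \<in> {a..b}"
  shows "0 \<le> integral {a..t} k"
  using indefinite_integral_mono[OF assms(1,2), of a t] assms(3) by simp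

lemma drift_cong: "(\<And>s. s \<in> {T0..T} \<Longrightarrow> x s = y s) \<Longrightarrow> t \<in> {T0..T} \<Longrightarrow> drift T0 f g x t = drift T0 f g y t"
  unfolding drift_def by (intro arg_cong2[of _ _ _ _ "(+)"] integral_cong) auto

definition growth_bound ::
  "real \<Rightarrow> (real \<Rightarrow> real) \<Rightarrow> (real \<Rightarrow> real \<Rightarrow> real) \<Rightarrow> 'a::real_normed_vector \<Rightarrow> real \<Rightarrow> real" where
  "growth_bound T0 \<beta> \<sigma> x0 t = (1 + norm x0) * exp (integral {T0..t} (growth_rate T0 \<beta> \<sigma>))"

context
  fixes T0 T :: real and C :: "'h::{real_inner, banach} set"
    and f :: "real \<Rightarrow> 'h \<Rightarrow> 'h" and g :: "real \<Rightarrow> real \<Rightarrow> 'h \<Rightarrow> 'h"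
    and \<beta> :: "real \<Rightarrow> real" and \<sigma> :: "real \<Rightarrow> real \<Rightarrow> real" and x0 :: 'h
  assumes T: "T0 < T" and C: "C \<noteq> {}" "closed C" "convex C" "x0 \<in> C"
    and f: "cond_f T0 T f \<beta>" and g: "cond_g T0 T g \<sigma>"
begin

lemma growth_rate_integrable_nonneg: "growth_rate T0 \<beta> \<sigma> integrable_on {T0..T}" "t \<in> {T0..T} \<Longrightarrow> 0 \<le> growth_rate T0 \<beta> \<sigma> t"
  using growth_rate_integrable[OF T f g] growth_rate_nonneg[OF T f g] by auto

lemma growth_bound_mono:
  assumes "T0 \<le> s" "s \<le> t" "t \<le> T"
  shows "growth_bound T0 \<beta> \<sigma> x0 s \<le> growth_bound T0 \<beta> \<sigma> x0 t"
  unfolding growth_bound_def using indefinite_integral_mono[OF growth_rate_integrable_nonneg assms] by (intro mult_left_mono) auto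

lemma projected_trajectory_unique:
  assumes x: "projected_trajectory T0 T C (drift T0 f g x) x" and y: "projected_trajectory T0 T C (drift T0 f g y) y"
    and init: "x T0 = y T0" and t: "t \<in> {T0..T}"
  shows "x t = y t"
proof -
  have xc: "continuous_on {T0..T} x" and yc: "continuous_on {T0..T} y"
    using x y absolutely_continuous_fun_on_imp_continuous_on unfolding projected_trajectory_def by blast+
  have "compact (x ` {T0..T} \<union> y ` {T0..T})" using xc yc by (intro compact_Un compact_continuous_image) auto
  then obtain R where R: "R > 0" "\<And>v. v \<in> x ` {T0..T} \<union> y ` {T0..T} \<Longrightarrow> norm v \<le> R"
    using compact_imp_bounded bounded_pos by metis
  have xyR: "norm (x s) \<le> R" "norm (y s) \<le> R" if "s \<in> {T0..T}" for s using R(2) that by auto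
  from drift_diff_le[OF T f g R(1)] obtain k where kk: "k integrable_on {T0..T} \<and> (\<forall>t\<in>{T0..T}. 0 \<le> k t) \<and>
    (\<forall>x y c. continuous_on {T0..T} x \<longrightarrow> continuous_on {T0..T} y \<longrightarrow>
      (\<forall>t\<in>{T0..T}. norm (x t) \<le> R \<and> norm (y t) \<le> R \<and> norm (x t - y t) \<le> c t) \<longrightarrow>
      (\<forall>s t. T0 \<le> s \<longrightarrow> s \<le> t \<longrightarrow> t \<le> T \<longrightarrow> c s \<le> c t) \<longrightarrow>
      (\<exists>N. negligible N \<and> (\<forall>t\<in>{T0..T} - N. norm (drift T0 f g x t - drift T0 f g y t) \<le> k t * c t)))" ..
  then have k: "k integrable_on {T0..T}" "\<And>t. t \<in> {T0..T} \<Longrightarrow> 0 \<le> k t" by auto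
  note lip = kk[THEN conjunct2, THEN conjunct2, THEN spec, THEN spec, THEN spec, THEN mp, THEN mp, THEN mp, THEN mp]
  define E where "E t = exp (2 * integral {T0..t} k)" for t
  have Em: "E s \<le> E t" if "T0 \<le> s" "s \<le> t" "t \<le> T" for s t
    using indefinite_integral_mono[OF k that] by (simp add: E_def)
  have E1: "1 \<le> E s" if "s \<in> {T0..T}" for s
    using indefinite_integral_nonneg[OF k that] by (simp add: E_def)
  have "\<forall>s\<in>{T0..T}. norm (x s - y s) \<le> 2 * R / 2 ^ n * E s" for n
  proof (induction n)
    case 0
    show ?case
    proof
      fix s assume s: "s \<in> {T0..T}"
      have "norm (x s - y s) \<le> 2 * R * 1"
        using norm_triangle_ineq4[of "x s" "y s"] xyR[OF s] by linarith
      also have "\<dots> \<le> 2 * R * E s" using E1[OF s] R(1) by (intro mult_left_mono) auto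
      finally show "norm (x s - y s) \<le> 2 * R / 2 ^ 0 * E s" by simp
    qed
  next
    case (Suc n)
    let ?c = "2 * R / 2 ^ n"
    have "\<exists>N. negligible N \<and> (\<forall>t\<in>{T0..T} - N. norm (drift T0 f g x t - drift T0 f g y t) \<le> k t * (?c * E t))"
    proof (rule lip[OF xc yc])
      show "\<forall>t\<in>{T0..T}. norm (x t) \<le> R \<and> norm (y t) \<le> R \<and> norm (x t - y t) \<le> ?c * E t"
        using xyR Suc by simp
      show "\<forall>s t. T0 \<le> s \<longrightarrow> s \<le> t \<longrightarrow> t \<le> T \<longrightarrow> ?c * E s \<le> ?c * E t"
        using R(1) by (intro allI impI mult_left_mono Em) auto
    qed
    then have "norm (x s - y s) \<le> ?c / 2 * E s" if "s \<in> {T0..T}" for s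
      unfolding E_def using R(1) by (intro weighted_contraction[OF C(3) k _ _ x y init that]) auto
    then show ?case by simp
  qed
  then have "norm (x t - y t) \<le> (2 * R * E t) / 2 ^ n" for n using t by (metis times_divide_eq_left)
  then have "norm (x t - y t) \<le> 0" by (rule le_0_of_le_half_powers)
  then show ?thesis by simp
qed

lemma projected_trajectory_step:
  assumes x: "continuous_on {T0..T} x" "\<And>t. t \<in> {T0..T} \<Longrightarrow> 1 + norm (x t) \<le> growth_bound T0 \<beta> \<sigma> x0 t"
  shows "\<exists>X. X T0 = x0 \<and> projected_trajectory T0 T C (drift T0 f g x) X \<and>
    continuous_on {T0..T} X \<and> (\<forall>t\<in>{T0..T}. 1 + norm (X t) \<le> growth_bound T0 \<beta> \<sigma> x0 t)"
proof -
  obtain X where X: "X T0 = x0" "projected_trajectory T0 T C (drift T0 f g x) X"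
    using projected_trajectory_exists[OF T C drift_bochner_integrable(1)[OF T f g x(1)]] by blast
  have Xc: "continuous_on {T0..T} X"
    using X(2) absolutely_continuous_fun_on_imp_continuous_on unfolding projected_trajectory_def by blast
  obtain N where N: "negligible N" "\<forall>t\<in>{T0..T} - N. norm (drift T0 f g x t) \<le> growth_rate T0 \<beta> \<sigma> t / 2 * growth_bound T0 \<beta> \<sigma> x0 t"
    using norm_drift_le[OF T f g x growth_bound_mono] by blast
  have g0: "0 \<le> growth_bound T0 \<beta> \<sigma> x0 t" for t by (simp add: growth_bound_def)
  have I: "((\<lambda>s. growth_rate T0 \<beta> \<sigma> s * growth_bound T0 \<beta> \<sigma> x0 s) has_integral (growth_bound T0 \<beta> \<sigma> x0 t - (1 + norm x0))) {T0..t}" if "t \<in> {T0..T}" for t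
    using has_integral_mult_right[OF has_integral_exp_indefinite_integral[OF growth_rate_integrable_nonneg that, of 1], of "1 + norm x0"]
    by (simp add: growth_bound_def mult_ac right_diff_distrib)
  have "1 + norm (X t) \<le> growth_bound T0 \<beta> \<sigma> x0 t" if t: "t \<in> {T0..T}" for t
  proof -
    have "norm (X t - X T0) \<le> integral {T0..t} (\<lambda>s. growth_rate T0 \<beta> \<sigma> s * growth_bound T0 \<beta> \<sigma> x0 s)"
    proof (rule projected_trajectory_norm_le[OF C(3) X(2) N(1) _ has_integral_integrable[OF I[of T]] t])
      fix s assume s: "s \<in> {T0..T} - N"
      have "growth_rate T0 \<beta> \<sigma> s / 2 * growth_bound T0 \<beta> \<sigma> x0 s \<le> growth_rate T0 \<beta> \<sigma> s * growth_bound T0 \<beta> \<sigma> x0 s"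
        using growth_rate_integrable_nonneg(2)[of s] s g0 by (intro mult_right_mono) auto
      then show "norm (drift T0 f g x s) \<le> growth_rate T0 \<beta> \<sigma> s * growth_bound T0 \<beta> \<sigma> x0 s" using N(2) s by force
    qed (use T in simp)
    then show ?thesis using norm_triangle_sub[of "X t" x0] X(1) by (simp add: integral_unique[OF I[OF t]])
  qed
  with X Xc show ?thesis by blast
qed

lemma projected_trajectory_fixed_point:
  "\<exists>x. x T0 = x0 \<and> projected_trajectory T0 T C (drift T0 f g x) x \<and>
    continuous_on {T0..T} x \<and> (\<forall>t\<in>{T0..T}. 1 + norm (x t) \<le> growth_bound T0 \<beta> \<sigma> x0 t)"
proof -
  define good where "good x \<longleftrightarrow> continuous_on {T0..T} x \<and> (\<forall>t\<in>{T0..T}. 1 + norm (x t) \<le> growth_bound T0 \<beta> \<sigma> x0 t)" for x :: "real \<Rightarrow> 'h"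
  have "\<forall>x. \<exists>X. good x \<longrightarrow> X T0 = x0 \<and> projected_trajectory T0 T C (drift T0 f g x) X \<and> good X"
    using projected_trajectory_step unfolding good_def by blast
  from choice[OF this] obtain nxt where nxt:
    "\<forall>x. good x \<longrightarrow> nxt x T0 = x0 \<and> projected_trajectory T0 T C (drift T0 f g x) (nxt x) \<and> good (nxt x)" ..
  define R where "R = growth_bound T0 \<beta> \<sigma> x0 T"
  have R: "R > 0" unfolding R_def growth_bound_def by (simp add: add_pos_nonneg)
  have goodR: "norm (x t) \<le> R" if "good x" "t \<in> {T0..T}" for x t
  proof -
    have "1 + norm (x t) \<le> growth_bound T0 \<beta> \<sigma> x0 t" using that by (simp add: good_def)
    also have "\<dots> \<le> R" unfolding R_def using that by (intro growth_bound_mono) auto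
    finally show ?thesis by simp
  qed
  from drift_diff_le[OF T f g R] obtain k where kk: "k integrable_on {T0..T} \<and> (\<forall>t\<in>{T0..T}. 0 \<le> k t) \<and>
    (\<forall>x y c. continuous_on {T0..T} x \<longrightarrow> continuous_on {T0..T} y \<longrightarrow>
      (\<forall>t\<in>{T0..T}. norm (x t) \<le> R \<and> norm (y t) \<le> R \<and> norm (x t - y t) \<le> c t) \<longrightarrow>
      (\<forall>s t. T0 \<le> s \<longrightarrow> s \<le> t \<longrightarrow> t \<le> T \<longrightarrow> c s \<le> c t) \<longrightarrow>
      (\<exists>N. negligible N \<and> (\<forall>t\<in>{T0..T} - N. norm (drift T0 f g x t - drift T0 f g y t) \<le> k t * c t)))" ..
  then have k: "k integrable_on {T0..T}" "\<And>t. t \<in> {T0..T} \<Longrightarrow> 0 \<le> k t" by auto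
  note lip = kk[THEN conjunct2, THEN conjunct2, THEN spec, THEN spec, THEN spec, THEN mp, THEN mp, THEN mp, THEN mp]
  define E where "E t = exp (2 * integral {T0..t} k)" for t
  have Em: "E s \<le> E t" if "T0 \<le> s" "s \<le> t" "t \<le> T" for s t
    using indefinite_integral_mono[OF k that] by (simp add: E_def)
  have E1: "1 \<le> E s" if "s \<in> {T0..T}" for s
    using indefinite_integral_nonneg[OF k that] by (simp add: E_def)
  have contr: "norm (nxt x t - nxt y t) \<le> c / 2 * E t"
    if x: "good x" and y: "good y" and c: "0 \<le> c" and le: "\<forall>t\<in>{T0..T}. norm (x t - y t) \<le> c * E t" and t: "t \<in> {T0..T}" for x y c t
  proof -
    have "\<exists>N. negligible N \<and> (\<forall>t\<in>{T0..T} - N. norm (drift T0 f g x t - drift T0 f g y t) \<le> k t * (c * E t))"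
    proof (rule lip)
      show "continuous_on {T0..T} x" "continuous_on {T0..T} y" using x y by (simp_all add: good_def)
      show "\<forall>t\<in>{T0..T}. norm (x t) \<le> R \<and> norm (y t) \<le> R \<and> norm (x t - y t) \<le> c * E t"
        using goodR[OF x] goodR[OF y] le by simp
      show "\<forall>s t. T0 \<le> s \<longrightarrow> s \<le> t \<longrightarrow> t \<le> T \<longrightarrow> c * E s \<le> c * E t"
        using c by (intro allI impI mult_left_mono Em) auto
    qed
    then show ?thesis
      unfolding E_def using nxt x y by (intro weighted_contraction[OF C(3) k c _ _ _ _ t]) auto
  qed
  define xs where "xs n = (nxt ^^ n) (\<lambda>_. x0)" for n
  have xs_Suc: "xs (Suc n) = nxt (xs n)" for n by (simp add: xs_def)
  have good0: "good (\<lambda>_. x0)"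
  proof -
    have "1 + norm x0 \<le> growth_bound T0 \<beta> \<sigma> x0 t" if "t \<in> {T0..T}" for t
      unfolding growth_bound_def using indefinite_integral_nonneg[OF growth_rate_integrable_nonneg that]
        mult_left_mono[of 1 "exp (integral {T0..t} (growth_rate T0 \<beta> \<sigma>))" "1 + norm x0"] by simp
    then show ?thesis by (simp add: good_def)
  qed
  have good: "good (xs n)" for n
  proof (induction n)
    case 0
    then show ?case using good0 by (simp add: xs_def)
  qed (use nxt xs_Suc in auto)
  have step: "\<forall>t\<in>{T0..T}. norm (xs (Suc n) t - xs n t) \<le> 2 * R / 2 ^ n * E t" for n
  proof (induction n)
    case 0
    show ?case
    proof
      fix t assume t: "t \<in> {T0..T}"
      have "norm (xs (Suc 0) t - xs 0 t) \<le> 2 * R * 1"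
        using norm_triangle_ineq4[of "xs (Suc 0) t" "xs 0 t"] goodR[OF good t, of 0] goodR[OF good t, of "Suc 0"] by linarith
      also have "\<dots> \<le> 2 * R * E t" using E1[OF t] R by (intro mult_left_mono) auto
      finally show "norm (xs (Suc 0) t - xs 0 t) \<le> 2 * R / 2 ^ 0 * E t" by simp
    qed
  next
    case (Suc n)
    show ?case
    proof
      fix t assume t: "t \<in> {T0..T}"
      have "norm (nxt (xs (Suc n)) t - nxt (xs n) t) \<le> (2 * R / 2 ^ n) / 2 * E t"
        using R by (intro contr good Suc t) auto
      then show "norm (xs (Suc (Suc n)) t - xs (Suc n) t) \<le> 2 * R / 2 ^ Suc n * E t" by (simp add: xs_Suc)
    qed
  qed
  have tail: "norm (xs (n + m) t - xs n t) \<le> 4 * R / 2 ^ n * (1 - 1 / 2 ^ m) * E t" if t: "t \<in> {T0..T}" for n m t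
  proof (induction m)
    case (Suc m)
    have "norm (xs (n + Suc m) t - xs n t) \<le> norm (xs (Suc (n + m)) t - xs (n + m) t) + norm (xs (n + m) t - xs n t)"
      using norm_triangle_ineq[of "xs (Suc (n + m)) t - xs (n + m) t" "xs (n + m) t - xs n t"] by simp
    also have "\<dots> \<le> 2 * R / 2 ^ (n + m) * E t + 4 * R / 2 ^ n * (1 - 1 / 2 ^ m) * E t"
      using step[of "n + m"] t Suc by (intro add_mono) auto
    also have "\<dots> = 4 * R / 2 ^ n * (1 - 1 / 2 ^ Suc m) * E t" by (simp add: power_add field_simps)
    finally show ?case .
  qed simp
  have tail': "norm (xs (n + m) t - xs n t) \<le> 4 * R / 2 ^ n * E t" if t: "t \<in> {T0..T}" for n m t
  proof -
    have "4 * R / 2 ^ n * (1 - 1 / 2 ^ m) * E t \<le> 4 * R / 2 ^ n * 1 * E t"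
      using R E1[OF t] by (intro mult_right_mono mult_left_mono) auto
    then show ?thesis using tail[OF t, of n m] by simp
  qed
  have small: "\<exists>M. \<forall>n\<ge>M. 4 * R / 2 ^ n * E T < e" if e: "e > 0" for e
  proof -
    have "(\<lambda>n. 4 * R * E T * (1 / 2) ^ n) \<longlonglongrightarrow> 4 * R * E T * 0" by (intro tendsto_intros LIMSEQ_realpow_zero) auto
    then have "eventually (\<lambda>n. 4 * R * E T * (1 / 2) ^ n < e) sequentially" using e by (intro order_tendstoD(2)) auto
    then show ?thesis unfolding eventually_sequentially by (simp add: power_one_over mult_ac)
  qed
  have cau: "Cauchy (\<lambda>n. xs n t)" if t: "t \<in> {T0..T}" for t
  proof (rule metric_CauchyI)
    fix e :: real assume e: "e > 0"
    obtain M where M: "\<forall>n\<ge>M. 4 * R / 2 ^ n * E T < e / 2" using small[of "e/2"] e by auto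
    have "dist (xs n t) (xs M t) < e / 2" if "n \<ge> M" for n
    proof -
      have "norm (xs (M + (n - M)) t - xs M t) \<le> 4 * R / 2 ^ M * E t" by (rule tail'[OF t])
      also have "\<dots> \<le> 4 * R / 2 ^ M * E T" using R Em[of t T] t by (intro mult_left_mono) auto
      also have "\<dots> < e / 2" using M by simp
      finally show ?thesis using that by (simp add: dist_norm)
    qed
    then have "dist (xs m t) (xs n t) < e" if "m \<ge> M" "n \<ge> M" for m n
      using that dist_triangle_half_l[of "xs m t" "xs M t" e "xs n t"] by blast
    then show "\<exists>M. \<forall>m\<ge>M. \<forall>n\<ge>M. dist (xs m t) (xs n t) < e" by blast
  qed
  define x where "x t = lim (\<lambda>n. xs n t)" for t
  have lim: "(\<lambda>n. xs n t) \<longlonglongrightarrow> x t" if "t \<in> {T0..T}" for t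
    unfolding x_def using Cauchy_convergent[OF cau[OF that]] by (simp add: convergent_LIMSEQ_iff)
  have xd: "norm (x t - xs n t) \<le> 4 * R / 2 ^ n * E t" if t: "t \<in> {T0..T}" for t n
  proof (rule LIMSEQ_le_const2)
    show "(\<lambda>m. norm (xs (m + n) t - xs n t)) \<longlonglongrightarrow> norm (x t - xs n t)"
      by (intro tendsto_intros LIMSEQ_ignore_initial_segment lim t)
    show "\<exists>N. \<forall>m\<ge>N. norm (xs (m + n) t - xs n t) \<le> 4 * R / 2 ^ n * E t"
      using tail'[OF t, of n] by (simp add: add.commute)
  qed
  have "uniform_limit {T0..T} xs x sequentially"
  proof (rule uniform_limitI)
    fix e :: real assume "e > 0"
    from small[OF this] obtain M where M: "\<forall>n\<ge>M. 4 * R / 2 ^ n * E T < e" ..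
    have "dist (xs n t) (x t) < e" if "n \<ge> M" "t \<in> {T0..T}" for n t
    proof -
      have "dist (xs n t) (x t) \<le> 4 * R / 2 ^ n * E t" using xd[OF that(2), of n] by (simp add: dist_norm norm_minus_commute)
      also have "\<dots> \<le> 4 * R / 2 ^ n * E T" using R Em[of t T] that by (intro mult_left_mono) auto
      also have "\<dots> < e" using M that by simp
      finally show ?thesis .
    qed
    then show "\<forall>\<^sub>F n in sequentially. \<forall>t\<in>{T0..T}. dist (xs n t) (x t) < e"
      unfolding eventually_sequentially by blast
  qed
  then have xc: "continuous_on {T0..T} x"
    by (rule uniform_limit_theorem[rotated]) (use good in \<open>auto simp: good_def\<close>)
  have gx: "good x"
    unfolding good_def
  proof (intro conjI xc ballI)
    fix t assume t: "t \<in> {T0..T}"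
    show "1 + norm (x t) \<le> growth_bound T0 \<beta> \<sigma> x0 t"
    proof (rule LIMSEQ_le_const2)
      show "(\<lambda>n. 1 + norm (xs n t)) \<longlonglongrightarrow> 1 + norm (x t)" by (intro tendsto_intros lim t)
      show "\<exists>N. \<forall>n\<ge>N. 1 + norm (xs n t) \<le> growth_bound T0 \<beta> \<sigma> x0 t" using good t by (simp add: good_def)
    qed
  qed
  have eq: "nxt x t = x t" if t: "t \<in> {T0..T}" for t
  proof -
    have "norm (nxt x t - x t) \<le> (4 * R * E t) / 2 ^ n" for n
    proof -
      have "norm (nxt x t - nxt (xs n) t) \<le> (4 * R / 2 ^ n) / 2 * E t"
        using R xd by (intro contr gx good t) auto
      moreover have "norm (x t - xs (Suc n) t) \<le> 4 * R / 2 ^ Suc n * E t" by (rule xd[OF t])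
      moreover have "norm (nxt x t - x t) \<le> norm (nxt x t - nxt (xs n) t) + norm (x t - xs (Suc n) t)"
        unfolding xs_Suc by norm
      moreover have "(4 * R / 2 ^ n) / 2 * E t + 4 * R / 2 ^ Suc n * E t = (4 * R * E t) / 2 ^ n" by (simp add: field_simps)
      ultimately show ?thesis by linarith
    qed
    then have "norm (nxt x t - x t) \<le> 0" by (rule le_0_of_le_half_powers)
    then show ?thesis by simp
  qed
  have n: "nxt x T0 = x0" "projected_trajectory T0 T C (drift T0 f g x) (nxt x)" "good (nxt x)" using nxt gx by auto
  have "drift T0 f g (nxt x) t = drift T0 f g x t" if "t \<in> {T0..T}" for t using eq that by (rule drift_cong)
  then have "projected_trajectory T0 T C (drift T0 f g (nxt x)) (nxt x)"
    using n(2) unfolding projected_trajectory_def by auto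
  then show ?thesis using n(1,3) unfolding good_def by blast
qed

end

theorem proposition6p2:
  fixes T0 T :: real
    and C :: "'h::{real_inner, banach} set"
    and f :: "real \<Rightarrow> 'h \<Rightarrow> 'h"
    and g :: "real \<Rightarrow> real \<Rightarrow> 'h \<Rightarrow> 'h"
    and \<beta> :: "real \<Rightarrow> real"
    and \<sigma> :: "real \<Rightarrow> real \<Rightarrow> real"
    and x0 :: 'h
  assumes "T0 < T"
    and "C \<noteq> {}" and "closed C" and "convex C"
    and "cond_f T0 T f \<beta>"
    and "cond_g T0 T g \<sigma>"
    and "x0 \<in> C"
  shows "let \<gamma> = (\<lambda>t. 2 * \<beta> t + 2 * integral {T0..t} (\<lambda>s. \<sigma> t s));
             r = (\<lambda>t. norm x0 * exp (integral {T0..t} \<gamma>)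
                    + integral {T0..t} (\<lambda>s. \<gamma> s * exp (integral {s..t} \<gamma>)));
             \<theta> = (\<lambda>t. \<gamma> t * (1 + r t))
         in \<exists>x. projected_solution T0 T C f g x0 x
              \<and> (\<forall>y. projected_solution T0 T C f g x0 y \<longrightarrow> (\<forall>t\<in>{T0..T}. y t = x t))
              \<and> slow_solution T0 T C f g x0 x
              \<and> (\<forall>t\<in>{T0..T}. norm (x t) \<le> r t)
              \<and> (AE t in lebesgue_on {T0..T}.
                    norm (vector_derivative x (at t within {T0..T})) \<le> \<theta> t)"
proof -
  note C = assms(2-4,7)
  define \<gamma> where "\<gamma> = growth_rate T0 \<beta> \<sigma>"
  define r where "r = (\<lambda>t. norm x0 * exp (integral {T0..t} \<gamma>)
                    + integral {T0..t} (\<lambda>s. \<gamma> s * exp (integral {s..t} \<gamma>)))"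
  have \<gamma>_eq: "\<gamma> = (\<lambda>t. 2 * \<beta> t + 2 * integral {T0..t} (\<lambda>s. \<sigma> t s))"
    by (simp add: \<gamma>_def growth_rate_def)
  have \<gamma>: "\<gamma> integrable_on {T0..T}" "\<And>t. t \<in> {T0..T} \<Longrightarrow> 0 \<le> \<gamma> t"
    unfolding \<gamma>_def using growth_rate_integrable[OF assms(1,5,6)] growth_rate_nonneg[OF assms(1,5,6)] by auto
  define w where "w t = (1 + norm x0) * exp (integral {T0..t} \<gamma>)" for t
  have wr: "w t = 1 + r t" if t: "t \<in> {T0..T}" for t
  proof -
    let ?\<Gamma> = "\<lambda>t. integral {T0..t} \<gamma>"
    have "((\<lambda>s. - exp (?\<Gamma> t) * (\<gamma> s * (- 1 * exp (- 1 * ?\<Gamma> s)))) has_integral - exp (?\<Gamma> t) * (exp (- 1 * ?\<Gamma> t) - 1)) {T0..t}"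
      by (intro has_integral_mult_right has_integral_exp_indefinite_integral[OF \<gamma> t])
    moreover have "- exp (?\<Gamma> t) * (exp (- 1 * ?\<Gamma> t) - 1) = exp (?\<Gamma> t) - 1"
      by (simp add: right_diff_distrib exp_minus_inverse)
    moreover have "- exp (?\<Gamma> t) * (\<gamma> s * (- 1 * exp (- 1 * ?\<Gamma> s))) = \<gamma> s * exp (integral {s..t} \<gamma>)"
      if "s \<in> {T0..t}" for s
    proof -
      have "?\<Gamma> t = ?\<Gamma> s + integral {s..t} \<gamma>" using integral_diff_Icc[OF \<gamma>(1), of s t] that t by simp
      then show ?thesis by (simp add: exp_add exp_minus)
    qed
    ultimately have "((\<lambda>s. \<gamma> s * exp (integral {s..t} \<gamma>)) has_integral (exp (?\<Gamma> t) - 1)) {T0..t}"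
      using has_integral_cong by (metis (no_types, lifting))
    then show ?thesis by (simp add: w_def r_def integral_unique algebra_simps)
  qed
  from projected_trajectory_fixed_point[OF assms(1) C assms(5,6)]
  obtain x where x: "x T0 = x0" "projected_trajectory T0 T C (drift T0 f g x) x"
    "continuous_on {T0..T} x" "\<forall>t\<in>{T0..T}. 1 + norm (x t) \<le> w t"
    unfolding growth_bound_def w_def \<gamma>_def by blast
  have ac: "absolutely_continuous_fun_on x {T0..T}" using x(2) by (simp add: projected_trajectory_def)
  obtain N where N: "negligible N" "\<And>t. t \<in> {T0..T} - N \<Longrightarrow> x t \<in> C \<and>
      (x has_vector_derivative metric_proj (tangent_cone C (x t)) (drift T0 f g x t)) (at t within {T0..T})"
    using x(2) unfolding projected_trajectory_def by blast
  have ps: "projected_solution T0 T C f g x0 y \<longleftrightarrow> y T0 = x0 \<and> projected_trajectory T0 T C (drift T0 f g y) y" for y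
    unfolding projected_solution_def projected_trajectory_def AE_lebesgue_on_Icc_iff by blast
  have uniq: "\<forall>y. projected_solution T0 T C f g x0 y \<longrightarrow> (\<forall>t\<in>{T0..T}. y t = x t)"
    unfolding ps using projected_trajectory_unique[OF assms(1) C assms(5,6)] x(1,2) by metis
  have slow: "slow_solution T0 T C f g x0 x"
    unfolding slow_solution_def AE_lebesgue_on_Icc_iff
  proof (intro conjI ac x(1) exI[of _ N] N(1) ballI)
    fix t assume t: "t \<in> {T0..T} - N"
    let ?h = "drift T0 f g x t"
    let ?p = "metric_proj (tangent_cone C (x t)) ?h"
    have xt: "x t \<in> C" using N(2)[OF t] by blast
    have "is_arg_min (\<lambda>\<nu>. norm (?h - \<nu>)) (\<lambda>\<nu>. \<nu> \<in> normal_cone C (x t)) (?h - ?p)"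
      by (rule moreau_decomposition(2)[OF C(3) xt metric_proj_tangent_cone(2,1,3)[OF C(3) xt]])
    then show "\<exists>\<nu>. is_arg_min (\<lambda>\<nu>. norm (?h - \<nu>)) (\<lambda>\<nu>. \<nu> \<in> normal_cone C (x t)) \<nu> \<and>
        (x has_vector_derivative (- \<nu> + ?h)) (at t within {T0..T})"
      using N(2)[OF t] by (intro exI[of _ "?h - ?p"]) simp
  qed
  have bound: "\<forall>t\<in>{T0..T}. norm (x t) \<le> r t" using x(4) wr by fastforce
  have wmono: "w s \<le> w t" if "T0 \<le> s" "s \<le> t" "t \<le> T" for s t
    unfolding w_def using indefinite_integral_mono[OF \<gamma> that] by (intro mult_left_mono) auto
  obtain N' where N': "negligible N'" "\<forall>t\<in>{T0..T} - N'. norm (drift T0 f g x t) \<le> \<gamma> t / 2 * w t"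
    using norm_drift_le[OF assms(1,5,6) x(3), of w] x(4) wmono unfolding \<gamma>_def by blast
  have deriv: "AE t in lebesgue_on {T0..T}. norm (vector_derivative x (at t within {T0..T})) \<le> \<gamma> t * (1 + r t)"
    unfolding AE_lebesgue_on_Icc_iff
  proof (intro exI[of _ "N \<union> N'"] conjI ballI)
    show "negligible (N \<union> N')" using N(1) N'(1) by simp
    fix t assume t: "t \<in> {T0..T} - (N \<union> N')"
    then have tI: "t \<in> {T0..T}" and d: "x t \<in> C \<and>
      (x has_vector_derivative metric_proj (tangent_cone C (x t)) (drift T0 f g x t)) (at t within {T0..T})"
      using N(2) by auto
    have "vector_derivative x (at t within {T0..T}) = metric_proj (tangent_cone C (x t)) (drift T0 f g x t)"
      using vector_derivative_within_cbox[OF assms(1), of t x] tI d by simp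
    then have "norm (vector_derivative x (at t within {T0..T})) \<le> norm (drift T0 f g x t)"
      using metric_proj_tangent_cone(4)[OF C(3)] d by simp
    also have "\<dots> \<le> \<gamma> t / 2 * w t" using N'(2) t by blast
    also have "\<dots> \<le> \<gamma> t * w t" using \<gamma>(2)[OF tI] by (intro mult_right_mono) (auto simp: w_def)
    finally show "norm (vector_derivative x (at t within {T0..T})) \<le> \<gamma> t * (1 + r t)" using wr[OF tI] by simp
  qed
  show ?thesis
    unfolding Let_def
  proof (intro exI[of _ x] conjI uniq slow)
    show "projected_solution T0 T C f g x0 x" using ps x(1,2) by blast
  qed (fact bound[unfolded r_def \<gamma>_eq] deriv[unfolded r_def \<gamma>_eq])+
qed

end
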